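(* Let $a\ge 0$ and let $X_1,X_2,\ldots$ be an i.i.d. sequence of random variables with $X_1\sim\mathrm{Exp}(1)$, i.e. with density $e^{-x}$, $x>0$. Then there exists a centred Gaussian process (Gaussian random element) $Z$ in $\mathbb{H}_a$ with covariance kernel $$K_0(s,t)=\exp(-\max(s,t))-\exp(-(s+t)),\quad s,t>0,$$ such that $$T_{n,a}\stackrel{\mathcal{D}}{\longrightarrow}\|Z\|_{\mathbb{H}_a}^2\quad\text{as } n\to\infty,$$ where $\stackrel{\mathcal{D}}{\longrightarrow}$ denotes convergence in distribution.
   Context: For $a\ge0$, $\mathbb{H}_a=L^2([0,\infty),\mathcal{B},\exp(-at)\,dt)$ is the separable Hilbert space of (equivalence classes of) measurable functions $f:[0,\infty)\to\mathbb{R}$ with $\int_0^\infty |f(t)|^2\exp(-at)\,dt<\infty$, where $\mathcal{B}$ is the Borel sigma-field on $[0,\infty)$, with scalar product $\langle f,g\rangle_{\mathbb{H}_a}=\int_0^\infty f(t)g(t)\exp(-at)\,dt$ and norm $\|f\|_{\mathbb{H}_a}=\langle f,f\rangle_{\mathbb{H}_a}^{1/2}$. A centred Gaussian process $Z$ in $\mathbb{H}_a$ has covariance kernel $K$ if $\mathbb{E}[\langle Z,f\rangle_{\mathbb{H}_a}\langle Z,g\rangle_{\mathbb{H}_a}]=\int_0^\infty\int_0^\infty K(s,t)f(s)g(t)\exp(-a(s+t))\,ds\,dt$ for all $f,g\in\mathbb{H}_a$. For positive random variables $X_1,\ldots,X_n$ put $\overline{X}_n=\frac1n\sum_{j=1}^nX_j$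 and $Y_j=X_j/\overline{X}_n$, $j=1,\ldots,n$ (scaled data; depending on $n$). The test statistic is $$T_{n,a}=n\int_0^\infty\left|\frac1n\sum_{j=1}^n(Y_j-y-1)\mathbf{1}\{Y_j>y\}\right|^2\exp(-ay)\,dy,\quad a\ge0.$$ *)

theory Defs
  imports "HOL-Probability.Probability"
begin

definition mu :: "real \<Rightarrow> real measure" where
  "mu a = density (restrict_space lborel {0..}) (\<lambda>t. ennreal (exp (- a * t)))"

text \<open>The space \<open>L\<^sup>2([0,\<infinity>), exp(-at) dt)\<close> is represented by square-integrable functions rather than by
  equivalence classes.  Hence \<open>Ha_norm\<close> is a seminorm: it vanishes exactly on the functions that are
  almost everywhere zero on \<open>[0,\<infinity>)\<close>.  The values of a function on the negative half-line play no role.\<close>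

definition Ha :: "real \<Rightarrow> (real \<Rightarrow> real) set" where
  "Ha a = {f \<in> borel_measurable (mu a). integrable (mu a) (\<lambda>t. (f t)\<^sup>2)}"

definition Ha_inner :: "real \<Rightarrow> (real \<Rightarrow> real) \<Rightarrow> (real \<Rightarrow> real) \<Rightarrow> real" where
  "Ha_inner a f g = (\<integral>t. f t * g t \<partial>mu a)"

definition Ha_norm :: "real \<Rightarrow> (real \<Rightarrow> real) \<Rightarrow> real" where
  "Ha_norm a f = sqrt (Ha_inner a f f)"

text \<open>Norm-open sets of representatives are automatically closed under almost-everywhere equality,
  so they are precisely the preimages of the open sets of the Hilbert space of equivalence classes,
  and \<open>Ha_borel\<close> is the preimage of its Borel sigma-field.\<close>

definition Ha_open :: "real \<Rightarrow> (real \<Rightarrow> real) set \<Rightarrow> bool" where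
  "Ha_open a U \<longleftrightarrow> U \<subseteq> Ha a \<and>
     (\<forall>f\<in>U. \<exists>e>0. \<forall>g\<in>Ha a. Ha_norm a (\<lambda>t. g t - f t) < e \<longrightarrow> g \<in> U)"

definition Ha_borel :: "real \<Rightarrow> (real \<Rightarrow> real) measure" where
  "Ha_borel a = sigma (Ha a) {U. Ha_open a U}"

text \<open>Normal laws include the degenerate ones (standard deviation 0), as is needed for Gaussian
  elements of a Hilbert space.\<close>

definition normal_rv :: "'w measure \<Rightarrow> ('w \<Rightarrow> real) \<Rightarrow> real \<Rightarrow> real \<Rightarrow> bool" where
  "normal_rv P Y m s \<longleftrightarrow>
     (if s = 0 then Y \<in> borel_measurable P \<and> (AE w in P. Y w = m)
      else s > 0 \<and> distributed P lborel Y (\<lambda>x. ennreal (normal_density m s x)))"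

definition gaussian_element :: "'w measure \<Rightarrow> real \<Rightarrow> ('w \<Rightarrow> real \<Rightarrow> real) \<Rightarrow> bool" where
  "gaussian_element P a Z \<longleftrightarrow>
     Z \<in> measurable P (Ha_borel a) \<and>
     (\<forall>f\<in>Ha a. \<exists>m s. normal_rv P (\<lambda>w. Ha_inner a (Z w) f) m s)"

definition centred :: "'w measure \<Rightarrow> real \<Rightarrow> ('w \<Rightarrow> real \<Rightarrow> real) \<Rightarrow> bool" where
  "centred P a Z \<longleftrightarrow>
     (\<forall>f\<in>Ha a. integrable P (\<lambda>w. Ha_inner a (Z w) f) \<and> (\<integral>w. Ha_inner a (Z w) f \<partial>P) = 0)"

text \<open>The two integrability clauses say that both sides of the defining equation exist
  (a Bochner integral that does not exist has the value 0 in HOL).\<close>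

definition has_covariance_kernel ::
    "'w measure \<Rightarrow> real \<Rightarrow> ('w \<Rightarrow> real \<Rightarrow> real) \<Rightarrow> (real \<Rightarrow> real \<Rightarrow> real) \<Rightarrow> bool" where
  "has_covariance_kernel P a Z K \<longleftrightarrow>
     (\<forall>f\<in>Ha a. \<forall>g\<in>Ha a.
        integrable P (\<lambda>w. Ha_inner a (Z w) f * Ha_inner a (Z w) g) \<and>
        set_integrable (lborel \<Otimes>\<^sub>M lborel) ({0..} \<times> {0..})
          (\<lambda>(s, t). K s t * f s * g t * exp (- a * (s + t))) \<and>
        (\<integral>w. Ha_inner a (Z w) f * Ha_inner a (Z w) g \<partial>P) =
          (LINT t:{0..}|lborel. (LINT s:{0..}|lborel. K s t * f s * g t * exp (- a * (s + t)))))"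

definition K0 :: "real \<Rightarrow> real \<Rightarrow> real" where
  "K0 s t = exp (- max s t) - exp (- (s + t))"

text \<open>The sample \<open>x\<^sub>1, \<dots>, x\<^sub>n\<close> is indexed from 0, i.e. it is \<open>x 0, \<dots>, x (n - 1)\<close>.\<close>

definition sample_mean :: "nat \<Rightarrow> (nat \<Rightarrow> real) \<Rightarrow> real" where
  "sample_mean n x = (\<Sum>j<n. x j) / real n"

definition scaled :: "nat \<Rightarrow> (nat \<Rightarrow> real) \<Rightarrow> nat \<Rightarrow> real" where
  "scaled n x j = x j / sample_mean n x"

definition test_statistic :: "nat \<Rightarrow> real \<Rightarrow> (nat \<Rightarrow> real) \<Rightarrow> real" where
  "test_statistic n a x = real n *
     (LINT y:{0..}|lborel.
        \<bar>(\<Sum>j<n. (scaled n x j - y - 1) * (if scaled n x j > y then 1 else 0)) / real n\<bar>\<^sup>2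
          * exp (- a * y))"

end

theory Submission
  imports Defs
begin

text \<open>
  Substituting \<open>x = m y\<close>, where \<open>m\<close> denotes the sample mean, turns \<open>T\<^bsub>n,a\<^esub>\<close> into the integral of
  \<open>(V\<^sub>n(x) - R\<^sub>n(x))\<^sup>2 exp(-ax / m)\<close>, divided by \<open>m\<close> cubed.  Here \<open>V\<^sub>n\<close> is a normalised sum of i.i.d. centred random
  functions with covariance kernel \<open>K\<^sub>0\<close>, and \<open>R\<^sub>n\<close> is \<open>\<surd>n (m - 1)\<close> times the error of the empirical survival
  function, so that \<open>T\<^bsub>n,a\<^esub> - \<parallel>V\<^sub>n\<parallel>\<^sup>2 \<longlonglongrightarrow> 0\<close> in probability.

  The kernel \<open>K\<^sub>0\<close> is the covariance of a Brownian bridge at the times \<open>exp(-s)\<close> and \<open>exp(-t)\<close>; the limit \<open>Z\<close> is its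
  Schauder series with independent standard normal coefficients.

  For nonnegative random variables weak convergence follows from convergence of the Laplace transforms at
  the natural numbers, by the Weierstrass theorem in the variable \<open>exp(-T)\<close>.  The Laplace transform of a squared
  norm is approximated, uniformly in \<open>n\<close>, by that of a finite weighted sum of squares \<open>\<Sum>\<^sub>i v\<^sub>i\<^sup>2\<close>, and
  \<open>E exp(- \<Sum>\<^sub>i v\<^sub>i\<^sup>2 / 2)\<close> is the average of the characteristic function of \<open>v\<close> over independent standard normal
  arguments.  Hence the one-dimensional central limit theorem for linear combinations suffices to compare
  \<open>V\<^sub>n\<close> with the partial sums of the Schauder series.
\<close>

section \<open>Laplace transforms and weak convergence\<close>

text \<open>The obstacle is that convergence of finite-dimensional laws alone does not control a
  norm in an infinite-dimensional space. The gap is closed by \<open>bridge_bounds\<close>: two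
  second-moment estimates, \<open>exp (- t)\<close> for the values and |s - t| for the increments,
  which every \<open>empirical n\<close> and every \<open>levy_sum n\<close> satisfies with the same
  constants. They make the discretisation error independent of \<open>n\<close>, and the decay
  \<open>exp (- t)\<close> secures integrability at infinity when \<open>a = 0\<close> and the
  weight disappears. Both families are discretised on the same grid and their grid transforms have
  the same limit. They are therefore compared with each other, and the law of the limiting norm is
  never computed. That the partial sums of the series also converge almost surely in norm is what
  produces \<open>Z\<close>. The remaining difficulty is that the error term is a product of two
  dependent small factors. The inequality of arithmetic and geometric means separates them, so that
  only the second moment of each factor enters.\<close>

lemma abs_integral_le:
  fixes f g :: "'a \<Rightarrow> real"
  assumes "integrable M f" "integrable M g" "\<And>x. x \<in> space M \<Longrightarrow> \<bar>f x\<bar> \<le> g x"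
  shows "\<bar>\<integral>x. f x \<partial>M\<bar> \<le> (\<integral>x. g x \<partial>M)"
proof -
  have "\<bar>\<integral>x. f x \<partial>M\<bar> \<le> (\<integral>x. \<bar>f x\<bar> \<partial>M)"
    by (rule integral_abs_bound)
  also have "\<dots> \<le> (\<integral>x. g x \<partial>M)"
    using assms by (intro integral_mono) auto
  finally show ?thesis .
qed

text \<open>In the variable \<open>exp (- t)\<close> the half-line becomes part of the compact
  interval [0, 1] and the transforms at natural arguments become moments. Continuous step functions,
  which decide weak convergence, are then uniform limits of polynomials, so compactness takes the
  place of tightness.\<close>

lemma laplace_imp_weak_conv:
  fixes T :: "nat \<Rightarrow> 'a \<Rightarrow> real" and R :: "'b \<Rightarrow> real"
  assumes M: "prob_space M" and P: "prob_space P"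
    and T[measurable]: "\<And>n. T n \<in> borel_measurable M" and R[measurable]: "R \<in> borel_measurable P"
    and T0: "\<And>n w. 0 \<le> T n w" and R0: "\<And>w. 0 \<le> R w"
    and lim: "\<And>m::nat. (\<lambda>n. \<integral>w. exp (- real m * T n w) \<partial>M) \<longlonglongrightarrow> (\<integral>w. exp (- real m * R w) \<partial>P)"
  shows "weak_conv_m (\<lambda>n. distr M borel (T n)) (distr P borel R)"
proof (rule integral_cts_step_conv_imp_weak_conv)
  interpret M: prob_space M by fact
  interpret P: prob_space P by fact
  show "real_distribution (distr M borel (T n))" for n
    by (rule M.real_distribution_distr) simp
  show "real_distribution (distr P borel R)"
    by (rule P.real_distribution_distr) simp
  fix x y :: real assume xy: "x < y"
  \<comment> \<open>The cut-off at \<open>exp (- y)\<close> keeps the logarithm away from 0 and does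
    not change the values at \<open>exp (- t)\<close>, since \<open>cts_step x y\<close> vanishes
    from \<open>y\<close> on. Thus \<open>h\<close> is continuous up to
    \<open>u = 0\<close>.\<close>
  define h where "h u = cts_step x y (- ln (max u (exp (- y))))" for u
  have h_eq: "cts_step x y t = h (exp (- t))" for t
    using xy by (cases "t \<le> y") (auto simp: h_def max_def cts_step_def)
  have [measurable]: "cts_step x y \<in> borel_measurable borel"
    unfolding cts_step_def[abs_def] by measurable
  have h_meas[measurable]: "h \<in> borel_measurable borel"
    unfolding h_def by measurable
  have nz: "max u (exp (- y)) \<noteq> 0" for u
    by (metis exp_gt_zero less_irrefl less_max_iff_disj)
  have h_cont: "continuous_on {0..1} h"
    unfolding h_def using uniformly_continuous_imp_continuous[OF cts_step_uniformly_continuous[OF xy]]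
    by (rule continuous_on_compose2) (auto intro!: continuous_intros simp: nz)
  have h_bd: "\<bar>h u\<bar> \<le> 1" for u
    using xy by (auto simp: h_def cts_step_def divide_simps)
  have int_pow: "integrable M (\<lambda>w. exp (- T n w) ^ m)" for m n
    by (rule M.integrable_const_bound[where B=1]) (auto simp: T0 power_le_one)
  have int_powR: "integrable P (\<lambda>w. exp (- R w) ^ m)" for m
    by (rule P.integrable_const_bound[where B=1]) (auto simp: R0 power_le_one)
  have int_h: "integrable M (\<lambda>w. h (exp (- T n w)))" for n
    by (rule M.integrable_const_bound[where B=1]) (auto simp: h_bd)
  have int_hR: "integrable P (\<lambda>w. h (exp (- R w)))"
    by (rule P.integrable_const_bound[where B=1]) (auto simp: h_bd)
  have "(\<lambda>n. \<integral>w. h (exp (- T n w)) \<partial>M) \<longlonglongrightarrow> (\<integral>w. h (exp (- R w)) \<partial>P)"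
  proof (rule LIMSEQ_I)
    fix r :: real assume r: "0 < r"
    obtain p where p: "real_polynomial_function p" and pa: "\<And>u. u \<in> {0..1} \<Longrightarrow> \<bar>h u - p u\<bar> < r / 4"
      using Stone_Weierstrass_real_polynomial_function[OF _ h_cont, of "r / 4"] r by auto
    obtain c d where p_eq: "p = (\<lambda>u. \<Sum>i\<le>d. c i * u ^ i)"
      using p unfolding real_polynomial_function_iff_sum by blast
    have pint: "integrable M (\<lambda>w. p (exp (- T n w)))" for n
      unfolding p_eq using int_pow by simp
    have pintR: "integrable P (\<lambda>w. p (exp (- R w)))"
      unfolding p_eq using int_powR by simp
    have "(\<lambda>n. \<integral>w. p (exp (- T n w)) \<partial>M) \<longlonglongrightarrow> (\<integral>w. p (exp (- R w)) \<partial>P)"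
      unfolding p_eq using int_pow int_powR lim
      by (auto simp: exp_of_nat_mult[symmetric] intro!: tendsto_intros)
    then obtain N where N: "\<And>n. n \<ge> N \<Longrightarrow>
        \<bar>(\<integral>w. p (exp (- T n w)) \<partial>M) - (\<integral>w. p (exp (- R w)) \<partial>P)\<bar> < r / 4"
      using LIMSEQ_D[of _ _ "r / 4"] r by (metis divide_pos_pos real_norm_def zero_less_numeral)
    have ap: "\<bar>(\<integral>w. h (exp (- T n w)) \<partial>M) - (\<integral>w. p (exp (- T n w)) \<partial>M)\<bar> \<le> r / 4" for n
    proof -
      have "\<bar>\<integral>w. h (exp (- T n w)) - p (exp (- T n w)) \<partial>M\<bar> \<le> (\<integral>w. r / 4 \<partial>M)"
        by (intro abs_integral_le Bochner_Integration.integrable_diff int_h pint less_imp_le[OF pa]) (auto simp: T0)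
      then show ?thesis using int_h pint by (simp add: M.prob_space)
    qed
    have apR: "\<bar>(\<integral>w. h (exp (- R w)) \<partial>P) - (\<integral>w. p (exp (- R w)) \<partial>P)\<bar> \<le> r / 4"
    proof -
      have "\<bar>\<integral>w. h (exp (- R w)) - p (exp (- R w)) \<partial>P\<bar> \<le> (\<integral>w. r / 4 \<partial>P)"
        by (intro abs_integral_le Bochner_Integration.integrable_diff int_hR pintR less_imp_le[OF pa]) (auto simp: R0)
      then show ?thesis using int_hR pintR by (simp add: P.prob_space)
    qed
    show "\<exists>no. \<forall>n\<ge>no. norm ((\<integral>w. h (exp (- T n w)) \<partial>M) - (\<integral>w. h (exp (- R w)) \<partial>P)) < r"
    proof (intro exI allI impI)
      fix n assume "n \<ge> N"
      from N[OF this] ap[of n] apR r show "norm ((\<integral>w. h (exp (- T n w)) \<partial>M) - (\<integral>w. h (exp (- R w)) \<partial>P)) < r"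
        unfolding real_norm_def by linarith
    qed
  qed
  then show "(\<lambda>n. integral\<^sup>L (distr M borel (T n)) (cts_step x y)) \<longlonglongrightarrow> integral\<^sup>L (distr P borel R) (cts_step x y)"
    by (simp add: integral_distr h_eq)
qed

section \<open>The infinite product of standard normal laws, and squares as Gaussian
  averages\<close>

abbreviation gauss :: "(nat \<Rightarrow> real) measure" where
  "gauss \<equiv> \<Pi>\<^sub>M i\<in>UNIV. std_normal_distribution"

lemma prob_space_gauss: "prob_space gauss"
  by (intro prob_space_PiM real_distribution.axioms(1) real_dist_normal_dist)

text \<open>The index set is countable, so the product sigma-field is the Borel sigma-field of the
  product topology. This makes open sets of coefficient sequences measurable in
  \<open>measurable_Ha_borel_gauss_sum\<close>.\<close>

lemma sets_gauss: "sets gauss = sets borel"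
proof -
  have "sets gauss = sets (\<Pi>\<^sub>M i\<in>UNIV. (borel :: real measure))"
    by (intro sets_PiM_cong) auto
  then show ?thesis by (simp add: sets_PiM_equal_borel)
qed

lemma space_gauss [simp]: "space gauss = UNIV"
  by (simp add: space_PiM)

lemma measurable_gauss_component [measurable]: "(\<lambda>z. z i) \<in> borel_measurable gauss"
  using measurable_component_singleton[of i UNIV "\<lambda>_. std_normal_distribution"] by simp

lemma distr_gauss_component: "distr gauss borel (\<lambda>z. z i) = std_normal_distribution"
proof -
  have "distr gauss std_normal_distribution (\<lambda>z. z i) = std_normal_distribution"
    by (rule distr_PiM_component) (auto intro: real_distribution.axioms(1) real_dist_normal_dist)
  then show ?thesis
    by (metis distr_cong sets_density sets_lborel)
qed

lemma indep_vars_gauss: "prob_space.indep_vars gauss (\<lambda>_. borel) (\<lambda>i z. z i) UNIV"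
proof -
  interpret prob_space gauss by (rule prob_space_gauss)
  have "distr gauss (\<Pi>\<^sub>M i\<in>(UNIV::nat set). (borel::real measure)) (\<lambda>x. \<lambda>i\<in>UNIV. x i) = gauss"
  proof -
    have "sets (\<Pi>\<^sub>M i\<in>(UNIV::nat set). (borel::real measure)) = sets gauss"
      by (simp add: sets_PiM_equal_borel sets_gauss)
    then show ?thesis
      by (simp add: distr_id2 restrict_UNIV)
  qed
  then show ?thesis
    by (subst indep_vars_iff_distr_eq_PiM) (auto simp: distr_gauss_component)
qed

text \<open>The coefficients are absorbed into the variables and all characteristic functions are
  evaluated at 1, so that independence factorises the transform of a single sum.\<close>

lemma char_gauss:
  assumes "finite I"
  shows "(\<integral>z. iexp (\<Sum>m\<in>I. \<theta> m * z m) \<partial>gauss) = exp (- (\<Sum>m\<in>I. (\<theta> m)\<^sup>2) / 2)"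
proof -
  interpret prob_space gauss by (rule prob_space_gauss)
  have ind: "indep_vars (\<lambda>_. borel) (\<lambda>i z. \<theta> i * z i) I"
    using indep_vars_compose2[OF indep_vars_subset[OF indep_vars_gauss], of I "\<lambda>i x. \<theta> i * x" "\<lambda>_. borel"]
    by simp
  have one: "char (distr gauss borel (\<lambda>z. \<theta> i * z i)) 1 = exp (- (\<theta> i)\<^sup>2 / 2)" for i
  proof -
    have "char (distr gauss borel (\<lambda>z. \<theta> i * z i)) 1 = char (distr gauss borel (\<lambda>z. z i)) (\<theta> i)"
      by (simp add: char_def integral_distr)
    then show ?thesis by (simp add: distr_gauss_component char_std_normal_distribution)
  qed
  have "(\<integral>z. iexp (\<Sum>m\<in>I. \<theta> m * z m) \<partial>gauss) = char (distr gauss borel (\<lambda>z. \<Sum>m\<in>I. \<theta> m * z m)) 1"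
    by (simp add: char_def integral_distr)
  also have "\<dots> = (\<Prod>m\<in>I. complex_of_real (exp (- (\<theta> m)\<^sup>2 / 2)))"
    by (simp add: char_distr_sum[OF ind] one)
  also have "\<dots> = complex_of_real (exp (\<Sum>m\<in>I. - (\<theta> m)\<^sup>2 / 2))"
    using assms by (simp only: exp_sum of_real_prod)
  also have "(\<Sum>m\<in>I. - (\<theta> m)\<^sup>2 / 2) = - (\<Sum>m\<in>I. (\<theta> m)\<^sup>2) / 2"
    by (simp add: sum_divide_distrib sum_negf)
  finally show ?thesis .
qed

text \<open>A standard normal average linearises the square in the exponent (Hubbard--Stratonovich).\<close>

lemma laplace_eq_mixed_char:
  fixes V :: "'a \<Rightarrow> nat \<Rightarrow> real"
  assumes "prob_space M" and [measurable]: "\<And>i. i < N \<Longrightarrow> (\<lambda>w. V w i) \<in> borel_measurable M"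
  shows "complex_of_real (\<integral>w. exp (- (\<Sum>i<N. (V w i)\<^sup>2) / 2) \<partial>M) =
    (\<integral>z. (\<integral>w. iexp (\<Sum>i<N. z i * V w i) \<partial>M) \<partial>gauss)"
    and "(\<lambda>z. \<integral>w. iexp (\<Sum>i<N. z i * V w i) \<partial>M) \<in> borel_measurable gauss"
proof -
  let ?c = "\<lambda>z. \<integral>w. iexp (\<Sum>i<N. z i * V w i) \<partial>M"
  interpret M: prob_space M by fact
  interpret G: prob_space gauss by (rule prob_space_gauss)
  interpret pair_prob_space gauss M ..
  have [measurable]: "(\<lambda>(z, w). \<Sum>i<N. z i * V w i) \<in> borel_measurable (gauss \<Otimes>\<^sub>M M)"
    unfolding case_prod_unfold by (intro borel_measurable_sum borel_measurable_times) auto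
  have int: "integrable (gauss \<Otimes>\<^sub>M M) (\<lambda>(z, w). iexp (\<Sum>i<N. z i * V w i))"
    by (rule P.integrable_const_bound[where B=1]) (auto simp: case_prod_unfold)
  have "(\<integral>z. (?c z) \<partial>gauss) = (\<integral>w. (\<integral>z. iexp (\<Sum>i<N. z i * V w i) \<partial>gauss) \<partial>M)"
    by (rule Fubini_integral[symmetric]) (rule int)
  also have "\<dots> = (\<integral>w. complex_of_real (exp (- (\<Sum>i<N. (V w i)\<^sup>2) / 2)) \<partial>M)"
    using char_gauss[of "{..<N}" "V _"] by (simp add: mult.commute)
  finally show "complex_of_real (\<integral>w. exp (- (\<Sum>i<N. (V w i)\<^sup>2) / 2) \<partial>M) =
    (\<integral>z. (?c z) \<partial>gauss)" by simp
  show "(\<lambda>z. \<integral>w. iexp (\<Sum>i<N. z i * V w i) \<partial>M) \<in> borel_measurable gauss"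
    using integrable_fst[OF int] by (rule borel_measurable_integrable)
qed

text \<open>Characteristic functions are bounded by 1, so dominated convergence applies under the
  Gaussian average over the coefficients. The limit \<open>f\<close> is any pointwise limit; its
  measurability is inherited from the approximating functions.\<close>

lemma char_conv_imp_laplace_conv:
  fixes V :: "nat \<Rightarrow> 'a \<Rightarrow> nat \<Rightarrow> real"
  assumes M: "prob_space M" and V: "\<And>n i. i < N \<Longrightarrow> (\<lambda>w. V n w i) \<in> borel_measurable M"
    and conv: "\<And>c. (\<lambda>n. \<integral>w. iexp (\<Sum>i<N. c i * V n w i) \<partial>M) \<longlonglongrightarrow> f c"
  shows "(\<lambda>n. complex_of_real (\<integral>w. exp (- (\<Sum>i<N. (V n w i)\<^sup>2) / 2) \<partial>M)) \<longlonglongrightarrow> (\<integral>z. f z \<partial>gauss)"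
proof -
  interpret M: prob_space M by fact
  interpret G: prob_space gauss by (rule prob_space_gauss)
  have eq: "complex_of_real (\<integral>w. exp (- (\<Sum>i<N. (V n w i)\<^sup>2) / 2) \<partial>M) =
    (\<integral>z. (\<integral>w. iexp (\<Sum>i<N. z i * V n w i) \<partial>M) \<partial>gauss)" for n
    using laplace_eq_mixed_char(1)[where V="V n" and N=N, OF M V] by simp
  show ?thesis
    unfolding eq
  proof (rule integral_dominated_convergence[where w="\<lambda>_. 1"])
    show "(\<lambda>z. \<integral>w. iexp (\<Sum>i<N. z i * V n w i) \<partial>M) \<in> borel_measurable gauss" for n
      using laplace_eq_mixed_char(2)[where V="V n" and N=N, OF M V] by simp
    then show "f \<in> borel_measurable gauss"
      by (rule borel_measurable_LIMSEQ_metric) (use conv in auto)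
    have "norm (\<integral>w. iexp (\<Sum>i<N. z i * V n w i) \<partial>M) \<le> (\<integral>w. norm (iexp (\<Sum>i<N. z i * V n w i)) \<partial>M)" for n z
      by (rule integral_norm_bound)
    also have "\<dots> n z \<le> 1" for n z
      by (simp del: of_real_sum of_real_mult add: M.prob_space)
    finally show "AE z in gauss. norm (\<integral>w. iexp (\<Sum>i<N. z i * V n w i) \<partial>M) \<le> 1" for n by simp
  qed (use conv in auto)
qed

section \<open>Quadratic functionals of processes with bounded increments\<close>

lemma space_mu [simp]: "space (mu a) = {0..}"
  by (simp add: mu_def space_restrict_space)

lemma sets_mu: "sets (mu a) = sets (restrict_space borel {0..})"
  by (simp add: mu_def sets_restrict_space)

lemma measurable_mu_ident [measurable]: "(\<lambda>t. t) \<in> measurable (mu a) borel"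
  by (simp add: measurable_cong_sets[OF sets_mu refl] measurable_restrict_space1)

lemma borel_measurable_muI: "f \<in> borel_measurable borel \<Longrightarrow> f \<in> borel_measurable (mu a)"
  using measurable_compose[OF measurable_mu_ident] .

lemma borel_measurable_mu_iff:
  "(f :: real \<Rightarrow> real) \<in> borel_measurable (mu a) \<longleftrightarrow> (\<lambda>t. indicator {0..} t * f t) \<in> borel_measurable borel"
  using borel_measurable_restrict_space_iff[of "{0..}" "borel :: real measure" f]
  by (simp add: measurable_cong_sets[OF sets_mu refl])

lemma measurable_pair_mu:
  assumes "(\<lambda>(w, t). V w t) \<in> borel_measurable (M \<Otimes>\<^sub>M borel)"
  shows "(\<lambda>(w, t). V w t) \<in> borel_measurable (M \<Otimes>\<^sub>M mu a)"
proof -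
  have "(\<lambda>p. (fst p, snd p)) \<in> measurable (M \<Otimes>\<^sub>M mu a) (M \<Otimes>\<^sub>M borel)"
    by (intro measurable_Pair measurable_fst measurable_compose[OF measurable_snd measurable_mu_ident])
  from measurable_compose[OF this assms] show ?thesis by simp
qed

lemma sigma_finite_mu: "sigma_finite_measure (mu a)"
proof -
  interpret R: sigma_finite_measure "restrict_space lborel {0::real..}"
    by (rule sigma_finite_measure_restrict_space[OF sigma_finite_lborel]) simp
  show ?thesis unfolding mu_def
    by (rule R.sigma_finite_iff_density_finite[THEN iffD2])
       (auto intro!: measurable_restrict_space1)
qed

lemma nn_integral_mu:
  assumes [measurable]: "f \<in> borel_measurable (mu a)"
  shows "(\<integral>\<^sup>+t. f t \<partial>mu a) = (\<integral>\<^sup>+t. ennreal (exp (- a * t)) * f t * indicator {0..} t \<partial>lborel)"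
proof -
  have "f \<in> borel_measurable (restrict_space lborel {0..})"
    using assms by (simp add: mu_def)
  then show ?thesis unfolding mu_def
    by (subst nn_integral_density)
       (auto intro!: measurable_restrict_space1 simp: nn_integral_restrict_space)
qed

lemma integral_mu:
  fixes f :: "real \<Rightarrow> real"
  assumes "f \<in> borel_measurable (mu a)"
  shows "(\<integral>t. f t \<partial>mu a) = (LINT t:{0..}|lborel. f t * exp (- a * t))"
proof -
  have "f \<in> borel_measurable (restrict_space lborel {0..})"
    using assms by (simp add: mu_def)
  then show ?thesis unfolding mu_def
    by (subst integral_density)
       (auto intro!: measurable_restrict_space1 simp: integral_restrict_space set_lebesgue_integral_def mult.commute)
qed

lemma integrable_mu_iff:
  fixes f :: "real \<Rightarrow> real"
  assumes "f \<in> borel_measurable (mu a)"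
  shows "integrable (mu a) f \<longleftrightarrow> set_integrable lborel {0..} (\<lambda>t. f t * exp (- a * t))"
proof -
  have "f \<in> borel_measurable (restrict_space lborel {0..})"
    using assms by (simp add: mu_def)
  then show ?thesis unfolding mu_def
    by (subst integrable_density)
       (auto intro!: measurable_restrict_space1 simp: integrable_restrict_space set_integrable_def mult.commute)
qed

text \<open>The weight is at most 1 and is dropped. The bound thus covers \<open>a = 0\<close>,
  where \<open>mu a\<close> is infinite and integrability has to come from the integrand.\<close>

lemma nn_integral_mu_exp:
  assumes "0 \<le> a" "0 < c"
  shows "(\<integral>\<^sup>+t. ennreal (exp (- c * t)) \<partial>mu a) \<le> ennreal (1 / c)"
proof -
  have "(\<integral>\<^sup>+t. ennreal (exp (- c * t)) \<partial>mu a) =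
      (\<integral>\<^sup>+t. ennreal (exp (- a * t)) * ennreal (exp (- c * t)) * indicator {0..} t \<partial>lborel)"
    by (rule nn_integral_mu) (auto intro!: borel_measurable_muI)
  also have "\<dots> \<le> (\<integral>\<^sup>+t. ennreal (exp (- (c * t))) * indicator {0..} t \<partial>lborel)"
    using assms by (intro nn_integral_mono) (auto simp: ennreal_mult[symmetric] mult_left_le_one_le split: split_indicator)
  also have "\<dots> = ennreal (1 / c) * (\<integral>\<^sup>+t. ennreal (exp (- (c * (0 + (1 / c) * t)))) * indicator {0..} (0 + (1 / c) * t) \<partial>lborel)"
    using assms by (subst nn_integral_real_affine[where c="1 / c" and t=0]) auto
  also have "(\<integral>\<^sup>+t. ennreal (exp (- (c * (0 + (1 / c) * t)))) * indicator {0..} (0 + (1 / c) * t) \<partial>lborel) = (\<integral>\<^sup>+t. ennreal (t ^ 0 * exp (- t)) * indicator {0..} t \<partial>lborel)"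
    using assms by (intro nn_integral_cong) (auto simp: zero_le_divide_iff split: split_indicator)
  also have "\<dots> = 1"
    by (subst nn_intergal_power_times_exp_Ici) auto
  finally show ?thesis by simp
qed

lemma emeasure_mu_Ico_le:
  assumes "0 \<le> a" "0 \<le> x" "x \<le> y"
  shows "emeasure (mu a) {x..<y} \<le> ennreal (y - x)"
proof -
  have s[measurable]: "{x..<y} \<in> sets (mu a)"
  proof -
    have "{0..} \<inter> {x..<y} \<in> sets (restrict_space borel {0..})"
      unfolding sets_restrict_space by (rule imageI) simp
    moreover have "{0..} \<inter> {x..<y} = {x..<y}" using assms by auto
    ultimately show ?thesis by (simp add: sets_mu)
  qed
  have "emeasure (mu a) {x..<y} = (\<integral>\<^sup>+t. indicator {x..<y} t \<partial>mu a)"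
    by simp
  also have "\<dots> = (\<integral>\<^sup>+t. ennreal (exp (- a * t)) * indicator {x..<y} t * indicator {0..} t \<partial>lborel)"
    by (rule nn_integral_mu) simp
  also have "\<dots> \<le> (\<integral>\<^sup>+t. indicator {x..<y} t \<partial>lborel)"
    using assms by (intro nn_integral_mono) (auto split: split_indicator)
  also have "\<dots> = ennreal (y - x)"
    using assms by simp
  finally show ?thesis .
qed

section \<open>Discretisation of the squared norm, uniformly over a class of processes\<close>

lemma exp_diff_le:
  fixes x y m :: real
  assumes "0 \<le> x" "0 \<le> y" "0 \<le> m"
  shows "\<bar>exp (- m * x) - exp (- m * y)\<bar> \<le> m * \<bar>x - y\<bar>"
proof -
  have *: "exp (- m * x) - exp (- m * y) \<le> m * \<bar>x - y\<bar>" "exp (- m * x) \<ge> exp (- m * y)"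
    if "0 \<le> x" "x \<le> y" for x y
  proof -
    have "exp (- m * y) = exp (- m * x) * exp (- m * (y - x))"
      by (simp add: exp_add[symmetric] algebra_simps)
    then have "exp (- m * x) - exp (- m * y) = exp (- m * x) * (1 - exp (- m * (y - x)))"
      by (simp add: right_diff_distrib)
    also have "\<dots> \<le> 1 * (1 - exp (- m * (y - x)))"
      using that assms by (intro mult_right_mono) auto
    also have "1 - exp (- m * (y - x)) \<le> m * (y - x)"
      using exp_ge_add_one_self[of "- m * (y - x)"] by simp
    finally show "exp (- m * x) - exp (- m * y) \<le> m * \<bar>x - y\<bar>" using that by simp
    show "exp (- m * x) \<ge> exp (- m * y)" using that assms by (simp add: mult_left_mono)
  qed
  show ?thesis
  proof (cases "x \<le> y")
    case True
    with *[of x y] assms show ?thesis by linarith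
  next
    case False
    with *[of y x] assms show ?thesis by (simp add: abs_minus_commute)
  qed
qed

text \<open>The function \<open>exp (- m * x)\<close> is \<open>m\<close>-Lipschitz on the
  half-line, so an L1 bound carries over to Laplace transforms. Since the bound is on a nonnegative
  integral, it also delivers the integrability of the difference.\<close>

lemma (in prob_space) laplace_diff_le:
  fixes A B :: "'a \<Rightarrow> real"
  assumes [measurable]: "A \<in> borel_measurable M" "B \<in> borel_measurable M"
    and nn: "\<And>w. 0 \<le> A w" "\<And>w. 0 \<le> B w" and m: "0 \<le> m" and c: "0 \<le> c"
    and le: "(\<integral>\<^sup>+w. ennreal \<bar>A w - B w\<bar> \<partial>M) \<le> ennreal c"
  shows "\<bar>(\<integral>w. exp (- m * A w) \<partial>M) - (\<integral>w. exp (- m * B w) \<partial>M)\<bar> \<le> m * c"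
proof -
  have int: "integrable M (\<lambda>w. \<bar>A w - B w\<bar>)"
    by (rule integrableI_bounded) (use le in \<open>auto simp: less_top[symmetric] top_unique intro: le_less_trans\<close>)
  have "(\<integral>w. \<bar>A w - B w\<bar> \<partial>M) = enn2real (\<integral>\<^sup>+w. ennreal \<bar>A w - B w\<bar> \<partial>M)"
    by (rule integral_eq_nn_integral) auto
  also have "\<dots> \<le> c"
    by (rule enn2real_leI[OF c le])
  finally have ic: "(\<integral>w. \<bar>A w - B w\<bar> \<partial>M) \<le> c" .
  have i: "integrable M (\<lambda>w. exp (- m * A w))" "integrable M (\<lambda>w. exp (- m * B w))"
    by (rule integrable_const_bound[where B=1]; use nn m in auto)+
  have "\<bar>\<integral>w. exp (- m * A w) - exp (- m * B w) \<partial>M\<bar> \<le> (\<integral>w. m * \<bar>A w - B w\<bar> \<partial>M)"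
    using i int nn m by (intro abs_integral_le exp_diff_le) auto
  also have "\<dots> \<le> m * c"
    using ic m by (simp add: mult_left_mono)
  finally show ?thesis using i by simp
qed


text \<open>These are the moment bounds that the kernel \<open>K0\<close> implies for a process with
  this covariance. They hold with the same constants for all members of both families to be
  compared, which is the source of uniformity in \<open>n\<close>. Nonnegative integrals include the
  finiteness of the moments.\<close>

definition bridge_bounds :: "'a measure \<Rightarrow> ('a \<Rightarrow> real \<Rightarrow> real) \<Rightarrow> bool" where
  "bridge_bounds M V \<longleftrightarrow>
     (\<lambda>(w, t). V w t) \<in> borel_measurable (M \<Otimes>\<^sub>M borel) \<and>
     (\<forall>t\<ge>0. (\<integral>\<^sup>+w. ennreal ((V w t)\<^sup>2) \<partial>M) \<le> ennreal (exp (- t))) \<and>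
     (\<forall>s\<ge>0. \<forall>t\<ge>0. (\<integral>\<^sup>+w. ennreal ((V w s - V w t)\<^sup>2) \<partial>M) \<le> ennreal \<bar>s - t\<bar>)"

text \<open>The grid covers \<open>[0, N)\<close> with mesh \<open>h = 1 / N^4\<close>, so that the discretisation error, of order \<open>N * sqrt h\<close>, and the
  contribution of \<open>[N, \<infinity>)\<close> are both of order \<open>1 / N\<close>.\<close>

definition grid_wt :: "real \<Rightarrow> nat \<Rightarrow> nat \<Rightarrow> real" where
  "grid_wt a N i = measure (mu a) {real i / real N ^ 4..<real (Suc i) / real N ^ 4}"

definition grid_sum :: "real \<Rightarrow> nat \<Rightarrow> (real \<Rightarrow> real) \<Rightarrow> real" where
  "grid_sum a N v = (\<Sum>i<N ^ 5. grid_wt a N i * (v (real i / real N ^ 4))\<^sup>2)"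

lemma bridge_boundsD:
  assumes "bridge_bounds M V" "0 \<le> s" "0 \<le> t"
  shows "(\<integral>\<^sup>+w. ennreal ((V w t)\<^sup>2) \<partial>M) \<le> ennreal (exp (- t))"
    and "(\<integral>\<^sup>+w. ennreal ((V w s - V w t)\<^sup>2) \<partial>M) \<le> ennreal \<bar>s - t\<bar>"
  using assms unfolding bridge_bounds_def by blast+

lemma bridge_bounds_measurable_pair:
  "bridge_bounds M V \<Longrightarrow> (\<lambda>(w, t). V w t) \<in> borel_measurable (M \<Otimes>\<^sub>M mu a)"
  unfolding bridge_bounds_def by (blast intro: measurable_pair_mu)

lemma bridge_bounds_measurable:
  "bridge_bounds M V \<Longrightarrow> (\<lambda>w. V w t) \<in> borel_measurable M"
  unfolding bridge_bounds_def using measurable_Pair2'[of t borel M]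
  by (auto dest!: measurable_compose[of "\<lambda>w. (w, t)" M "M \<Otimes>\<^sub>M borel"])

text \<open>Young's inequality for the product of |x - y| and |x + y|, with a free parameter \<eta>.
  It compares squares through second moments of increments and of values only.\<close>

lemma sq_diff_abs_le:
  fixes x y \<eta> :: real
  assumes "0 < \<eta>"
  shows "\<bar>x\<^sup>2 - y\<^sup>2\<bar> \<le> (x - y)\<^sup>2 / (2 * \<eta>) + \<eta> * (x\<^sup>2 + y\<^sup>2)"
proof -
  have "\<bar>x\<^sup>2 - y\<^sup>2\<bar> = \<bar>x - y\<bar> * \<bar>x + y\<bar>"
    by (simp add: abs_mult[symmetric] power2_eq_square algebra_simps)
  moreover have "2 * \<eta> * (\<bar>x - y\<bar> * \<bar>x + y\<bar>) \<le> (x - y)\<^sup>2 + \<eta>\<^sup>2 * (x + y)\<^sup>2"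
    using sum_squares_bound[of "\<bar>x - y\<bar>" "\<eta> * \<bar>x + y\<bar>"] by (simp add: power_mult_distrib mult_ac)
  moreover have "\<eta>\<^sup>2 * (x + y)\<^sup>2 \<le> \<eta>\<^sup>2 * (2 * (x\<^sup>2 + y\<^sup>2))"
    using sum_squares_bound[of x y] by (intro mult_left_mono) (auto simp: power2_sum)
  ultimately have "2 * \<eta> * \<bar>x\<^sup>2 - y\<^sup>2\<bar> \<le> (x - y)\<^sup>2 + \<eta>\<^sup>2 * (2 * (x\<^sup>2 + y\<^sup>2))"
    by (smt (verit) mult.assoc)
  then show ?thesis
    using assms by (simp add: field_simps power2_eq_square)
qed

lemma bridge_bounds_sq_diff:
  assumes V: "bridge_bounds M V" and h: "0 < h" and y: "0 \<le> y" "y \<le> t" "t \<le> y + h"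
  shows "(\<integral>\<^sup>+w. ennreal \<bar>(V w t)\<^sup>2 - (V w y)\<^sup>2\<bar> \<partial>M) \<le> ennreal (3 * sqrt h)"
proof -
  \<comment> \<open>This choice balances the two terms: the increment gives
    \<open>h / (2 * \<eta>) = \<eta> / 2\<close> and the values give \<open>2 * \<eta>\<close>,
    together at most \<open>3 * sqrt h\<close>.\<close>
  define \<eta> where "\<eta> = sqrt h"
  have \<eta>: "0 < \<eta>" "h = \<eta>\<^sup>2" using h by (auto simp: \<eta>_def)
  note [measurable] = bridge_bounds_measurable[OF V]
  have "(\<integral>\<^sup>+w. ennreal \<bar>(V w t)\<^sup>2 - (V w y)\<^sup>2\<bar> \<partial>M) \<le>
      (\<integral>\<^sup>+w. ennreal (1 / (2 * \<eta>)) * ennreal ((V w t - V w y)\<^sup>2) + ennreal \<eta> * (ennreal ((V w t)\<^sup>2) + ennreal ((V w y)\<^sup>2)) \<partial>M)"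
  proof (rule nn_integral_mono)
    fix w
    have "\<bar>(V w t)\<^sup>2 - (V w y)\<^sup>2\<bar> \<le> 1 / (2 * \<eta>) * (V w t - V w y)\<^sup>2 + \<eta> * ((V w t)\<^sup>2 + (V w y)\<^sup>2)"
      using sq_diff_abs_le[OF \<eta>(1), of "V w t" "V w y"] by simp
    then show "ennreal \<bar>(V w t)\<^sup>2 - (V w y)\<^sup>2\<bar> \<le> ennreal (1 / (2 * \<eta>)) * ennreal ((V w t - V w y)\<^sup>2) + ennreal \<eta> * (ennreal ((V w t)\<^sup>2) + ennreal ((V w y)\<^sup>2))"
      using \<eta> by (simp add: ennreal_mult[symmetric] ennreal_plus[symmetric] ennreal_leI del: ennreal_plus)
  qed
  also have "\<dots> = ennreal (1 / (2 * \<eta>)) * (\<integral>\<^sup>+w. ennreal ((V w t - V w y)\<^sup>2) \<partial>M) +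
      ennreal \<eta> * ((\<integral>\<^sup>+w. ennreal ((V w t)\<^sup>2) \<partial>M) + (\<integral>\<^sup>+w. ennreal ((V w y)\<^sup>2) \<partial>M))"
    by (simp add: nn_integral_add nn_integral_cmult)
  also have "\<dots> \<le> ennreal (1 / (2 * \<eta>)) * ennreal h + ennreal \<eta> * (ennreal 1 + ennreal 1)"
  proof (intro add_mono mult_left_mono)
    have "(\<integral>\<^sup>+w. ennreal ((V w t - V w y)\<^sup>2) \<partial>M) \<le> ennreal \<bar>t - y\<bar>"
      using y by (intro bridge_boundsD(2)[OF V]) auto
    also have "\<dots> \<le> ennreal h" using y by (intro ennreal_leI) auto
    finally show "(\<integral>\<^sup>+w. ennreal ((V w t - V w y)\<^sup>2) \<partial>M) \<le> ennreal h" .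
    have *: "(\<integral>\<^sup>+w. ennreal ((V w x)\<^sup>2) \<partial>M) \<le> ennreal 1" if "0 \<le> x" for x
    proof -
      have "(\<integral>\<^sup>+w. ennreal ((V w x)\<^sup>2) \<partial>M) \<le> ennreal (exp (- x))"
        using that by (intro bridge_boundsD(1)[OF V]) auto
      also have "\<dots> \<le> ennreal 1" using that by (intro ennreal_leI) auto
      finally show ?thesis .
    qed
    show "(\<integral>\<^sup>+w. ennreal ((V w t)\<^sup>2) \<partial>M) \<le> ennreal 1" "(\<integral>\<^sup>+w. ennreal ((V w y)\<^sup>2) \<partial>M) \<le> ennreal 1"
      using * y by auto
  qed auto
  also have "ennreal 1 + ennreal 1 = ennreal 2"
    by (subst ennreal_plus[symmetric]) auto
  also have "ennreal (1 / (2 * \<eta>)) * ennreal h + ennreal \<eta> * ennreal 2 = ennreal (1 / (2 * \<eta>) * h + \<eta> * 2)"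
    using \<eta> by (subst (1 2) ennreal_mult[symmetric], auto intro!: ennreal_plus[symmetric])
  also have "\<dots> \<le> ennreal (3 * sqrt h)"
    using \<eta> unfolding \<eta>_def[symmetric] by (intro ennreal_leI) (simp add: power2_eq_square)
  finally show ?thesis .
qed

text \<open>By Tonelli the mean squared norm is the integral of the pointwise second moments, which
  are at most \<open>exp (- t)\<close>; finiteness for almost every \<open>w\<close>
  follows.\<close>

lemma bridge_bounds_integrable:
  assumes "prob_space M" and V: "bridge_bounds M V" and a: "0 \<le> a"
  shows "(\<integral>\<^sup>+w. (\<integral>\<^sup>+t. ennreal ((V w t)\<^sup>2) \<partial>mu a) \<partial>M) \<le> 1"
    and "AE w in M. integrable (mu a) (\<lambda>t. (V w t)\<^sup>2)"
proof -
  let ?I = "\<lambda>w. \<integral>\<^sup>+t. ennreal ((V w t)\<^sup>2) \<partial>mu a"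
  interpret M: prob_space M by fact
  interpret mu: sigma_finite_measure "mu a" by (rule sigma_finite_mu)
  interpret pair_sigma_finite M "mu a" ..
  note [measurable] = bridge_bounds_measurable_pair[OF V, of a]
  have "(\<integral>\<^sup>+w. (?I w) \<partial>M) = (\<integral>\<^sup>+t. (\<integral>\<^sup>+w. ennreal ((V w t)\<^sup>2) \<partial>M) \<partial>mu a)"
    by (intro Fubini'[symmetric]) measurable
  also have "\<dots> \<le> (\<integral>\<^sup>+t. ennreal (exp (- 1 * t)) \<partial>mu a)"
    using bridge_boundsD(1)[OF V] by (intro nn_integral_mono) auto
  also have "\<dots> \<le> ennreal (1 / 1)"
    using a by (intro nn_integral_mu_exp) auto
  finally show le: "(\<integral>\<^sup>+w. (?I w) \<partial>M) \<le> 1" by simp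
  have "AE w in M. (?I w) \<noteq> \<infinity>"
    by (rule nn_integral_noteq_infinite) (use le in \<open>auto simp: top_unique\<close>)
  then show "AE w in M. integrable (mu a) (\<lambda>t. (V w t)\<^sup>2)"
    using AE_space
  proof eventually_elim
    case (elim w)
    then show ?case
      by (intro integrableI_nonneg) (auto simp: less_top measurable_Pair2)
  qed
qed

text \<open>The grid sum is the integral of the step function \<open>st\<close>. On [0, N) each
  point is within \<open>h\<close> of its node, which costs \<open>3 * sqrt h * N = 3 / N\<close> in
  total. Beyond N the step function is 0 and the tail of the process costs at most
  \<open>2 * exp (- N / 2)\<close>, which is at most \<open>4 / N\<close>.\<close>

lemma grid_sum_approx:
  assumes "prob_space M" and V: "bridge_bounds M V" and a: "0 \<le> a" and N: "0 < N"
  shows "(\<integral>\<^sup>+w. ennreal \<bar>(\<integral>t. (V w t)\<^sup>2 \<partial>mu a) - grid_sum a N (V w)\<bar> \<partial>M) \<le> ennreal (7 / N)"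
proof -
  interpret M: prob_space M by fact
  interpret mu: sigma_finite_measure "mu a" by (rule sigma_finite_mu)
  interpret pair_sigma_finite M "mu a" ..
  note [measurable] = bridge_bounds_measurable_pair[OF V, of a] bridge_bounds_measurable[OF V]
  define h where "h = 1 / real N ^ 4"
  have h: "0 < h" using N by (simp add: h_def)
  define I where "I i = {real i * h..<real (Suc i) * h}" for i :: nat
  have I_sets[measurable]: "I i \<in> sets (mu a)" for i
  proof -
    have "{0..} \<inter> I i \<in> sets (restrict_space borel {0..})"
      unfolding sets_restrict_space I_def by (rule imageI) simp
    moreover have "{0..} \<inter> I i = I i" using h by (auto simp: I_def intro: order_trans[rotated])
    ultimately show ?thesis by (simp add: sets_mu)
  qed
  have I_fin: "emeasure (mu a) (I i) < \<infinity>" for i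
    using emeasure_mu_Ico_le[of a "real i * h" "real (Suc i) * h"] a h
    unfolding I_def by (auto intro: le_less_trans simp: mult_right_mono)
  define st where "st w t = (\<Sum>i<N ^ 5. indicator (I i) t * (V w (real i * h))\<^sup>2)" for w t
  have [measurable]: "(\<lambda>(w, t). st w t) \<in> borel_measurable (M \<Otimes>\<^sub>M mu a)"
    unfolding st_def by measurable
  have gs: "grid_sum a N (V w) = (\<integral>t. st w t \<partial>mu a)" and st_int: "integrable (mu a) (st w)" for w
  proof -
    show "integrable (mu a) (st w)"
      unfolding st_def[abs_def] using I_fin
      by (intro Bochner_Integration.integrable_sum integrable_mult_left integrable_real_indicator) auto
    have "(\<integral>t. st w t \<partial>mu a) = (\<Sum>i<N ^ 5. \<integral>t. indicator (I i) t * (V w (real i * h))\<^sup>2 \<partial>mu a)"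
      unfolding st_def using I_fin
      by (intro Bochner_Integration.integral_sum integrable_mult_left integrable_real_indicator) auto
    also have "\<dots> = (\<Sum>i<N ^ 5. measure (mu a) (I i) * (V w (real i * h))\<^sup>2)"
      using sets.sets_into_space[OF I_sets] by (simp add: Int_absorb2)
    finally show "grid_sum a N (V w) = (\<integral>t. st w t \<partial>mu a)"
      by (simp add: grid_sum_def grid_wt_def I_def h_def)
  qed
  have st_eq: "st w t = (V w (real i * h))\<^sup>2" if "t \<in> I i" "i < N ^ 5" for w t i
  proof -
    have "t \<notin> I j" if "j \<noteq> i" for j
    proof
      assume "t \<in> I j"
      with \<open>t \<in> I i\<close> have "real i * h < real (Suc j) * h" "real j * h < real (Suc i) * h"
        unfolding I_def by (auto simp del: of_nat_Suc)
      then have "real i < real (Suc j)" "real j < real (Suc i)"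
        using h by (simp_all only: mult_less_cancel_right)
      with that show False by simp
    qed
    then have "st w t = (\<Sum>j<N ^ 5. if j = i then (V w (real i * h))\<^sup>2 else 0)"
      unfolding st_def using that by (intro sum.cong) (auto simp: indicator_def)
    then show ?thesis using that by simp
  qed
  have st_0: "st w t = 0" if "\<And>i. i < N ^ 5 \<Longrightarrow> t \<notin> I i" for w t
    unfolding st_def using that by (intro sum.neutral) auto
  have "(\<integral>\<^sup>+w. ennreal \<bar>(\<integral>t. (V w t)\<^sup>2 \<partial>mu a) - grid_sum a N (V w)\<bar> \<partial>M) \<le>
      (\<integral>\<^sup>+w. (\<integral>\<^sup>+t. ennreal \<bar>(V w t)\<^sup>2 - st w t\<bar> \<partial>mu a) \<partial>M)"
  proof (rule nn_integral_mono_AE)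
    show "AE w in M. ennreal \<bar>(\<integral>t. (V w t)\<^sup>2 \<partial>mu a) - grid_sum a N (V w)\<bar> \<le> (\<integral>\<^sup>+t. ennreal \<bar>(V w t)\<^sup>2 - st w t\<bar> \<partial>mu a)"
      using bridge_bounds_integrable(2)[OF assms(1) V a]
    proof eventually_elim
      case (elim w)
      have "ennreal (norm (\<integral>t. (V w t)\<^sup>2 - st w t \<partial>mu a)) \<le> (\<integral>\<^sup>+t. norm ((V w t)\<^sup>2 - st w t) \<partial>mu a)"
        by (intro integral_norm_bound_ennreal Bochner_Integration.integrable_diff elim st_int)
      then show ?case
        using elim st_int by (simp add: gs)
    qed
  qed
  also have "\<dots> = (\<integral>\<^sup>+t. (\<integral>\<^sup>+w. ennreal \<bar>(V w t)\<^sup>2 - st w t\<bar> \<partial>M) \<partial>mu a)"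
    by (intro Fubini'[symmetric]) measurable
  also have "\<dots> \<le> (\<integral>\<^sup>+t. ennreal (3 * sqrt h) * indicator (\<Union>i<N ^ 5. I i) t + ennreal (exp (- real N / 2)) * ennreal (exp (- (1 / 2) * t)) \<partial>mu a)"
  proof (rule nn_integral_mono)
    fix t assume "t \<in> space (mu a)"
    then have t: "0 \<le> t" by simp
    show "(\<integral>\<^sup>+w. ennreal \<bar>(V w t)\<^sup>2 - st w t\<bar> \<partial>M) \<le> ennreal (3 * sqrt h) * indicator (\<Union>i<N ^ 5. I i) t + ennreal (exp (- real N / 2)) * ennreal (exp (- (1 / 2) * t))"
    proof (cases "t \<in> (\<Union>i<N ^ 5. I i)")
      case True
      then obtain i where i: "i < N ^ 5" "t \<in> I i" by auto
      have "(\<integral>\<^sup>+w. ennreal \<bar>(V w t)\<^sup>2 - (V w (real i * h))\<^sup>2\<bar> \<partial>M) \<le> ennreal (3 * sqrt h)"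
        using i h by (intro bridge_bounds_sq_diff[OF V]) (auto simp: I_def algebra_simps)
      then show ?thesis
        using True i by (auto simp: st_eq[OF i(2,1)] intro: order_trans[OF _ le_add1] add_increasing2)
    next
      case False
      have tN: "real N \<le> t"
      proof (rule ccontr)
        assume "\<not> real N \<le> t"
        define i where "i = nat \<lfloor>t / h\<rfloor>"
        have "real i \<le> t / h" "t / h < real i + 1"
          using t h by (auto simp: i_def)
        then have ti: "t \<in> I i" using h by (auto simp: I_def field_simps)
        have "real i < real (N ^ 5)"
        proof -
          have "real i \<le> t / h" by fact
          also have "\<dots> < real N / h" using h \<open>\<not> real N \<le> t\<close> by (simp add: divide_strict_right_mono)
          also have "\<dots> = real (N ^ 5)" using N by (simp add: h_def eval_nat_numeral)
          finally show ?thesis .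
        qed
        then have "i < N ^ 5" using of_nat_less_iff by blast
        with ti False show False by auto
      qed
      have "(\<integral>\<^sup>+w. ennreal \<bar>(V w t)\<^sup>2 - st w t\<bar> \<partial>M) = (\<integral>\<^sup>+w. ennreal ((V w t)\<^sup>2) \<partial>M)"
        using False by (intro nn_integral_cong) (simp add: st_0)
      also have "\<dots> \<le> ennreal (exp (- t))"
        by (rule bridge_boundsD(1)[OF V t t])
      \<comment> \<open>Half of the exponent supplies the smallness beyond N, the other half remains
        as an integrable function of \<open>t\<close>.\<close>
      also have "\<dots> \<le> ennreal (exp (- real N / 2)) * ennreal (exp (- (1 / 2) * t))"
        using tN by (simp add: ennreal_mult[symmetric] exp_add[symmetric] ennreal_leI)
      finally show ?thesis using False by simp
    qed
  qed
  also have "\<dots> = ennreal (3 * sqrt h) * emeasure (mu a) (\<Union>i<N ^ 5. I i) + ennreal (exp (- real N / 2)) * (\<integral>\<^sup>+t. ennreal (exp (- (1 / 2) * t)) \<partial>mu a)"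
    by (subst nn_integral_add) (auto simp: nn_integral_cmult nn_integral_cmult_indicator intro!: borel_measurable_muI)
  also have "\<dots> \<le> ennreal (3 * sqrt h) * ennreal (real N) + ennreal (exp (- real N / 2)) * ennreal (1 / (1 / 2))"
  proof (intro add_mono mult_left_mono nn_integral_mu_exp)
    have "(\<Union>i<N ^ 5. I i) \<subseteq> {0..<real N}"
    proof (rule UN_least)
      fix i assume "i \<in> {..<N ^ 5}"
      then have "real (Suc i) \<le> real (N ^ 5)" by (simp del: of_nat_Suc)
      then have "real (Suc i) * h \<le> real (N ^ 5) * h" using h by (intro mult_right_mono) auto
      also have "\<dots> = real N" using N by (simp add: h_def eval_nat_numeral)
      finally show "I i \<subseteq> {0..<real N}" using h by (auto simp: I_def intro: order_trans[rotated])
    qed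
    then have "emeasure (mu a) (\<Union>i<N ^ 5. I i) \<le> emeasure (mu a) {0..<real N}"
      by (intro emeasure_mono) (auto simp: sets_mu sets_restrict_space intro!: image_eqI[of _ _ "{0..<real N}"])
    also have "\<dots> \<le> ennreal (real N - 0)"
      using a by (intro emeasure_mu_Ico_le) auto
    finally show "emeasure (mu a) (\<Union>i<N ^ 5. I i) \<le> ennreal (real N)" by simp
  qed (use a in auto)
  also have "ennreal (3 * sqrt h) * ennreal (real N) = ennreal (3 * sqrt h * real N)"
    using h by (intro ennreal_mult[symmetric]) auto
  also have "ennreal (exp (- real N / 2)) * ennreal (1 / (1 / 2)) = ennreal (exp (- real N / 2) * (1 / (1 / 2)))"
    by (intro ennreal_mult[symmetric]) auto
  also have "ennreal (3 * sqrt h * real N) + ennreal (exp (- real N / 2) * (1 / (1 / 2))) =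
      ennreal (3 * sqrt h * real N + exp (- real N / 2) * (1 / (1 / 2)))"
    using h by (intro ennreal_plus[symmetric]) auto
  also have "\<dots> \<le> ennreal (7 / N)"
  proof (rule ennreal_leI)
    have "sqrt h = 1 / real N ^ 2"
      by (rule real_sqrt_unique) (simp_all add: h_def power_divide flip: power_mult)
    then have 1: "3 * sqrt h * real N = 3 / N" using N by (simp add: power2_eq_square)
    have "real N / 2 \<le> exp (real N / 2)" using exp_ge_add_one_self[of "real N / 2"] by linarith
    then have "exp (- real N / 2) \<le> 2 / N" using N by (simp add: exp_minus field_simps)
    with 1 show "3 * sqrt h * real N + exp (- real N / 2) * (1 / (1 / 2)) \<le> 7 / N" by (simp add: field_simps)
  qed
  finally show ?thesis .
qed

lemma measurable_grid_sum:
  assumes "bridge_bounds M V"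
  shows "(\<lambda>w. grid_sum a N (V w)) \<in> borel_measurable M"
  using bridge_bounds_measurable[OF assms] unfolding grid_sum_def by measurable

lemma measurable_integral_sq:
  assumes "bridge_bounds M V"
  shows "(\<lambda>w. \<integral>t. (V w t)\<^sup>2 \<partial>mu a) \<in> borel_measurable M"
proof -
  interpret mu: sigma_finite_measure "mu a" by (rule sigma_finite_mu)
  note [measurable] = bridge_bounds_measurable_pair[OF assms, of a]
  show ?thesis by measurable
qed

text \<open>The value at \<open>c\<close> of the characteristic function of a centred Gaussian
  vector with covariance matrix \<open>K (y i) (y j)\<close>. It serves as a name for the common
  limit of the two families.\<close>

definition gauss_char :: "(real \<Rightarrow> real \<Rightarrow> real) \<Rightarrow> nat \<Rightarrow> (nat \<Rightarrow> real) \<Rightarrow> (nat \<Rightarrow> real) \<Rightarrow> complex" where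
  "gauss_char K n c y = exp (- (\<Sum>i<n. \<Sum>j<n. c i * c j * K (y i) (y j)) / 2)"

lemma grid_laplace_conv:
  fixes V :: "nat \<Rightarrow> 'a \<Rightarrow> real \<Rightarrow> real"
  assumes M: "prob_space M" and V: "\<And>n. bridge_bounds M (V n)" and m: "0 \<le> m"
    and conv: "\<And>k c y. (\<And>i. i < k \<Longrightarrow> 0 \<le> y i) \<Longrightarrow>
      (\<lambda>n. \<integral>w. iexp (\<Sum>i<k. c i * V n w (y i)) \<partial>M) \<longlonglongrightarrow> gauss_char K k c y"
  shows "(\<lambda>n. complex_of_real (\<integral>w. exp (- m * grid_sum a N (V n w)) \<partial>M)) \<longlonglongrightarrow>
    (\<integral>z. gauss_char K (N ^ 5) (\<lambda>i. z i * sqrt (2 * m * grid_wt a N i)) (\<lambda>i. real i / real N ^ 4) \<partial>gauss)"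
proof -
  \<comment> \<open>The weights move into the variables; the factor 2 compensates the division by 2
    in the Gaussian identity.\<close>
  define \<theta> where "\<theta> N i = sqrt (2 * m * grid_wt a N i)" for N i
  have eq: "exp (- m * grid_sum a N v) = exp (- (\<Sum>i<N ^ 5. (\<theta> N i * v (real i / real N ^ 4))\<^sup>2) / 2)" for v
    unfolding grid_sum_def \<theta>_def using m 
    by (simp add: grid_wt_def power_mult_distrib sum_distrib_left sum_divide_distrib sum_negf[symmetric] mult_ac del: of_nat_Suc)
  show ?thesis
    unfolding eq \<theta>_def[symmetric]
  proof (rule char_conv_imp_laplace_conv[OF M])
    show "(\<lambda>w. \<theta> N i * V n w (real i / real N ^ 4)) \<in> borel_measurable M" for n i
      using bridge_bounds_measurable[OF V] by measurable
    show "(\<lambda>n. \<integral>w. iexp (\<Sum>i<N ^ 5. c i * (\<theta> N i * V n w (real i / real N ^ 4))) \<partial>M)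
        \<longlonglongrightarrow> gauss_char K (N ^ 5) (\<lambda>i. c i * \<theta> N i) (\<lambda>i. real i / real N ^ 4)" for c
      using conv[of "N ^ 5" "\<lambda>i. real i / real N ^ 4" "\<lambda>i. c i * \<theta> N i"] by (simp add: mult.assoc)
  qed
qed

text \<open>The discretisation errors do not depend on the index of the sequences, so
  \<open>N\<close> can be fixed before \<open>n\<close> grows. For fixed \<open>N\<close> both grid
  transforms tend to the same Gaussian average, which cancels.\<close>

lemma laplace_universal:
  fixes V :: "nat \<Rightarrow> 'a \<Rightarrow> real \<Rightarrow> real" and V' :: "nat \<Rightarrow> 'b \<Rightarrow> real \<Rightarrow> real"
  assumes M: "prob_space M" and V: "\<And>n. bridge_bounds M (V n)"
    and M': "prob_space M'" and V': "\<And>n. bridge_bounds M' (V' n)"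
    and conv: "\<And>k c y. (\<And>i. i < k \<Longrightarrow> 0 \<le> y i) \<Longrightarrow>
      (\<lambda>n. \<integral>w. iexp (\<Sum>i<k. c i * V n w (y i)) \<partial>M) \<longlonglongrightarrow> gauss_char K k c y"
    and conv': "\<And>k c y. (\<And>i. i < k \<Longrightarrow> 0 \<le> y i) \<Longrightarrow>
      (\<lambda>n. \<integral>w. iexp (\<Sum>i<k. c i * V' n w (y i)) \<partial>M') \<longlonglongrightarrow> gauss_char K k c y"
    and m: "0 \<le> m" and a: "0 \<le> a"
  shows "(\<lambda>n. (\<integral>w. exp (- m * (\<integral>t. (V n w t)\<^sup>2 \<partial>mu a)) \<partial>M) - (\<integral>w. exp (- m * (\<integral>t. (V' n w t)\<^sup>2 \<partial>mu a)) \<partial>M')) \<longlonglongrightarrow> 0"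
proof (rule LIMSEQ_I)
  let ?E = "\<lambda>n. \<integral>w. exp (- m * (\<integral>t. (V n w t)\<^sup>2 \<partial>mu a)) \<partial>M"
    and ?E' = "\<lambda>n. \<integral>w. exp (- m * (\<integral>t. (V' n w t)\<^sup>2 \<partial>mu a)) \<partial>M'"
    and ?G = "\<lambda>N n. \<integral>w. exp (- m * grid_sum a N (V n w)) \<partial>M"
    and ?G' = "\<lambda>N n. \<integral>w. exp (- m * grid_sum a N (V' n w)) \<partial>M'"
  fix r :: real assume r: "0 < r"
  \<comment> \<open>More than \<open>42 * m / r\<close> grid units make each discretisation error
    \<open>m * (7 / N)\<close> less than \<open>r / 6\<close>, within the share \<open>r / 4\<close>
    allotted to it.\<close>
  define N where "N = nat \<lceil>42 * m / r\<rceil> + 1"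
  have "42 * m / r < real N" unfolding N_def by linarith
  moreover have N0: "0 < N" by (simp add: N_def)
  ultimately have N: "0 < N" "m * (7 / N) < r / 4"
    using r m by (auto simp: field_simps)
  interpret M: prob_space M by fact
  interpret M': prob_space M' by fact
  have gnn: "0 \<le> grid_sum a N v" for v by (auto simp: grid_sum_def grid_wt_def intro!: sum_nonneg)
  have 1: "\<bar>(?E n) - (?G N n)\<bar> \<le> m * (7 / N)" for n
    using m by (intro M.laplace_diff_le measurable_integral_sq measurable_grid_sum V grid_sum_approx a M N) (auto simp: gnn)
  have 2: "\<bar>(?E' n) - (?G' N n)\<bar> \<le> m * (7 / N)" for n
    using m by (intro M'.laplace_diff_le measurable_integral_sq measurable_grid_sum V' grid_sum_approx a M' N) (auto simp: gnn)
  have "(\<lambda>n. complex_of_real (?G N n) - complex_of_real (?G' N n)) \<longlonglongrightarrow> 0"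
    using tendsto_diff[OF grid_laplace_conv[OF M V m conv, of a N] grid_laplace_conv[OF M' V' m conv', of a N]] by simp
  then obtain n0 where n0: "\<And>n. n \<ge> n0 \<Longrightarrow> norm (complex_of_real (?G N n) - complex_of_real (?G' N n)) < r / 4"
    using LIMSEQ_D[of _ 0 "r / 4"] r by fastforce
  show "\<exists>no. \<forall>n\<ge>no. norm ((?E n) - (?E' n) - 0) < r"
  proof (intro exI allI impI)
    fix n assume "n \<ge> n0"
    from n0[OF this] have "\<bar>(?G N n) - (?G' N n)\<bar> < r / 4"
      by (simp only: of_real_diff[symmetric] norm_of_real)
    with 1[of n] 2[of n] N(2) r show "norm ((?E n) - (?E' n) - 0) < r"
      unfolding real_norm_def by linarith
  qed
qed

section \<open>The space of weighted square-integrable functions\<close>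

lemma Ha_measurable: "f \<in> Ha a \<Longrightarrow> f \<in> borel_measurable (mu a)"
  by (simp add: Ha_def)

lemma Ha_sq_integrable: "f \<in> Ha a \<Longrightarrow> integrable (mu a) (\<lambda>t. (f t)\<^sup>2)"
  by (simp add: Ha_def)

lemma Ha_mult_integrable:
  assumes f: "f \<in> Ha a" and g: "g \<in> Ha a"
  shows "integrable (mu a) (\<lambda>t. f t * g t)"
proof (rule Bochner_Integration.integrable_bound)
  show "integrable (mu a) (\<lambda>t. (f t)\<^sup>2 + (g t)\<^sup>2)"
    using f g by (simp add: Ha_sq_integrable)
  show "(\<lambda>t. f t * g t) \<in> borel_measurable (mu a)"
    using Ha_measurable[OF f] Ha_measurable[OF g] by simp
  have "\<bar>x * y\<bar> \<le> x\<^sup>2 + y\<^sup>2" for x y :: real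
    using sum_squares_bound[of "\<bar>x\<bar>" "\<bar>y\<bar>"] abs_ge_zero[of "x * y"] unfolding abs_mult power2_abs by linarith
  then show "AE t in mu a. norm (f t * g t) \<le> norm ((f t)\<^sup>2 + (g t)\<^sup>2)"
    by (intro AE_I2) (simp add: abs_of_nonneg)
qed

lemma Ha_add: "f \<in> Ha a \<Longrightarrow> g \<in> Ha a \<Longrightarrow> (\<lambda>t. f t + g t) \<in> Ha a"
  using Ha_mult_integrable[of f a g] by (auto simp: Ha_def power2_sum mult.assoc)

lemma Ha_scale: "f \<in> Ha a \<Longrightarrow> (\<lambda>t. c * f t) \<in> Ha a"
  by (auto simp: Ha_def power_mult_distrib)

lemma Ha_diff: "f \<in> Ha a \<Longrightarrow> g \<in> Ha a \<Longrightarrow> (\<lambda>t. f t - g t) \<in> Ha a"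
  using Ha_add[OF _ Ha_scale[of g a "- 1"], of f] by simp

lemma Ha_zero: "(\<lambda>t. 0) \<in> Ha a"
  by (simp add: Ha_def)

lemma Ha_sum: "(\<And>m. m \<in> I \<Longrightarrow> f m \<in> Ha a) \<Longrightarrow> (\<lambda>t. \<Sum>m\<in>I. f m t) \<in> Ha a"
  by (induction I rule: infinite_finite_induct) (auto simp: Ha_zero Ha_add)

lemma Ha_inner_commute: "Ha_inner a f g = Ha_inner a g f"
  by (simp add: Ha_inner_def mult.commute)

lemma Ha_inner_add: "f \<in> Ha a \<Longrightarrow> g \<in> Ha a \<Longrightarrow> h \<in> Ha a \<Longrightarrow>
    Ha_inner a (\<lambda>t. f t + g t) h = Ha_inner a f h + Ha_inner a g h"
  by (simp add: Ha_inner_def distrib_right Ha_mult_integrable)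

lemma Ha_inner_diff: "f \<in> Ha a \<Longrightarrow> g \<in> Ha a \<Longrightarrow> h \<in> Ha a \<Longrightarrow>
    Ha_inner a (\<lambda>t. f t - g t) h = Ha_inner a f h - Ha_inner a g h"
  by (simp add: Ha_inner_def left_diff_distrib Ha_mult_integrable)

lemma Ha_inner_scale: "Ha_inner a (\<lambda>t. c * f t) h = c * Ha_inner a f h"
  by (simp add: Ha_inner_def mult.assoc)

lemma Ha_inner_sum:
  assumes "\<And>m. m \<in> I \<Longrightarrow> f m \<in> Ha a" "h \<in> Ha a"
  shows "Ha_inner a (\<lambda>t. \<Sum>m\<in>I. f m t) h = (\<Sum>m\<in>I. Ha_inner a (f m) h)"
  unfolding Ha_inner_def sum_distrib_right using assms
  by (intro Bochner_Integration.integral_sum Ha_mult_integrable) auto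

lemma Ha_norm_sq: "(Ha_norm a f)\<^sup>2 = (\<integral>t. (f t)\<^sup>2 \<partial>mu a)"
  by (simp add: Ha_norm_def Ha_inner_def power2_eq_square[symmetric])

lemma Ha_norm_nonneg: "0 \<le> Ha_norm a f"
  by (simp add: Ha_norm_def Ha_inner_def)

lemma Ha_norm_zero: "Ha_norm a (\<lambda>t. 0) = 0"
  by (simp add: Ha_norm_def Ha_inner_def)

lemma Ha_norm_minus: "Ha_norm a (\<lambda>t. f t - g t) = Ha_norm a (\<lambda>t. g t - f t)"
  by (simp add: Ha_norm_def Ha_inner_def algebra_simps)

lemma Ha_norm_scale: "Ha_norm a (\<lambda>t. c * f t) = \<bar>c\<bar> * Ha_norm a f"
proof (rule power2_eq_imp_eq)
  show "(Ha_norm a (\<lambda>t. c * f t))\<^sup>2 = (\<bar>c\<bar> * Ha_norm a f)\<^sup>2"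
    by (simp add: Ha_norm_sq power_mult_distrib)
qed (simp_all add: Ha_norm_nonneg)

text \<open>The discriminant argument for the squared norm of \<open>f - x * g\<close> as a
  polynomial in \<open>x\<close>. Since representatives are used, a nonzero \<open>g\<close> may
  have norm 0, and the degenerate polynomial is treated separately.\<close>

lemma Ha_Cauchy_Schwarz:
  assumes f: "f \<in> Ha a" and g: "g \<in> Ha a"
  shows "\<bar>Ha_inner a f g\<bar> \<le> Ha_norm a f * Ha_norm a g"
proof -
  define F G c where "F = (Ha_norm a f)\<^sup>2" and "G = (Ha_norm a g)\<^sup>2" and "c = Ha_inner a f g"
  have q: "0 \<le> F - 2 * x * c + x\<^sup>2 * G" for x
  proof -
    have "(Ha_norm a (\<lambda>t. f t - x * g t))\<^sup>2 = (\<integral>t. (f t)\<^sup>2 - 2 * x * (f t * g t) + x\<^sup>2 * (g t)\<^sup>2 \<partial>mu a)"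
      unfolding Ha_norm_sq by (intro arg_cong[where f="integral\<^sup>L (mu a)"] ext) (simp add: power2_eq_square algebra_simps)
    also have "\<dots> = F - 2 * x * c + x\<^sup>2 * G"
      using Ha_mult_integrable[OF f g] Ha_sq_integrable[OF f] Ha_sq_integrable[OF g]
      by (simp add: F_def G_def c_def Ha_norm_sq Ha_inner_def)
    finally show ?thesis by (metis zero_le_power2)
  qed
  have "c\<^sup>2 \<le> F * G"
  proof (cases "G = 0")
    case True
    have "c = 0"
    proof (rule ccontr)
      assume c: "c \<noteq> 0"
      \<comment> \<open>At this argument the affine function takes the value
        \<open>F - (F + 1) = - 1\<close>.\<close>
      from q[of "(F + 1) / (2 * c)"] True c show False by (simp add: F_def)
    qed
    then show ?thesis using True by simp
  next
    case False
    then have "0 < G" by (simp add: G_def)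
    with q[of "c / G"] have "0 \<le> F - c\<^sup>2 / G"
      by (simp add: power2_eq_square field_simps)
    with \<open>0 < G\<close> show ?thesis by (simp add: field_simps)
  qed
  then have "\<bar>c\<bar>\<^sup>2 \<le> (Ha_norm a f * Ha_norm a g)\<^sup>2"
    by (simp add: F_def G_def power_mult_distrib)
  then show ?thesis
    unfolding c_def by (rule power2_le_imp_le) (simp add: Ha_norm_nonneg)
qed

lemma Ha_norm_triangle:
  assumes f: "f \<in> Ha a" and g: "g \<in> Ha a"
  shows "Ha_norm a (\<lambda>t. f t + g t) \<le> Ha_norm a f + Ha_norm a g"
proof (rule power2_le_imp_le)
  have "(Ha_norm a (\<lambda>t. f t + g t))\<^sup>2 = (Ha_norm a f)\<^sup>2 + 2 * Ha_inner a f g + (Ha_norm a g)\<^sup>2"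
    using Ha_mult_integrable[OF f g] Ha_sq_integrable[OF f] Ha_sq_integrable[OF g]
    by (simp add: Ha_norm_sq Ha_inner_def power2_sum mult.assoc)
  also have "\<dots> \<le> (Ha_norm a f + Ha_norm a g)\<^sup>2"
    using Ha_Cauchy_Schwarz[OF f g] by (simp add: power2_sum)
  finally show "(Ha_norm a (\<lambda>t. f t + g t))\<^sup>2 \<le> (Ha_norm a f + Ha_norm a g)\<^sup>2" .
qed (simp add: Ha_norm_nonneg)

lemma Ha_dist_triangle:
  assumes "f \<in> Ha a" "g \<in> Ha a" "h \<in> Ha a"
  shows "Ha_norm a (\<lambda>t. f t - h t) \<le> Ha_norm a (\<lambda>t. f t - g t) + Ha_norm a (\<lambda>t. g t - h t)"
  using Ha_norm_triangle[of "\<lambda>t. f t - g t" a "\<lambda>t. g t - h t"] assms by (simp add: Ha_diff)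

lemma Ha_norm_sum:
  assumes "\<And>m. m \<in> I \<Longrightarrow> f m \<in> Ha a"
  shows "Ha_norm a (\<lambda>t. \<Sum>m\<in>I. f m t) \<le> (\<Sum>m\<in>I. Ha_norm a (f m))"
  using assms
proof (induction I rule: infinite_finite_induct)
  case (insert x F)
  then have "Ha_norm a (\<lambda>t. f x t + (\<Sum>m\<in>F. f m t)) \<le> Ha_norm a (f x) + Ha_norm a (\<lambda>t. \<Sum>m\<in>F. f m t)"
    by (intro Ha_norm_triangle Ha_sum) auto
  also have "\<dots> \<le> Ha_norm a (f x) + (\<Sum>m\<in>F. Ha_norm a (f m))"
    using insert by simp
  finally show ?case using insert by simp
qed (simp_all add: Ha_norm_zero)

lemma Ha_norm_tendsto:
  assumes f: "\<And>n. f n \<in> Ha a" and g: "g \<in> Ha a"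
    and lim: "(\<lambda>n. Ha_norm a (\<lambda>t. f n t - g t)) \<longlonglongrightarrow> 0"
  shows "(\<lambda>n. Ha_norm a (f n)) \<longlonglongrightarrow> Ha_norm a g"
proof (rule LIM_zero_cancel, rule Lim_null_comparison[OF _ lim], rule always_eventually, rule allI)
  fix n
  have "Ha_norm a (f n) \<le> Ha_norm a (\<lambda>t. f n t - g t) + Ha_norm a g"
    using Ha_dist_triangle[OF f g Ha_zero, of n] by simp
  moreover have "Ha_norm a g \<le> Ha_norm a (\<lambda>t. f n t - g t) + Ha_norm a (f n)"
    using Ha_dist_triangle[OF g f Ha_zero, of n] by (simp add: Ha_norm_minus[of a g])
  ultimately show "norm (Ha_norm a (f n) - Ha_norm a g) \<le> Ha_norm a (\<lambda>t. f n t - g t)"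
    by (simp add: abs_le_iff)
qed

lemma Ha_inner_tendsto:
  assumes f: "\<And>n. f n \<in> Ha a" and g: "g \<in> Ha a" and h: "h \<in> Ha a"
    and lim: "(\<lambda>n. Ha_norm a (\<lambda>t. f n t - g t)) \<longlonglongrightarrow> 0"
  shows "(\<lambda>n. Ha_inner a (f n) h) \<longlonglongrightarrow> Ha_inner a g h"
proof (rule LIM_zero_cancel, rule Lim_null_comparison)
  show "(\<lambda>n. Ha_norm a (\<lambda>t. f n t - g t) * Ha_norm a h) \<longlonglongrightarrow> 0"
    using tendsto_mult_left_zero[OF lim] .
  show "\<forall>\<^sub>F n in sequentially. norm (Ha_inner a (f n) h - Ha_inner a g h) \<le> Ha_norm a (\<lambda>t. f n t - g t) * Ha_norm a h"
    using Ha_Cauchy_Schwarz[OF Ha_diff[OF f g] h] f g h by (simp add: Ha_inner_diff)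
qed

section \<open>The Borel sigma-field and measurability of random elements\<close>

lemma space_Ha_borel [simp]: "space (Ha_borel a) = Ha a"
  by (simp add: Ha_borel_def space_measure_of_conv)

lemma sets_Ha_borel_open: "Ha_open a U \<Longrightarrow> U \<in> sets (Ha_borel a)"
  by (auto simp: Ha_borel_def Ha_open_def intro!: sigma_sets.Basic subset_Pow_Union)

lemma Ha_openD:
  assumes "Ha_open a U" "f \<in> U"
  shows "\<exists>e>0. \<forall>g\<in>Ha a. Ha_norm a (\<lambda>t. g t - f t) < e \<longrightarrow> g \<in> U"
  using assms unfolding Ha_open_def by blast

lemma measurable_Ha_borelI:
  assumes "\<And>w. w \<in> space M \<Longrightarrow> Z w \<in> Ha a"
    and "\<And>U. Ha_open a U \<Longrightarrow> {w \<in> space M. Z w \<in> U} \<in> sets M"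
  shows "Z \<in> measurable M (Ha_borel a)"
  unfolding Ha_borel_def
  by (rule measurable_measure_of) (use assms in \<open>auto simp: Ha_open_def vimage_def Int_def conj_commute\<close>)

lemma Ha_open_near:
  assumes C: "C \<subseteq> Ha a"
  shows "Ha_open a {f \<in> Ha a. \<exists>g\<in>C. Ha_norm a (\<lambda>t. g t - f t) < e}"
  unfolding Ha_open_def
proof (intro conjI ballI)
  fix f assume "f \<in> {f \<in> Ha a. \<exists>g\<in>C. Ha_norm a (\<lambda>t. g t - f t) < e}"
  then obtain g where f: "f \<in> Ha a" and g: "g \<in> C" "Ha_norm a (\<lambda>t. g t - f t) < e" by auto
  then have gH: "g \<in> Ha a" using C by auto
  show "\<exists>d>0. \<forall>h\<in>Ha a. Ha_norm a (\<lambda>t. h t - f t) < d \<longrightarrow> h \<in> {f \<in> Ha a. \<exists>g\<in>C. Ha_norm a (\<lambda>t. g t - f t) < e}"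
  proof (intro exI conjI ballI impI)
    show "0 < e - Ha_norm a (\<lambda>t. g t - f t)" using g by simp
    fix h assume h: "h \<in> Ha a" and "Ha_norm a (\<lambda>t. h t - f t) < e - Ha_norm a (\<lambda>t. g t - f t)"
    then have "Ha_norm a (\<lambda>t. g t - h t) < e"
      using Ha_dist_triangle[OF gH f h] Ha_norm_minus[of a f h] by simp
    with g h show "h \<in> {f \<in> Ha a. \<exists>g\<in>C. Ha_norm a (\<lambda>t. g t - f t) < e}" by auto
  qed
qed auto

text \<open>A limit lies in the open set \<open>U\<close> iff for some \<open>k\<close> the
  approximating points eventually keep distance at least \<open>1 / (k + 1)\<close> from the
  complement. The open sets \<open>N k\<close> are neighbourhoods of the complement; they replace
  the distance function and are empty when the complement is.\<close>

lemma measurable_Ha_borel_limit: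
  assumes S: "\<And>n. S n \<in> measurable M (Ha_borel a)" and Z: "\<And>w. w \<in> space M \<Longrightarrow> Z w \<in> Ha a"
    and lim: "\<And>w. w \<in> space M \<Longrightarrow> (\<lambda>n. Ha_norm a (\<lambda>t. S n w t - Z w t)) \<longlonglongrightarrow> 0"
  shows "Z \<in> measurable M (Ha_borel a)"
proof (rule measurable_Ha_borelI)
  fix U assume U: "Ha_open a U"
  have SH: "S n w \<in> Ha a" if "w \<in> space M" for n w
    using measurable_space[OF S that] by simp
  define N where "N k = {f \<in> Ha a. \<exists>g\<in>Ha a - U. Ha_norm a (\<lambda>t. g t - f t) < 1 / real (Suc k)}" for k
  have N_sets: "N k \<in> sets (Ha_borel a)" for k
    unfolding N_def by (intro sets_Ha_borel_open Ha_open_near) auto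
  have "{w \<in> space M. Z w \<in> U} = (\<Union>k. \<Union>n0. \<Inter>n\<in>{n0..}. {w \<in> space M. S n w \<notin> N k})"
  proof (intro set_eqI iffI)
    fix w assume "w \<in> {w \<in> space M. Z w \<in> U}"
    then have w: "w \<in> space M" and ZU: "Z w \<in> U" by auto
    then obtain e where e: "0 < e" "\<And>g. g \<in> Ha a \<Longrightarrow> Ha_norm a (\<lambda>t. g t - Z w t) < e \<Longrightarrow> g \<in> U"
      using Ha_openD[OF U ZU] by auto
    obtain k where k: "1 / real (Suc k) < e / 2"
      using nat_approx_posE[of "e / 2"] e by auto
    obtain n0 where n0: "\<And>n. n \<ge> n0 \<Longrightarrow> Ha_norm a (\<lambda>t. S n w t - Z w t) < e / 2"
      using LIMSEQ_D[OF lim[OF w], of "e / 2"] e by (auto simp: Ha_norm_nonneg)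
    have "S n w \<notin> N k" if "n \<ge> n0" for n
    proof
      assume "S n w \<in> N k"
      then obtain g where g: "g \<in> Ha a" "g \<notin> U" "Ha_norm a (\<lambda>t. g t - S n w t) < 1 / real (Suc k)"
        by (auto simp: N_def)
      have "Ha_norm a (\<lambda>t. g t - Z w t) < e"
        using Ha_dist_triangle[OF g(1) SH[OF w] Z[OF w], of n] g(3) k n0[OF that] by linarith
      with e(2) g show False by auto
    qed
    with w show "w \<in> (\<Union>k. \<Union>n0. \<Inter>n\<in>{n0..}. {w \<in> space M. S n w \<notin> N k})" by auto
  next
    fix w assume "w \<in> (\<Union>k. \<Union>n0. \<Inter>n\<in>{n0..}. {w \<in> space M. S n w \<notin> N k})"
    then obtain k n0 where w: "w \<in> space M" and *: "\<And>n. n \<ge> n0 \<Longrightarrow> S n w \<notin> N k" by auto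
    obtain n1 where n1: "\<And>n. n \<ge> n1 \<Longrightarrow> Ha_norm a (\<lambda>t. S n w t - Z w t) < 1 / real (Suc k)"
      using LIMSEQ_D[OF lim[OF w], of "1 / real (Suc k)"] by (auto simp: Ha_norm_nonneg)
    define n where "n = max n0 n1"
    have "Ha_norm a (\<lambda>t. Z w t - S n w t) < 1 / real (Suc k)"
      using n1[of n] by (simp add: n_def Ha_norm_minus[of a "Z w"])
    moreover have "S n w \<notin> N k" using *[of n] by (simp add: n_def)
    ultimately have "Z w \<in> U" using Z[OF w] SH[OF w] by (auto simp: N_def)
    with w show "w \<in> {w \<in> space M. Z w \<in> U}" by simp
  qed
  also have "\<dots> \<in> sets M"
  proof -
    have "{w \<in> space M. S n w \<notin> N k} \<in> sets M" for n k
      using measurable_sets[OF S N_sets, of n k] by (auto simp: vimage_def Int_def conj_commute intro!: sets.sets_Collect_neg)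
    then show ?thesis by (intro sets.countable_UN' sets.countable_INT') auto
  qed
  finally show "{w \<in> space M. Z w \<in> U} \<in> sets M" .
qed (use Z in auto)

text \<open>The map is continuous for the product topology: the norm of a difference is at most the
  sum of coefficient differences times the norms of the \<open>\<phi> m\<close>. Preimages of open
  sets are therefore open, hence in the sigma-field of \<open>gauss\<close>.\<close>

lemma measurable_Ha_borel_gauss_sum:
  assumes \<phi>: "\<And>m. m \<in> I \<Longrightarrow> \<phi> m \<in> Ha a"
  shows "(\<lambda>z t. \<Sum>m\<in>I. z m * \<phi> m t) \<in> measurable gauss (Ha_borel a)"
proof (rule measurable_Ha_borelI)
  let ?F = "\<lambda>z t. \<Sum>m\<in>I. z m * \<phi> m t"
  have H: "?F z \<in> Ha a" for z :: "nat \<Rightarrow> real"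
    using \<phi> by (intro Ha_sum Ha_scale)
  then show "?F z \<in> Ha a" for z :: "nat \<Rightarrow> real" .
  fix U assume U: "Ha_open a U"
  have "open {z. ?F z \<in> U}"
    unfolding open_subopen[of "{z. _ z \<in> U}"]
  proof (intro ballI)
    fix z assume "z \<in> {z. ?F z \<in> U}"
    then obtain e where e: "0 < e" "\<And>g. g \<in> Ha a \<Longrightarrow> Ha_norm a (\<lambda>t. g t - (\<Sum>m\<in>I. z m * \<phi> m t)) < e \<Longrightarrow> g \<in> U"
      using Ha_openD[OF U, of "\<lambda>t. \<Sum>m\<in>I. z m * \<phi> m t"] by auto
    let ?T = "{z'. (\<Sum>m\<in>I. \<bar>z' m - z m\<bar> * Ha_norm a (\<phi> m)) < e}"
    have "open ?T"
      by (intro open_Collect_less continuous_intros continuous_on_product_coordinates)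
    moreover have "z \<in> ?T" using e by simp
    moreover have "?T \<subseteq> {z. ?F z \<in> U}"
    proof
      fix z' assume T: "z' \<in> ?T"
      have "Ha_norm a (\<lambda>t. (\<Sum>m\<in>I. z' m * \<phi> m t) - (\<Sum>m\<in>I. z m * \<phi> m t)) = Ha_norm a (\<lambda>t. \<Sum>m\<in>I. (z' m - z m) * \<phi> m t)"
        by (simp add: sum_subtractf left_diff_distrib)
      also have "\<dots> \<le> (\<Sum>m\<in>I. Ha_norm a (\<lambda>t. (z' m - z m) * \<phi> m t))"
        using \<phi> by (intro Ha_norm_sum Ha_scale)
      also have "\<dots> < e" using T by (simp add: Ha_norm_scale)
      finally show "z' \<in> {z. ?F z \<in> U}"
        using e(2)[OF H] by simp
    qed
    ultimately show "\<exists>T. open T \<and> z \<in> T \<and> T \<subseteq> {z. ?F z \<in> U}" by blast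
  qed
  then show "{z \<in> space gauss. ?F z \<in> U} \<in> sets gauss"
    by (simp add: sets_gauss)
qed

section \<open>Normal laws and second moments of independent sums\<close>

text \<open>Levy's uniqueness theorem identifies the law: a point mass when \<open>q = 0\<close>,
  otherwise a standard normal law after division by \<open>sqrt q\<close>. The moments belong to the
  conclusion because they are read off from the law.\<close>

lemma (in prob_space) gaussian_char_normal:
  fixes Y :: "'a \<Rightarrow> real"
  assumes Y[measurable]: "Y \<in> borel_measurable M" and q: "0 \<le> q"
    and ch: "\<And>u. (\<integral>w. iexp (u * Y w) \<partial>M) = exp (- (u\<^sup>2 * q) / 2)"
  shows "normal_rv M Y 0 (sqrt q)" "integrable M Y" "expectation Y = 0"
    "integrable M (\<lambda>w. (Y w)\<^sup>2)" "expectation (\<lambda>w. (Y w)\<^sup>2) = q"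
proof -
  have "normal_rv M Y 0 (sqrt q) \<and> integrable M Y \<and> expectation Y = 0 \<and> integrable M (\<lambda>w. (Y w)\<^sup>2) \<and> expectation (\<lambda>w. (Y w)\<^sup>2) = q"
  proof (cases "q = 0")
    case True
    interpret R: prob_space "return borel (0::real)" by (rule prob_space_return) simp
    have "real_distribution (return borel (0::real))" by unfold_locales auto
    moreover have "real_distribution (distr M borel Y)" by (rule real_distribution_distr) simp
    moreover have "char (distr M borel Y) = char (return borel 0)"
    proof
      fix u
      have "char (distr M borel Y) u = 1"
        using ch[of u] True by (simp add: char_def integral_distr)
      moreover have "char (return borel 0) u = 1"
        unfolding char_def by (subst integral_return) auto
      ultimately show "char (distr M borel Y) u = char (return borel 0) u" by simp
    qed
    ultimately have "distr M borel Y = return borel 0" by (intro Levy_uniqueness)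
    moreover have "AE x in return borel (0::real). x = 0" by (subst AE_return) auto
    ultimately have "AE x in distr M borel Y. x = 0" by (simp only:)
    then have ae: "AE w in M. Y w = 0" by (subst (asm) AE_distr_iff) auto
    then have "integrable M Y" "expectation Y = 0" "integrable M (\<lambda>w. (Y w)\<^sup>2)" "expectation (\<lambda>w. (Y w)\<^sup>2) = 0"
      using integrable_cong_AE[of Y M "\<lambda>_. 0"] integral_cong_AE[of Y M "\<lambda>_. 0"]
        integrable_cong_AE[of "\<lambda>w. (Y w)\<^sup>2" M "\<lambda>_. 0"] integral_cong_AE[of "\<lambda>w. (Y w)\<^sup>2" M "\<lambda>_. 0"]
      by auto
    with ae True show ?thesis by (simp add: normal_rv_def)
  next
    case False
    define \<sigma> where "\<sigma> = sqrt q"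
    have \<sigma>: "0 < \<sigma>" "\<sigma>\<^sup>2 = q" using q False by (auto simp: \<sigma>_def)
    have "distr M borel (\<lambda>w. Y w / \<sigma>) = std_normal_distribution"
    proof (rule Levy_uniqueness)
      show "real_distribution (distr M borel (\<lambda>w. Y w / \<sigma>))" by (rule real_distribution_distr) simp
      show "real_distribution std_normal_distribution" by (rule real_dist_normal_dist)
      show "char (distr M borel (\<lambda>w. Y w / \<sigma>)) = char std_normal_distribution"
      proof
        fix u
        have "char (distr M borel (\<lambda>w. Y w / \<sigma>)) u = (\<integral>w. iexp ((u / \<sigma>) * Y w) \<partial>M)"
          by (simp add: char_def integral_distr)
        also have "\<dots> = exp (- (u\<^sup>2) / 2)"
          using \<sigma> False by (subst ch) (simp add: power_divide)
        finally show "char (distr M borel (\<lambda>w. Y w / \<sigma>)) u = char std_normal_distribution u"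
          by (simp add: char_std_normal_distribution)
      qed
    qed
    then have "distributed M lborel (\<lambda>w. Y w / \<sigma>) std_normal_density"
      unfolding distributed_def by (auto cong: distr_cong)
    then have D: "distributed M lborel Y (normal_density 0 \<sigma>)"
      by (subst normal_standard_normal_convert[OF \<sigma>(1)]) simp
    have i1: "integrable M Y"
      using distributed_integrable[OF D, of "\<lambda>x. x"] integrable_normal_moment[OF \<sigma>(1), of 0 1] by simp
    have i2: "integrable M (\<lambda>w. (Y w)\<^sup>2)"
      using distributed_integrable[OF D, of "\<lambda>x. x\<^sup>2"] integrable_normal_moment[OF \<sigma>(1), of 0 2] by simp
    have e: "expectation Y = 0" by (rule normal_distributed_expectation[OF \<sigma>(1) D])
    have "expectation (\<lambda>w. (Y w)\<^sup>2) = q"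
      using normal_distributed_variance[OF \<sigma>(1) D] e \<sigma> by simp
    with D i1 i2 e \<sigma> show ?thesis by (simp add: normal_rv_def \<sigma>_def[symmetric])
  qed
  then show "normal_rv M Y 0 (sqrt q)" "integrable M Y" "expectation Y = 0"
    "integrable M (\<lambda>w. (Y w)\<^sup>2)" "expectation (\<lambda>w. (Y w)\<^sup>2) = q" by auto
qed

text \<open>The induction also carries the integrability and the zero mean of the partial sum, by
  which the cross term with the next variable factorises and vanishes.\<close>

lemma (in prob_space) indep_second_moment_sum:
  fixes X :: "'i \<Rightarrow> 'a \<Rightarrow> real"
  assumes "finite I" "indep_vars (\<lambda>_. borel) X I"
    and "\<And>i. i \<in> I \<Longrightarrow> integrable M (\<lambda>w. (X i w)\<^sup>2)" "\<And>i. i \<in> I \<Longrightarrow> expectation (X i) = 0"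
  shows "integrable M (\<lambda>w. (\<Sum>i\<in>I. X i w)\<^sup>2)"
    and "expectation (\<lambda>w. (\<Sum>i\<in>I. X i w)\<^sup>2) = (\<Sum>i\<in>I. expectation (\<lambda>w. (X i w)\<^sup>2))"
proof -
  have "integrable M (\<lambda>w. (\<Sum>i\<in>I. X i w)\<^sup>2) \<and> integrable M (\<lambda>w. \<Sum>i\<in>I. X i w) \<and> expectation (\<lambda>w. \<Sum>i\<in>I. X i w) = 0 \<and>
     expectation (\<lambda>w. (\<Sum>i\<in>I. X i w)\<^sup>2) = (\<Sum>i\<in>I. expectation (\<lambda>w. (X i w)\<^sup>2))"
    using assms
  proof (induction I rule: finite_induct)
    case (insert j F)
    have rv: "random_variable borel (X i)" if "i \<in> insert j F" for i
      using insert.prems(1) that by (auto simp: indep_vars_def)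
    have IH: "integrable M (\<lambda>w. (\<Sum>i\<in>F. X i w)\<^sup>2)" "integrable M (\<lambda>w. \<Sum>i\<in>F. X i w)" "expectation (\<lambda>w. \<Sum>i\<in>F. X i w) = 0"
      "expectation (\<lambda>w. (\<Sum>i\<in>F. X i w)\<^sup>2) = (\<Sum>i\<in>F. expectation (\<lambda>w. (X i w)\<^sup>2))"
      using insert.IH insert.prems indep_vars_subset[OF insert.prems(1), of F] by auto
    have j1: "integrable M (X j)"
      using square_integrable_imp_integrable[OF rv insert.prems(2), of j] by simp
    have ind: "indep_var borel (X j) borel (\<lambda>w. \<Sum>i\<in>F. X i w)"
      using insert by (intro indep_vars_sum) auto
    have m: "integrable M (\<lambda>w. X j w * (\<Sum>i\<in>F. X i w))" "expectation (\<lambda>w. X j w * (\<Sum>i\<in>F. X i w)) = 0"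
      using indep_var_integrable[OF ind j1 IH(2)] indep_var_lebesgue_integral[OF ind j1 IH(2)] IH(3) by auto
    have eq: "(\<Sum>i\<in>insert j F. X i w)\<^sup>2 = (X j w)\<^sup>2 + 2 * (X j w * (\<Sum>i\<in>F. X i w)) + (\<Sum>i\<in>F. X i w)\<^sup>2" for w
      using insert.hyps by (simp add: power2_sum algebra_simps)
    show ?case
      unfolding eq using insert.hyps insert.prems IH j1 m by (auto simp: prob_space)
  qed (auto simp: prob_space)
  then show "integrable M (\<lambda>w. (\<Sum>i\<in>I. X i w)\<^sup>2)"
    and "expectation (\<lambda>w. (\<Sum>i\<in>I. X i w)\<^sup>2) = (\<Sum>i\<in>I. expectation (\<lambda>w. (X i w)\<^sup>2))" by auto
qed

lemma gauss_second_moment: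
  assumes "finite I"
  shows "(\<integral>\<^sup>+z. ennreal ((\<Sum>m\<in>I. c m * z m)\<^sup>2) \<partial>gauss) = ennreal (\<Sum>m\<in>I. (c m)\<^sup>2)"
proof -
  interpret prob_space gauss by (rule prob_space_gauss)
  have ch: "(\<integral>z. iexp (u * (\<Sum>m\<in>I. c m * z m)) \<partial>gauss) = exp (- (u\<^sup>2 * (\<Sum>m\<in>I. (c m)\<^sup>2)) / 2)" for u
    using char_gauss[OF assms, of "\<lambda>m. u * c m"] by (simp add: sum_distrib_left mult.assoc power_mult_distrib)
  have [measurable]: "(\<lambda>z. \<Sum>m\<in>I. c m * z m) \<in> borel_measurable gauss" by measurable
  note g = gaussian_char_normal[OF this _ ch]
  have "0 \<le> (\<Sum>m\<in>I. (c m)\<^sup>2)" by (simp add: sum_nonneg)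
  from g(4,5)[OF this] show ?thesis
    by (subst nn_integral_eq_integral) auto
qed

section \<open>The Schauder expansion of the covariance kernel\<close>

text \<open>The distance from \<open>x\<close> to the nearest integer.\<close>

definition tent :: "real \<Rightarrow> real" where
  "tent x = min (frac x) (1 - frac x)"

definition bridge_cov :: "real \<Rightarrow> real \<Rightarrow> real" where
  "bridge_cov u v = min u v - u * v"

lemma K0_eq: "K0 s t = exp (- max s t) - exp (- s) * exp (- t)"
  using exp_add[of "- s" "- t"] by (simp add: K0_def)

lemma K0_bridge_cov: "K0 s t = bridge_cov (exp (- s)) (exp (- t))"
  by (simp add: K0_eq bridge_cov_def min_def max_def)

text \<open>Given its value at the midpoint, a Brownian bridge consists of two independent bridges of half the size.\<close>

lemma bridge_cov_halving:
  "of_bool (\<lfloor>x\<rfloor> = \<lfloor>y\<rfloor>) * bridge_cov (frac x) (frac y) =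
   of_bool (\<lfloor>x\<rfloor> = \<lfloor>y\<rfloor>) * (tent x * tent y) +
   1 / 2 * (of_bool (\<lfloor>2 * x\<rfloor> = \<lfloor>2 * y\<rfloor>) * bridge_cov (frac (2 * x)) (frac (2 * y)))"
proof -
  have fl: "\<lfloor>2 * z\<rfloor> = 2 * \<lfloor>z\<rfloor> + (if frac z < 1 / 2 then 0 else 1)" for z :: real
  proof -
    have "z = of_int \<lfloor>z\<rfloor> + frac z" by (simp add: frac_def)
    moreover have "0 \<le> frac z" "frac z < 1" by (simp_all add: frac_lt_1)
    ultimately show ?thesis by (intro floor_unique) (auto split: if_splits)
  qed
  have fr: "frac (2 * z) = (if frac z < 1 / 2 then 2 * frac z else 2 * frac z - 1)" for z :: real
    unfolding frac_def[of "2 * z"] fl by (auto simp: frac_def)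
  show ?thesis
  proof (cases "\<lfloor>x\<rfloor> = \<lfloor>y\<rfloor>")
    case True
    have "0 \<le> frac x" "frac x < 1" "0 \<le> frac y" "frac y < 1" by (simp_all add: frac_lt_1)
    then show ?thesis unfolding fr fl using True
      by (auto simp: tent_def bridge_cov_def min_def field_simps)
  next
    case False
    then have "\<lfloor>2 * x\<rfloor> \<noteq> \<lfloor>2 * y\<rfloor>" unfolding fl by (auto split: if_splits)
    with False show ?thesis by simp
  qed
qed

text \<open>\<open>schauder j k\<close> is the Schauder function of the dyadic interval \<open>[k / 2\<^sup>j, (k + 1) / 2\<^sup>j)\<close>, composed with \<open>exp (- t)\<close>.\<close>

definition schauder :: "nat \<Rightarrow> nat \<Rightarrow> real \<Rightarrow> real" where
  "schauder j k t = (1 / sqrt 2) ^ j * tent (2 ^ j * exp (- t)) * of_bool (\<lfloor>2 ^ j * exp (- t)\<rfloor> = int k)"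

definition schauder_seq :: "nat \<Rightarrow> real \<Rightarrow> real" where
  "schauder_seq m = (case prod_decode m of (j, k) \<Rightarrow> schauder j k)"

text \<open>The range \<open>{..2 ^ j}\<close> has one index more than there are dyadic intervals in
  [0, 1): at \<open>t = 0\<close> the argument \<open>2 ^ j * exp (- t)\<close> equals
  \<open>2 ^ j\<close>. The additional Schauder function vanishes on the half-line, but with it
  every \<open>t\<close> in the closed half-line belongs to exactly one cell. Pairs are encoded as
  naturals because the coefficients form a sequence.\<close>

definition level_set :: "nat \<Rightarrow> nat set" where
  "level_set n = prod_encode ` (SIGMA j:{..<n}. {..2 ^ j})"

definition levy_sum :: "nat \<Rightarrow> (nat \<Rightarrow> real) \<Rightarrow> real \<Rightarrow> real" where
  "levy_sum n z t = (\<Sum>m\<in>level_set n. z m * schauder_seq m t)"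

text \<open>The covariance left after \<open>n\<close> levels: independent bridges on the dyadic
  intervals of length \<open>(1 / 2) ^ n\<close>, with variances scaled by that length.\<close>

definition remainder :: "nat \<Rightarrow> real \<Rightarrow> real \<Rightarrow> real" where
  "remainder n s t = (1 / 2) ^ n * (of_bool (\<lfloor>2 ^ n * exp (- s)\<rfloor> = \<lfloor>2 ^ n * exp (- t)\<rfloor>) *
     bridge_cov (frac (2 ^ n * exp (- s))) (frac (2 ^ n * exp (- t))))"

lemma finite_level_set [simp]: "finite (level_set n)"
  by (simp add: level_set_def)

lemma level_set_mono: "n \<le> n' \<Longrightarrow> level_set n \<subseteq> level_set n'"
  by (auto simp: level_set_def)

lemma sum_level_set:
  "(\<Sum>m\<in>level_set n. F (prod_decode m)) = (\<Sum>j<n. \<Sum>k\<le>2 ^ j. F (j, k))"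
  unfolding level_set_def
  by (subst sum.reindex) (auto simp: sum.Sigma intro: inj_onI)

lemma tent_bounds: "0 \<le> tent x" "tent x \<le> 1"
  by (auto simp: tent_def less_imp_le[OF frac_lt_1] min_le_iff_disj)

lemma bridge_cov_bounds:
  assumes "0 \<le> u" "u \<le> 1" "0 \<le> v" "v \<le> 1"
  shows "0 \<le> bridge_cov u v" "bridge_cov u v \<le> 1"
proof -
  have "u * v \<le> u" "u * v \<le> v" "0 \<le> u * v"
    using assms by (auto simp: mult_left_le mult_left_le_one_le)
  with assms show "0 \<le> bridge_cov u v" "bridge_cov u v \<le> 1"
    unfolding bridge_cov_def by (auto simp: min_def)
qed

lemma remainder_bounds: "0 \<le> remainder n s t" "remainder n s t \<le> (1 / 2) ^ n"
  using bridge_cov_bounds[of "frac (2 ^ n * exp (- s))" "frac (2 ^ n * exp (- t))"]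
  by (auto simp: remainder_def less_imp_le[OF frac_lt_1] mult_left_le)

text \<open>Only the endpoint \<open>exp (- 0) = 1\<close> is delicate. It opens a new unit cell
  with fractional part 0, but a bridge vanishes at both ends, so the two sides agree there as
  well.\<close>

lemma remainder_0:
  assumes "0 \<le> s" "0 \<le> t"
  shows "remainder 0 s t = K0 s t"
proof -
  have fl: "\<lfloor>exp (- x)\<rfloor> = (if x = 0 then 1 else 0)" "frac (exp (- x)) = (if x = 0 then 0 else exp (- x))"
    if "0 \<le> x" for x :: real
    using that by (auto simp: frac_def floor_eq_iff)
  show ?thesis
    using assms fl[OF assms(1)] fl[OF assms(2)]
    by (auto simp: remainder_def K0_bridge_cov bridge_cov_def min_def)
qed

text \<open>The functions of one level have disjoint supports, so at most the cell \<open>k0\<close>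
  of \<open>s\<close> contributes; it lies in the range of summation because \<open>x\<close> is at
  most \<open>2 ^ j\<close>.\<close>

lemma schauder_level_sum:
  assumes "0 \<le> s" "0 \<le> t"
  shows "(\<Sum>k\<le>2 ^ j. schauder j k s * schauder j k t) = (1 / 2) ^ j *
    (of_bool (\<lfloor>2 ^ j * exp (- s)\<rfloor> = \<lfloor>2 ^ j * exp (- t)\<rfloor>) * (tent (2 ^ j * exp (- s)) * tent (2 ^ j * exp (- t))))"
proof -
  define x y where "x = 2 ^ j * exp (- s)" and "y = 2 ^ j * exp (- t)"
  define k0 where "k0 = nat \<lfloor>x\<rfloor>"
  have x0: "0 \<le> x" by (simp add: x_def)
  have k0: "int k0 = \<lfloor>x\<rfloor>" using x0 by (simp add: k0_def)
  have "x \<le> 2 ^ j" using assms by (simp add: x_def)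
  then have "\<lfloor>x\<rfloor> \<le> \<lfloor>2 ^ j :: real\<rfloor>" by (rule floor_mono)
  also have "\<lfloor>2 ^ j :: real\<rfloor> = int (2 ^ j)" using floor_of_nat[of "2 ^ j", where ?'a=real] by simp
  finally have k0_le: "k0 \<le> 2 ^ j" using k0 by linarith
  have h: "(1 / sqrt 2) ^ j * (1 / sqrt 2) ^ j = (1 / 2 :: real) ^ j"
    by (simp add: power_mult_distrib[symmetric])
  have "schauder j k s * schauder j k t =
      (if k = k0 then (1 / 2) ^ j * (of_bool (\<lfloor>x\<rfloor> = \<lfloor>y\<rfloor>) * (tent x * tent y)) else 0)" for k
    unfolding schauder_def x_def[symmetric] y_def[symmetric] h[symmetric] using k0 by auto
  then show ?thesis unfolding x_def[symmetric] y_def[symmetric] using k0_le by simp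
qed

text \<open>Halving every remaining bridge moves one level of Schauder functions from the remainder
  into the sum. The identity is exact and the remainder is nonnegative, so the partial kernels never
  exceed \<open>K0\<close>.\<close>

lemma schauder_kernel_sum:
  assumes "0 \<le> s" "0 \<le> t"
  shows "(\<Sum>m\<in>level_set n. schauder_seq m s * schauder_seq m t) = K0 s t - remainder n s t"
proof -
  have "(\<Sum>j<n. \<Sum>k\<le>2 ^ j. schauder j k s * schauder j k t) = K0 s t - remainder n s t"
  proof (induction n)
    case 0
    then show ?case using remainder_0[OF assms] by simp
  next
    case (Suc n)
    have "remainder n s t = (\<Sum>k\<le>2 ^ n. schauder n k s * schauder n k t) + remainder (Suc n) s t"
      unfolding schauder_level_sum[OF assms] remainder_def bridge_cov_halving[of "2 ^ n * exp (- s)" "2 ^ n * exp (- t)"]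
      by (simp add: distrib_left mult.assoc)
    with Suc show ?case by simp
  qed
  then show ?thesis
    using sum_level_set[of "\<lambda>(j, k). schauder j k s * schauder j k t" n]
    by (simp add: schauder_seq_def case_prod_unfold)
qed

lemma schauder_kernel_conv:
  assumes "0 \<le> s" "0 \<le> t"
  shows "(\<lambda>n. \<Sum>m\<in>level_set n. schauder_seq m s * schauder_seq m t) \<longlonglongrightarrow> K0 s t"
proof -
  have "(\<lambda>n. remainder n s t) \<longlonglongrightarrow> 0"
    by (rule tendsto_sandwich[of "\<lambda>_. 0" _ _ "\<lambda>n. (1 / 2) ^ n"])
       (auto simp: remainder_bounds intro: LIMSEQ_power_zero)
  from tendsto_diff[OF tendsto_const this, of "K0 s t"] show ?thesis
    by (simp add: schauder_kernel_sum[OF assms])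
qed

lemma measurable_tent [measurable]: "tent \<in> borel_measurable borel"
  unfolding tent_def[abs_def] frac_def by measurable

lemma measurable_schauder_seq [measurable]: "schauder_seq m \<in> borel_measurable borel"
proof -
  have "(\<lambda>t. schauder j k t) \<in> borel_measurable borel" for j k
    unfolding schauder_def by measurable
  then show ?thesis by (simp add: schauder_seq_def split: prod.split)
qed

lemma schauder_seq_nonneg: "0 \<le> schauder_seq m t"
  by (auto simp: schauder_seq_def schauder_def tent_bounds split: prod.split)

lemma K0_diag_le: "0 \<le> t \<Longrightarrow> K0 t t \<le> exp (- t)"
  by (simp add: K0_def)

text \<open>A maximum is at least the mean. The bound factorises in \<open>s\<close> and
  \<open>t\<close>, which turns majorants of double integrals into products of one-dimensional
  integrals.\<close>

lemma K0_le: "K0 s t \<le> exp (- s / 2) * exp (- t / 2)"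
proof -
  have "- max s t \<le> - s / 2 + - t / 2" by (auto simp: max_def)
  then have "exp (- max s t) \<le> exp (- s / 2 + - t / 2)" by (simp only: exp_le_cancel_iff)
  also have "\<dots> = exp (- s / 2) * exp (- t / 2)" by (rule exp_add)
  finally have "exp (- max s t) \<le> exp (- s / 2) * exp (- t / 2)" .
  moreover have "0 \<le> exp (- (s + t))" by simp
  ultimately show ?thesis unfolding K0_def by linarith
qed

text \<open>With \<open>d = exp (- x) - exp (- y)\<close> the variance of a bridge increment is
  \<open>d - d^2\<close>, hence at most \<open>d\<close>, and \<open>exp (- t)\<close> is
  1-Lipschitz on the half-line.\<close>

lemma K0_increment_le:
  assumes "0 \<le> s" "0 \<le> t"
  shows "K0 s s - 2 * K0 s t + K0 t t \<le> \<bar>s - t\<bar>"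
proof -
  have main: "K0 x x - 2 * K0 x y + K0 y y \<le> y - x" if "0 \<le> x" "x \<le> y" for x y
  proof -
    have "K0 x x - 2 * K0 x y + K0 y y = (exp (- x) - exp (- y)) - (exp (- x) - exp (- y))\<^sup>2"
      using that by (simp add: K0_eq power2_eq_square algebra_simps)
    also have "\<dots> \<le> exp (- x) - exp (- y)" by simp
    also have "\<dots> \<le> \<bar>x - y\<bar>" using exp_diff_le[of x y 1] that by simp
    finally show ?thesis using that by simp
  qed
  have sym: "K0 s t = K0 t s" by (simp add: K0_def max.commute add.commute)
  show ?thesis
  proof (cases "s \<le> t")
    case True then show ?thesis using main[of s t] assms by simp
  next
    case False then show ?thesis using main[of t s] assms sym by simp
  qed
qed

text \<open>The sums increase with \<open>n\<close> and their limit is the variance of an increment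
  under \<open>K0\<close>, so each of them inherits the bound for the limit.\<close>

lemma schauder_sq_sum_le:
  assumes "0 \<le> s" "0 \<le> t"
  shows "(\<Sum>m\<in>level_set n. (schauder_seq m s - schauder_seq m t)\<^sup>2) \<le> \<bar>s - t\<bar>"
proof -
  let ?S = "\<lambda>n. \<Sum>m\<in>level_set n. (schauder_seq m s - schauder_seq m t)\<^sup>2"
  have eq: "?S = (\<lambda>n. (\<Sum>m\<in>level_set n. schauder_seq m s * schauder_seq m s) -
      2 * (\<Sum>m\<in>level_set n. schauder_seq m s * schauder_seq m t) + (\<Sum>m\<in>level_set n. schauder_seq m t * schauder_seq m t))"
    by (simp add: power2_eq_square algebra_simps sum.distrib sum_subtractf sum_distrib_left)
  have "?S \<longlonglongrightarrow> K0 s s - 2 * K0 s t + K0 t t"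
    unfolding eq by (intro tendsto_intros schauder_kernel_conv assms)
  moreover have "incseq ?S"
    by (intro monoI sum_mono2 level_set_mono) auto
  ultimately have "?S n \<le> K0 s s - 2 * K0 s t + K0 t t" by (rule incseq_le[rotated])
  also note K0_increment_le[OF assms]
  finally show ?thesis .
qed

lemma measurable_levy_sum_pair: "(\<lambda>(z, t). levy_sum n z t) \<in> borel_measurable (gauss \<Otimes>\<^sub>M borel)"
  unfolding levy_sum_def by measurable

lemma measurable_levy_sum [measurable]: "levy_sum n z \<in> borel_measurable borel"
  unfolding levy_sum_def[abs_def] by measurable

lemma bridge_bounds_levy_sum: "bridge_bounds gauss (levy_sum n)"
  unfolding bridge_bounds_def
proof (intro conjI allI impI)
  show "(\<lambda>(z, t). levy_sum n z t) \<in> borel_measurable (gauss \<Otimes>\<^sub>M borel)"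
    by (rule measurable_levy_sum_pair)
  fix t :: real assume t: "0 \<le> t"
  have "(\<integral>\<^sup>+z. ennreal ((levy_sum n z t)\<^sup>2) \<partial>gauss) = ennreal (\<Sum>m\<in>level_set n. (schauder_seq m t)\<^sup>2)"
    unfolding levy_sum_def using gauss_second_moment[of "level_set n" "\<lambda>m. schauder_seq m t"] by (simp add: mult.commute)
  also have "\<dots> \<le> ennreal (exp (- t))"
    using schauder_kernel_sum[OF t t, of n] remainder_bounds(1)[of n t t] K0_diag_le[OF t]
    by (intro ennreal_leI) (simp add: power2_eq_square)
  finally show "(\<integral>\<^sup>+z. ennreal ((levy_sum n z t)\<^sup>2) \<partial>gauss) \<le> ennreal (exp (- t))" .
  fix s :: real assume s: "0 \<le> s"
  have "(\<integral>\<^sup>+z. ennreal ((levy_sum n z s - levy_sum n z t)\<^sup>2) \<partial>gauss) = (\<integral>\<^sup>+z. ennreal ((\<Sum>m\<in>level_set n. (schauder_seq m s - schauder_seq m t) * z m)\<^sup>2) \<partial>gauss)"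
    by (simp add: levy_sum_def sum_subtractf[symmetric] right_diff_distrib[symmetric] mult.commute)
  also have "\<dots> = ennreal (\<Sum>m\<in>level_set n. (schauder_seq m s - schauder_seq m t)\<^sup>2)"
    by (rule gauss_second_moment) simp
  also have "\<dots> \<le> ennreal \<bar>s - t\<bar>"
    by (intro ennreal_leI schauder_sq_sum_le s t)
  finally show "(\<integral>\<^sup>+z. ennreal ((levy_sum n z s - levy_sum n z t)\<^sup>2) \<partial>gauss) \<le> ennreal \<bar>s - t\<bar>" .
qed

text \<open>At every stage the combination is exactly normal, with the partial kernel as covariance,
  and the partial kernels converge pointwise.\<close>

lemma levy_sum_char_conv:
  assumes y: "\<And>i. i < k \<Longrightarrow> 0 \<le> y i"
  shows "(\<lambda>n. \<integral>z. iexp (\<Sum>i<k. c i * levy_sum n z (y i)) \<partial>gauss) \<longlonglongrightarrow> gauss_char K0 k c y"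
proof -
  define q where "q n = (\<Sum>i<k. \<Sum>j<k. c i * c j * (\<Sum>m\<in>level_set n. schauder_seq m (y i) * schauder_seq m (y j)))" for n
  have q: "(\<Sum>m\<in>level_set n. (\<Sum>i<k. c i * schauder_seq m (y i))\<^sup>2) = q n" for n
  proof -
    have "(\<Sum>m\<in>level_set n. (\<Sum>i<k. c i * schauder_seq m (y i))\<^sup>2) =
        (\<Sum>m\<in>level_set n. \<Sum>i<k. \<Sum>j<k. c i * c j * (schauder_seq m (y i) * schauder_seq m (y j)))"
      by (simp add: power2_eq_square sum_product mult_ac)
    also have "\<dots> = (\<Sum>i<k. \<Sum>j<k. \<Sum>m\<in>level_set n. c i * c j * (schauder_seq m (y i) * schauder_seq m (y j)))"
      by (subst sum.swap) (intro sum.cong refl sum.swap)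
    finally show ?thesis by (simp add: q_def sum_distrib_left)
  qed
  have "(\<integral>z. iexp (\<Sum>i<k. c i * levy_sum n z (y i)) \<partial>gauss) = exp (- q n / 2)" for n
  proof -
    have "(\<Sum>i<k. c i * levy_sum n z (y i)) = (\<Sum>m\<in>level_set n. (\<Sum>i<k. c i * schauder_seq m (y i)) * z m)" for z
      unfolding levy_sum_def sum_distrib_left sum_distrib_right by (subst sum.swap) (simp add: mult_ac)
    then show ?thesis
      using char_gauss[of "level_set n" "\<lambda>m. \<Sum>i<k. c i * schauder_seq m (y i)"] by (simp only: q finite_level_set simp_thms)
  qed
  moreover have "(\<lambda>n. complex_of_real (exp (- q n / 2))) \<longlonglongrightarrow> complex_of_real (exp (- (\<Sum>i<k. \<Sum>j<k. c i * c j * K0 (y i) (y j)) / 2))"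
    unfolding q_def by (intro tendsto_intros schauder_kernel_conv y) auto
  ultimately show ?thesis by (simp add: gauss_char_def)
qed

section \<open>The limiting Gaussian element\<close>

lemma sum_geometric_le:
  fixes c :: real
  assumes "0 < c" "c < 1" "n \<le> p"
  shows "(\<Sum>j\<in>{n..<p}. c ^ j) \<le> c ^ n / (1 - c)"
proof -
  have g: "(\<Sum>j<k. c ^ j) * (1 - c) = 1 - c ^ k" for k
    using assms by (simp add: sum_gp_strict)
  have "(\<Sum>j\<in>{n..<p}. c ^ j) = (\<Sum>j<p. c ^ j) - (\<Sum>j<n. c ^ j)"
    using assms sum_diff_nat_ivl[of 0 n p "\<lambda>j. c ^ j"] by (simp add: atLeast0LessThan)
  also have "\<dots> * (1 - c) = c ^ n - c ^ p"
    unfolding left_diff_distrib g by simp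
  finally have "(\<Sum>j\<in>{n..<p}. c ^ j) = (c ^ n - c ^ p) / (1 - c)"
    using assms by (simp add: field_simps)
  also have "\<dots> \<le> c ^ n / (1 - c)"
    using assms by (intro divide_right_mono) auto
  finally show ?thesis .
qed

text \<open>Cauchy-Schwarz against geometric weights: \<open>81 / 64\<close> is the square of
  \<open>9 / 8\<close>, the increments are paired with \<open>(8 / 9) ^ j\<close>, and
  \<open>81 / 17\<close> is \<open>1 / (1 - 64 / 81)\<close>.\<close>

lemma weighted_increments_convergent:
  fixes x :: "nat \<Rightarrow> real"
  assumes e: "(\<Sum>j. ennreal ((81 / 64) ^ j * (x (Suc j) - x j)\<^sup>2)) = ennreal E" and E: "0 \<le> E"
  shows "convergent x" and "(lim x - x n)\<^sup>2 \<le> (64 / 81) ^ n * (81 / 17) * E"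
proof -
  have part: "(\<Sum>j\<in>{n..<p}. (81 / 64) ^ j * (x (Suc j) - x j)\<^sup>2) \<le> E" for n p
  proof -
    have "ennreal (\<Sum>j\<in>{n..<p}. (81 / 64) ^ j * (x (Suc j) - x j)\<^sup>2) = (\<Sum>j\<in>{n..<p}. ennreal ((81 / 64) ^ j * (x (Suc j) - x j)\<^sup>2))"
      by (rule sum_ennreal[symmetric]) simp
    also have "\<dots> \<le> ennreal E"
      unfolding e[symmetric] by (rule sum_le_suminf) auto
    finally show ?thesis using E by simp
  qed
  have bd: "(x p - x n)\<^sup>2 \<le> (64 / 81) ^ n * (81 / 17) * E" if "n \<le> p" for n p
  proof -
    have "x p - x n = (\<Sum>j\<in>{n..<p}. (8 / 9) ^ j * ((9 / 8) ^ j * (x (Suc j) - x j)))"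
      using sum_Suc_diff'[OF that, of x] by (simp add: mult.assoc[symmetric] power_mult_distrib[symmetric])
    then have "(x p - x n)\<^sup>2 \<le> (\<Sum>j\<in>{n..<p}. ((8 / 9) ^ j)\<^sup>2) * (\<Sum>j\<in>{n..<p}. ((9 / 8) ^ j * (x (Suc j) - x j))\<^sup>2)"
      by (simp only: Cauchy_Schwarz_ineq_sum)
    also have "\<dots> = (\<Sum>j\<in>{n..<p}. (64 / 81) ^ j) * (\<Sum>j\<in>{n..<p}. (81 / 64) ^ j * (x (Suc j) - x j)\<^sup>2)"
    proof -
      have "((8 / 9 :: real) ^ j)\<^sup>2 = (64 / 81) ^ j" "((9 / 8 :: real) ^ j)\<^sup>2 = (81 / 64) ^ j" for j
        by (simp_all add: power2_eq_square power_mult_distrib[symmetric])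
      then show ?thesis by (simp add: power_mult_distrib)
    qed
    also have "\<dots> \<le> ((64 / 81) ^ n / (1 - 64 / 81)) * E"
      by (intro mult_mono sum_geometric_le part that) (auto intro!: sum_nonneg)
    finally show ?thesis by (simp add: mult_ac)
  qed
  have to0: "(\<lambda>n. (64 / 81) ^ n * (81 / 17) * E) \<longlonglongrightarrow> 0"
    by (intro tendsto_mult_left_zero LIMSEQ_power_zero) auto
  have "Cauchy x"
  proof (rule metric_CauchyI)
    fix d :: real assume d: "0 < d"
    obtain N where N: "\<And>n. n \<ge> N \<Longrightarrow> (64 / 81) ^ n * (81 / 17) * E < (d / 2)\<^sup>2"
      using LIMSEQ_D[OF to0, of "(d / 2)\<^sup>2"] d E by (auto simp: abs_mult)
    have near: "\<bar>x p - x N\<bar> < d / 2" if "p \<ge> N" for p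
    proof -
      have "\<bar>x p - x N\<bar>\<^sup>2 < (d / 2)\<^sup>2" using bd[OF that] N[of N] by simp
      from power2_less_imp_less[OF this] d show ?thesis by simp
    qed
    have "dist (x p) (x n) < d" if "p \<ge> N" "n \<ge> N" for p n
      using near[OF that(1)] near[OF that(2)] unfolding dist_real_def by linarith
    then show "\<exists>M. \<forall>m\<ge>M. \<forall>n\<ge>M. dist (x m) (x n) < d" by blast
  qed
  then show "convergent x" by (rule Cauchy_convergent)
  then have "x \<longlonglongrightarrow> lim x" by (simp add: convergent_LIMSEQ_iff)
  then have "(\<lambda>p. (x p - x n)\<^sup>2) \<longlonglongrightarrow> (lim x - x n)\<^sup>2"
    by (intro tendsto_intros)
  then show "(lim x - x n)\<^sup>2 \<le> (64 / 81) ^ n * (81 / 17) * E"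
    by (rule LIMSEQ_le_const2) (use bd in auto)
qed

text \<open>The moment equals \<open>(1 / 2) ^ j\<close> times the square of \<open>tent x\<close>.
  A bound by \<open>(1 / 2) ^ j\<close> alone is not integrable in \<open>t\<close> when
  \<open>a = 0\<close>, so part of the decay in \<open>j\<close> is traded for decay in
  \<open>t\<close>: the fourth power of \<open>tent x\<close> is at most \<open>tent x\<close>,
  hence at most \<open>x = 2 ^ j * exp (- t)\<close>. The rational ratio \<open>3 / 4\<close>
  replaces \<open>1 / sqrt 2\<close>.\<close>

lemma levy_sum_increment_second_moment:
  assumes t: "0 \<le> t"
  shows "(\<integral>\<^sup>+z. ennreal ((levy_sum (Suc j) z t - levy_sum j z t)\<^sup>2) \<partial>gauss) \<le> ennreal ((3 / 4) ^ j * exp (- t / 2))"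
proof -
  define x where "x = 2 ^ j * exp (- t)"
  have sub: "level_set j \<subseteq> level_set (Suc j)" by (rule level_set_mono) simp
  have "levy_sum (Suc j) z t - levy_sum j z t = (\<Sum>m\<in>level_set (Suc j) - level_set j. schauder_seq m t * z m)" for z
    unfolding levy_sum_def using sum_diff[OF finite_level_set sub, of "\<lambda>m. z m * schauder_seq m t"] by (simp add: mult.commute)
  then have "(\<integral>\<^sup>+z. ennreal ((levy_sum (Suc j) z t - levy_sum j z t)\<^sup>2) \<partial>gauss) =
      ennreal (\<Sum>m\<in>level_set (Suc j) - level_set j. (schauder_seq m t)\<^sup>2)"
    by (simp add: gauss_second_moment)
  also have "(\<Sum>m\<in>level_set (Suc j) - level_set j. (schauder_seq m t)\<^sup>2) = remainder j t t - remainder (Suc j) t t"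
    using sum_diff[OF finite_level_set sub, of "\<lambda>m. schauder_seq m t * schauder_seq m t"]
    by (simp add: schauder_kernel_sum[OF t t] power2_eq_square)
  also have "\<dots> = (1 / 2) ^ j * (tent x)\<^sup>2"
    using bridge_cov_halving[of x x] by (simp add: remainder_def x_def power2_eq_square algebra_simps)
  also have "\<dots> \<le> (3 / 4) ^ j * exp (- t / 2)"
  proof (rule power2_le_imp_le)
    have x0: "0 \<le> x" by (simp add: x_def)
    have "tent x \<le> frac x" by (simp add: tent_def)
    also have "frac x \<le> x" using x0 by (simp add: frac_def)
    finally have "tent x \<le> x" .
    have "(tent x)\<^sup>2 * (tent x)\<^sup>2 \<le> 1 * tent x"
      using tent_bounds[of x] by (intro mult_mono) (auto simp: power2_eq_square intro: mult_le_one mult_left_le)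
    with \<open>tent x \<le> x\<close> have t4: "((tent x)\<^sup>2)\<^sup>2 \<le> x" by (simp add: power2_eq_square)
    have "((1 / 2) ^ j * (tent x)\<^sup>2)\<^sup>2 = (1 / 4) ^ j * ((tent x)\<^sup>2)\<^sup>2"
      by (simp add: power_mult_distrib power2_eq_square[of "(1 / 2) ^ j"] power_mult_distrib[symmetric])
    also have "\<dots> \<le> (1 / 4) ^ j * x" using t4 by (intro mult_left_mono) auto
    also have "\<dots> = (1 / 2) ^ j * exp (- t)"
      by (simp add: x_def mult.assoc[symmetric] power_mult_distrib[symmetric])
    also have "\<dots> \<le> (9 / 16) ^ j * exp (- t)"
      by (intro mult_right_mono power_mono) auto
    also have "\<dots> = ((3 / 4) ^ j * exp (- t / 2))\<^sup>2"
      by (simp add: power2_eq_square power_mult_distrib[symmetric] exp_add[symmetric] mult_ac)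
    finally show "((1 / 2) ^ j * (tent x)\<^sup>2)\<^sup>2 \<le> ((3 / 4) ^ j * exp (- t / 2))\<^sup>2" .
  qed simp
  finally show ?thesis by (simp add: ennreal_leI)
qed

text \<open>The second moments of the increments decay like \<open>(3 / 4)\<^sup>j\<close>; any weight ratio between \<open>1\<close> and \<open>4 / 3\<close> makes this
  energy integrable and still forces convergence.  The ratio \<open>81 / 64\<close> has a rational square root.\<close>

definition increment_energy :: "(nat \<Rightarrow> real) \<Rightarrow> real \<Rightarrow> ennreal" where
  "increment_energy z t = (\<Sum>j. ennreal ((81 / 64) ^ j * (levy_sum (Suc j) z t - levy_sum j z t)\<^sup>2))"

definition energy :: "real \<Rightarrow> (nat \<Rightarrow> real) \<Rightarrow> ennreal" where
  "energy a z = (\<integral>\<^sup>+t. increment_energy z t \<partial>mu a)"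

text \<open>The value 0 on the null set of infinite energy puts every path into \<open>Ha a\<close>,
  as measurability into \<open>Ha_borel a\<close> demands. On the other paths the sequence may
  diverge only for a null set of times, where \<open>lim\<close> takes some arbitrary value.\<close>

definition bridge_limit :: "real \<Rightarrow> (nat \<Rightarrow> real) \<Rightarrow> real \<Rightarrow> real" where
  "bridge_limit a z t = (if energy a z < \<infinity> then lim (\<lambda>n. levy_sum n z t) else 0)"

lemma measurable_increment_energy_pair:
  "(\<lambda>(z, t). increment_energy z t) \<in> borel_measurable (gauss \<Otimes>\<^sub>M mu a)"
proof -
  have [measurable]: "(\<lambda>(z, t). levy_sum n z t) \<in> borel_measurable (gauss \<Otimes>\<^sub>M mu a)" for n
    using bridge_bounds_measurable_pair[OF bridge_bounds_levy_sum] .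
  show ?thesis unfolding increment_energy_def by measurable
qed

lemma measurable_energy [measurable]: "energy a \<in> borel_measurable gauss"
proof -
  interpret mu: sigma_finite_measure "mu a" by (rule sigma_finite_mu)
  note [measurable] = measurable_increment_energy_pair[of a]
  show ?thesis unfolding energy_def[abs_def] by measurable
qed

lemma energy_finite_AE:
  assumes a: "0 \<le> a"
  shows "AE z in gauss. energy a z < \<infinity>"
proof -
  let ?d = "\<lambda>j z t. (levy_sum (Suc j) z t - levy_sum j z t)\<^sup>2"
  interpret G: prob_space gauss by (rule prob_space_gauss)
  interpret mu: sigma_finite_measure "mu a" by (rule sigma_finite_mu)
  interpret pair_sigma_finite gauss "mu a" ..
  note [measurable] = measurable_increment_energy_pair[of a]
  have [measurable]: "(\<lambda>z. levy_sum n z t) \<in> borel_measurable gauss" for n t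
    by (rule bridge_bounds_measurable[OF bridge_bounds_levy_sum])
  have "(\<integral>\<^sup>+z. energy a z \<partial>gauss) = (\<integral>\<^sup>+t. (\<integral>\<^sup>+z. increment_energy z t \<partial>gauss) \<partial>mu a)"
    unfolding energy_def by (intro Fubini'[symmetric]) measurable
  \<comment> \<open>The weighted second moments have the ratio
    \<open>81 / 64 * 3 / 4 = 243 / 256\<close>, and \<open>256 / 13\<close> is the sum of this
    geometric series.\<close>
  also have "\<dots> \<le> (\<integral>\<^sup>+t. ennreal (256 / 13) * ennreal (exp (- (1 / 2) * t)) \<partial>mu a)"
  proof (rule nn_integral_mono)
    fix t assume "t \<in> space (mu a)"
    then have t: "0 \<le> t" by simp
    have "(\<integral>\<^sup>+z. increment_energy z t \<partial>gauss) =
        (\<Sum>j. \<integral>\<^sup>+z. ennreal ((81 / 64) ^ j) * ennreal (?d j z t) \<partial>gauss)"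
      unfolding increment_energy_def by (subst nn_integral_suminf) (auto simp: ennreal_mult)
    also have "\<dots> = (\<Sum>j. ennreal ((81 / 64) ^ j) * (\<integral>\<^sup>+z. ennreal (?d j z t) \<partial>gauss))"
      by (simp add: nn_integral_cmult)
    also have "\<dots> \<le> (\<Sum>j. ennreal ((243 / 256) ^ j * exp (- t / 2)))"
    proof (intro suminf_le)
      fix j
      have "ennreal ((81 / 64) ^ j) * (\<integral>\<^sup>+z. ennreal (?d j z t) \<partial>gauss) \<le>
          ennreal ((81 / 64) ^ j) * ennreal ((3 / 4) ^ j * exp (- t / 2))"
        by (intro mult_left_mono levy_sum_increment_second_moment t) simp
      also have "\<dots> = ennreal ((243 / 256) ^ j * exp (- t / 2))"
        by (subst ennreal_mult[symmetric]) (auto simp: mult.assoc[symmetric] power_mult_distrib[symmetric])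
      finally show "ennreal ((81 / 64) ^ j) * (\<integral>\<^sup>+z. ennreal (?d j z t) \<partial>gauss) \<le> ennreal ((243 / 256) ^ j * exp (- t / 2))" .
    qed auto
    also have "\<dots> = ennreal (\<Sum>j. (243 / 256) ^ j * exp (- t / 2))"
      by (intro suminf_ennreal2 summable_mult2) auto
    also have "(\<Sum>j. (243 / 256) ^ j * exp (- t / 2)) = 256 / 13 * exp (- t / 2)"
      by (subst suminf_mult2[symmetric]) (auto simp: suminf_geometric)
    finally show "(\<integral>\<^sup>+z. increment_energy z t \<partial>gauss) \<le> ennreal (256 / 13) * ennreal (exp (- (1 / 2) * t))"
      by (subst ennreal_mult[symmetric]) auto
  qed
  also have "\<dots> = ennreal (256 / 13) * (\<integral>\<^sup>+t. ennreal (exp (- (1 / 2) * t)) \<partial>mu a)"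
    by (intro nn_integral_cmult) (auto intro!: borel_measurable_muI)
  also have "\<dots> \<le> ennreal (256 / 13) * ennreal (1 / (1 / 2))"
    using a by (intro mult_left_mono nn_integral_mu_exp) auto
  also have "\<dots> < \<infinity>" by (simp add: ennreal_mult_less_top)
  finally have "(\<integral>\<^sup>+z. energy a z \<partial>gauss) < \<infinity>" .
  then have "AE z in gauss. energy a z \<noteq> \<infinity>"
    by (intro nn_integral_noteq_infinite) auto
  then show ?thesis by eventually_elim (simp add: less_top)
qed

lemma bridge_limit_dist:
  assumes fin: "energy a z < \<infinity>"
  shows "(\<integral>\<^sup>+t. ennreal ((bridge_limit a z t - levy_sum n z t)\<^sup>2) \<partial>mu a) \<le> ennreal ((64 / 81) ^ n * (81 / 17)) * energy a z"
proof -
  have [measurable]: "increment_energy z \<in> borel_measurable (mu a)"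
    unfolding increment_energy_def[abs_def] by (intro borel_measurable_muI) measurable
  have "AE t in mu a. increment_energy z t \<noteq> \<infinity>"
    using fin by (intro nn_integral_noteq_infinite) (auto simp: energy_def)
  then have "AE t in mu a. ennreal ((bridge_limit a z t - levy_sum n z t)\<^sup>2) \<le> ennreal ((64 / 81) ^ n * (81 / 17)) * increment_energy z t"
  proof eventually_elim
    case (elim t)
    define E where "E = enn2real (increment_energy z t)"
    have E: "increment_energy z t = ennreal E" "0 \<le> E"
      using elim by (auto simp: E_def less_top)
    have "(lim (\<lambda>n. levy_sum n z t) - levy_sum n z t)\<^sup>2 \<le> (64 / 81) ^ n * (81 / 17) * E"
      using E unfolding increment_energy_def by (rule weighted_increments_convergent(2))
    with fin E show ?case
      unfolding bridge_limit_def E(1) by (subst ennreal_mult[symmetric]) (auto intro!: ennreal_leI)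
  qed
  then have "(\<integral>\<^sup>+t. ennreal ((bridge_limit a z t - levy_sum n z t)\<^sup>2) \<partial>mu a) \<le> (\<integral>\<^sup>+t. ennreal ((64 / 81) ^ n * (81 / 17)) * increment_energy z t \<partial>mu a)"
    by (rule nn_integral_mono_AE)
  also have "\<dots> = ennreal ((64 / 81) ^ n * (81 / 17)) * energy a z"
    unfolding energy_def by (rule nn_integral_cmult) simp
  finally show ?thesis .
qed

lemma measurable_bridge_limit [measurable]: "bridge_limit a z \<in> borel_measurable borel"
proof -
  have "(\<lambda>t. lim (\<lambda>n. levy_sum n z t)) \<in> borel_measurable borel"
    by (rule borel_measurable_lim_metric) measurable
  then show ?thesis unfolding bridge_limit_def[abs_def] by simp
qed

lemma schauder_seq_Ha:
  assumes a: "0 \<le> a" and m: "m \<in> level_set n"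
  shows "schauder_seq m \<in> Ha a"
  unfolding Ha_def
proof (intro CollectI conjI)
  show [measurable]: "schauder_seq m \<in> borel_measurable (mu a)" by (rule borel_measurable_muI) simp
  show "integrable (mu a) (\<lambda>t. (schauder_seq m t)\<^sup>2)"
  proof (rule integrableI_nonneg)
    have le: "(schauder_seq m t)\<^sup>2 \<le> exp (- t)" if t: "0 \<le> t" for t
    proof -
      have "(schauder_seq m t)\<^sup>2 \<le> (\<Sum>m\<in>level_set n. (schauder_seq m t)\<^sup>2)"
        using m by (intro member_le_sum) auto
      also have "\<dots> \<le> exp (- t)"
        using schauder_kernel_sum[OF t t, of n] remainder_bounds(1)[of n t t] K0_diag_le[OF t]
        by (simp add: power2_eq_square)
      finally show ?thesis .
    qed
    have "(\<integral>\<^sup>+t. ennreal ((schauder_seq m t)\<^sup>2) \<partial>mu a) \<le> (\<integral>\<^sup>+t. ennreal (exp (- 1 * t)) \<partial>mu a)"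
      using le by (intro nn_integral_mono ennreal_leI) auto
    also have "\<dots> \<le> ennreal (1 / 1)" using a by (intro nn_integral_mu_exp) auto
    finally show "(\<integral>\<^sup>+t. ennreal ((schauder_seq m t)\<^sup>2) \<partial>mu a) < \<infinity>" by (simp add: le_less_trans)
  qed auto
qed

lemma levy_sum_Ha: "0 \<le> a \<Longrightarrow> levy_sum n z \<in> Ha a"
  unfolding levy_sum_def[abs_def] by (intro Ha_sum Ha_scale schauder_seq_Ha)

lemma bridge_limit_conv:
  assumes a: "0 \<le> a"
  shows "bridge_limit a z \<in> Ha a"
    and "energy a z < \<infinity> \<Longrightarrow> (\<lambda>n. Ha_norm a (\<lambda>t. levy_sum n z t - bridge_limit a z t)) \<longlonglongrightarrow> 0"
proof -
  let ?D = "\<lambda>n. Ha_norm a (\<lambda>t. levy_sum n z t - bridge_limit a z t)"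
  have *: "bridge_limit a z \<in> Ha a \<and> (\<lambda>n. ?D n) \<longlonglongrightarrow> 0"
    if fin: "energy a z < \<infinity>"
  proof
    obtain E where E: "energy a z = ennreal E" "0 \<le> E"
      using fin by (auto simp: less_top_ennreal)
    let ?d = "\<lambda>n t. bridge_limit a z t - levy_sum n z t"
    have [measurable]: "?d n \<in> borel_measurable (mu a)" for n by (rule borel_measurable_muI) measurable
    have le: "(\<integral>\<^sup>+t. ennreal ((?d n t)\<^sup>2) \<partial>mu a) \<le> ennreal ((64 / 81) ^ n * (81 / 17) * E)" for n
    proof -
      have "ennreal ((64 / 81) ^ n * (81 / 17)) * ennreal E = ennreal ((64 / 81) ^ n * (81 / 17) * E)"
        using E by (intro ennreal_mult[symmetric]) auto
      then show ?thesis using bridge_limit_dist[OF fin, of n] E by simp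
    qed
    have int: "integrable (mu a) (\<lambda>t. (?d n t)\<^sup>2)" for n
      by (rule integrableI_nonneg) (use le[of n] in \<open>auto intro: le_less_trans\<close>)
    then have "?d 0 \<in> Ha a" by (simp add: Ha_def)
    from Ha_add[OF this levy_sum_Ha[OF a, of 0 z]] show "bridge_limit a z \<in> Ha a" by simp
    have "(?D n)\<^sup>2 \<le> (64 / 81) ^ n * (81 / 17) * E" for n
    proof -
      have "(?D n)\<^sup>2 = enn2real (\<integral>\<^sup>+t. ennreal ((?d n t)\<^sup>2) \<partial>mu a)"
        unfolding Ha_norm_minus[of a "levy_sum n z"] Ha_norm_sq by (rule integral_eq_nn_integral) auto
      also have "\<dots> \<le> (64 / 81) ^ n * (81 / 17) * E"
        using E by (intro enn2real_leI le) auto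
      finally show ?thesis .
    qed
    note le2 = this
    have lim0: "(\<lambda>n. (64 / 81) ^ n * (81 / 17) * E) \<longlonglongrightarrow> 0"
      by (intro tendsto_mult_left_zero LIMSEQ_power_zero) auto
    have "(\<lambda>n. (?D n)\<^sup>2) \<longlonglongrightarrow> 0"
    proof (rule Lim_null_comparison[OF always_eventually lim0], rule allI)
      show "norm ((?D n)\<^sup>2) \<le> (64 / 81) ^ n * (81 / 17) * E" for n
        unfolding real_norm_def abs_power2 by (rule le2)
    qed
    from tendsto_real_sqrt[OF this]
    show "(\<lambda>n. ?D n) \<longlonglongrightarrow> 0"
      by (simp add: Ha_norm_nonneg)
  qed
  then show "energy a z < \<infinity> \<Longrightarrow> (\<lambda>n. ?D n) \<longlonglongrightarrow> 0" by blast
  show "bridge_limit a z \<in> Ha a"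
  proof (cases "energy a z < \<infinity>")
    case False
    then have "bridge_limit a z = (\<lambda>t. 0)" by (auto simp: bridge_limit_def)
    then show ?thesis by (simp add: Ha_zero)
  qed (use * in blast)
qed

text \<open>The partial sums are replaced by 0 on the same set as the limit, so that convergence in
  norm holds for every \<open>z\<close> and measurability passes to the limit without exceptional
  sets.\<close>

definition cut_path :: "real \<Rightarrow> nat \<Rightarrow> (nat \<Rightarrow> real) \<Rightarrow> real \<Rightarrow> real" where
  "cut_path a n z = (if energy a z < \<infinity> then levy_sum n z else (\<lambda>t. 0))"

lemma cut_path_Ha: "0 \<le> a \<Longrightarrow> cut_path a n z \<in> Ha a"
  by (simp add: cut_path_def levy_sum_Ha Ha_zero)

lemma cut_path_conv:
  assumes a: "0 \<le> a"
  shows "(\<lambda>n. Ha_norm a (\<lambda>t. cut_path a n z t - bridge_limit a z t)) \<longlonglongrightarrow> 0"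
proof (cases "energy a z < \<infinity>")
  case True
  then show ?thesis using bridge_limit_conv(2)[OF a, of z] by (simp add: cut_path_def)
next
  case False
  then show ?thesis by (simp add: cut_path_def bridge_limit_def Ha_norm_zero)
qed

lemma measurable_bridge_limit_Ha:
  assumes a: "0 \<le> a"
  shows "bridge_limit a \<in> measurable gauss (Ha_borel a)"
proof (rule measurable_Ha_borel_limit)
  show "cut_path a n \<in> measurable gauss (Ha_borel a)" for n
    unfolding cut_path_def[abs_def]
  proof (rule measurable_If)
    show "levy_sum n \<in> measurable gauss (Ha_borel a)"
      unfolding levy_sum_def[abs_def] by (rule measurable_Ha_borel_gauss_sum) (rule schauder_seq_Ha[OF a])
    show "(\<lambda>_ t. 0) \<in> measurable gauss (Ha_borel a)"
      by (rule measurable_const) (simp add: Ha_zero)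
    show "{z \<in> space gauss. energy a z < \<infinity>} \<in> sets gauss" by measurable
  qed
qed (use bridge_limit_conv(1)[OF a] cut_path_conv[OF a] in auto)

lemma Ha_inner_path:
  assumes "0 \<le> a" "f \<in> Ha a"
  shows "Ha_inner a (levy_sum n z) f = (\<Sum>m\<in>level_set n. Ha_inner a (schauder_seq m) f * z m)"
  unfolding levy_sum_def[abs_def] using assms
  by (subst Ha_inner_sum) (auto intro!: Ha_scale schauder_seq_Ha simp: Ha_inner_scale mult.commute)

lemma Ha_inner_cut_path:
  assumes "0 \<le> a" "f \<in> Ha a"
  shows "Ha_inner a (cut_path a n z) f = (if energy a z < \<infinity> then \<Sum>m\<in>level_set n. Ha_inner a (schauder_seq m) f * z m else 0)"
  using assms by (simp add: cut_path_def Ha_inner_path) (simp add: Ha_inner_def)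

lemma Ha_inner_bridge_limit_conv:
  assumes a: "0 \<le> a" and f: "f \<in> Ha a"
  shows "(\<lambda>n. Ha_inner a (cut_path a n z) f) \<longlonglongrightarrow> Ha_inner a (bridge_limit a z) f"
  by (intro Ha_inner_tendsto cut_path_Ha bridge_limit_conv cut_path_conv a f)

lemma measurable_Ha_inner_bridge_limit:
  assumes a: "0 \<le> a" and f: "f \<in> Ha a"
  shows "(\<lambda>z. Ha_inner a (bridge_limit a z) f) \<in> borel_measurable gauss"
proof (rule borel_measurable_LIMSEQ_metric)
  show "(\<lambda>z. Ha_inner a (cut_path a n z) f) \<in> borel_measurable gauss" for n
    unfolding Ha_inner_cut_path[OF a f] by measurable
qed (rule Ha_inner_bridge_limit_conv[OF a f])

lemma measurable_Ha_norm_bridge_limit: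
  assumes a: "0 \<le> a"
  shows "(\<lambda>z. Ha_norm a (bridge_limit a z)) \<in> borel_measurable gauss"
proof (rule borel_measurable_LIMSEQ_metric)
  show "(\<lambda>z. Ha_norm a (cut_path a n z)) \<in> borel_measurable gauss" for n
  proof -
    have "Ha_norm a (cut_path a n z) = (if energy a z < \<infinity> then sqrt (\<integral>t. (levy_sum n z t)\<^sup>2 \<partial>mu a) else 0)" for z
      using Ha_norm_sq[of a "levy_sum n z"] by (simp add: cut_path_def Ha_norm_zero Ha_norm_nonneg real_sqrt_unique)
    then show ?thesis
      using measurable_integral_sq[OF bridge_bounds_levy_sum, of a n] by simp
  qed
  show "(\<lambda>n. Ha_norm a (cut_path a n z)) \<longlonglongrightarrow> Ha_norm a (bridge_limit a z)" for z
    by (intro Ha_norm_tendsto cut_path_Ha bridge_limit_conv cut_path_conv a)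
qed

lemma levy_sum_laplace_conv:
  assumes a: "0 \<le> a" and m: "0 \<le> m"
  shows "(\<lambda>n. \<integral>z. exp (- m * (\<integral>t. (levy_sum n z t)\<^sup>2 \<partial>mu a)) \<partial>gauss) \<longlonglongrightarrow>
    (\<integral>z. exp (- m * (Ha_norm a (bridge_limit a z))\<^sup>2) \<partial>gauss)"
proof (rule integral_dominated_convergence[where w="\<lambda>_. 1"])
  let ?I = "\<lambda>n z. \<integral>t. (levy_sum n z t)\<^sup>2 \<partial>mu a"
  interpret G: prob_space gauss by (rule prob_space_gauss)
  show "integrable gauss (\<lambda>_. 1 :: real)" by simp
  show "(\<lambda>z. exp (- m * (Ha_norm a (bridge_limit a z))\<^sup>2)) \<in> borel_measurable gauss"
    using measurable_Ha_norm_bridge_limit[OF a] by measurable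
  show "(\<lambda>z. exp (- m * (?I n z))) \<in> borel_measurable gauss" for n
    using measurable_integral_sq[OF bridge_bounds_levy_sum, of a n] by measurable
  show "AE z in gauss. (\<lambda>n. exp (- m * (?I n z))) \<longlonglongrightarrow> exp (- m * (Ha_norm a (bridge_limit a z))\<^sup>2)"
    using energy_finite_AE[OF a]
  proof eventually_elim
    case (elim z)
    show ?case unfolding Ha_norm_sq[symmetric]
      by (intro tendsto_intros Ha_norm_tendsto levy_sum_Ha bridge_limit_conv a elim)
  qed
  show "AE z in gauss. norm (exp (- m * (?I n z))) \<le> 1" for n
    using m by simp
qed

section \<open>The covariance form and the law of the limit\<close>

definition K0_form :: "real \<Rightarrow> (real \<Rightarrow> real) \<Rightarrow> (real \<Rightarrow> real) \<Rightarrow> real" where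
  "K0_form a f g = (LINT t:{0..}|lborel. (LINT s:{0..}|lborel. K0 s t * f s * g t * exp (- a * (s + t))))"

lemma exp_half_Ha: "0 \<le> a \<Longrightarrow> (\<lambda>t. exp (- t / 2)) \<in> Ha a"
  unfolding Ha_def
proof (intro CollectI conjI)
  assume a: "0 \<le> a"
  show [measurable]: "(\<lambda>t. exp (- t / 2)) \<in> borel_measurable (mu a)" by (rule borel_measurable_muI) simp
  have "(exp (- t / 2))\<^sup>2 = exp (- 1 * t)" for t :: real
    by (simp add: power2_eq_square exp_add[symmetric])
  then have "(\<integral>\<^sup>+t. ennreal ((exp (- t / 2))\<^sup>2) \<partial>mu a) \<le> ennreal (1 / 1)"
    using nn_integral_mu_exp[OF a, of 1] by simp
  then show "integrable (mu a) (\<lambda>t. (exp (- t / 2))\<^sup>2)"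
    by (intro integrableI_nonneg) (auto intro: le_less_trans)
qed

lemma measurable_K0 [measurable]: "(\<lambda>(s, t). K0 s t) \<in> borel_measurable (borel \<Otimes>\<^sub>M borel)"
  unfolding K0_def by measurable

lemma measurable_mu_pair:
  assumes "(\<lambda>(s, t). F s t :: real) \<in> borel_measurable (borel \<Otimes>\<^sub>M borel)"
  shows "(\<lambda>(s, t). F s t) \<in> borel_measurable (mu a \<Otimes>\<^sub>M mu a)"
proof -
  have "(\<lambda>p. (fst p, snd p)) \<in> measurable (mu a \<Otimes>\<^sub>M mu a) (borel \<Otimes>\<^sub>M borel)"
    by (intro measurable_Pair measurable_compose[OF measurable_fst measurable_mu_ident] measurable_compose[OF measurable_snd measurable_mu_ident])
  from measurable_compose[OF this assms] show ?thesis by simp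
qed

lemma product_integrable:
  assumes "sigma_finite_measure M1" "sigma_finite_measure M2"
    and f: "integrable M1 f" and g: "integrable M2 (g :: _ \<Rightarrow> real)"
  shows "integrable (M1 \<Otimes>\<^sub>M M2) (\<lambda>(s, t). f s * g t :: real)"
proof -
  interpret M1: sigma_finite_measure M1 by fact
  interpret M2: sigma_finite_measure M2 by fact
  interpret pair_sigma_finite M1 M2 ..
  note [measurable] = borel_measurable_integrable[OF f] borel_measurable_integrable[OF g]
  show ?thesis
  proof (rule Fubini_integrable)
    show "(\<lambda>(s, t). f s * g t) \<in> borel_measurable (M1 \<Otimes>\<^sub>M M2)" by measurable
    show "integrable M1 (\<lambda>s. \<integral>t. norm (case (s, t) of (s, t) \<Rightarrow> f s * g t) \<partial>M2)"
      using f g by (simp add: abs_mult)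
    show "AE s in M1. integrable M2 (\<lambda>t. case (s, t) of (s, t) \<Rightarrow> f s * g t)"
      using g by simp
  qed
qed

lemma K0_nonneg: "0 \<le> s \<Longrightarrow> 0 \<le> t \<Longrightarrow> 0 \<le> K0 s t"
  by (simp add: K0_def)

text \<open>The factorised bound \<open>K0_le\<close> leaves a product of two functions of the form
  \<open>exp (- t / 2) * \<bar>h t\<bar>\<close>. Each is integrable as a product of two elements of
  \<open>Ha a\<close>.\<close>

lemma K0_form_integrable:
  assumes a: "0 \<le> a" and f: "f \<in> Ha a" and g: "g \<in> Ha a"
  shows "set_integrable (lborel \<Otimes>\<^sub>M lborel) ({0..} \<times> {0..}) (\<lambda>(s, t). K0 s t * f s * g t * exp (- a * (s + t)))"
proof -
  let ?w = "\<lambda>h t. indicator {0..} t * (exp (- t / 2) * \<bar>h t\<bar> * exp (- a * t))"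
  \<comment> \<open>Elements of \<open>Ha a\<close> are measurable on the half-line only; their
    products with the indicator are Borel on the whole line.\<close>
  let ?f = "\<lambda>t. indicator {0..} t * f t" and ?g = "\<lambda>t. indicator {0..} t * g t"
  have [measurable]: "?f \<in> borel_measurable borel" "?g \<in> borel_measurable borel"
    using Ha_measurable[OF f] Ha_measurable[OF g] by (simp_all add: borel_measurable_mu_iff)
  have exp_int: "integrable lborel (\<lambda>t. indicator {0..} t * (exp (- t / 2) * \<bar>h t\<bar> * exp (- a * t)))" if h: "h \<in> Ha a" for h
  proof -
    have hm: "(\<lambda>t. exp (- t / 2) * \<bar>h t\<bar>) \<in> borel_measurable (mu a)"
      using Ha_measurable[OF h] Ha_measurable[OF exp_half_Ha[OF a]] by measurable
    have "integrable (mu a) (\<lambda>t. \<bar>exp (- t / 2) * h t\<bar>)"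
      using Ha_mult_integrable[OF exp_half_Ha[OF a] h] by (rule integrable_abs)
    then have "integrable (mu a) (\<lambda>t. exp (- t / 2) * \<bar>h t\<bar>)" by (simp add: abs_mult)
    then show ?thesis
      unfolding integrable_mu_iff[OF hm] by (simp add: set_integrable_def)
  qed
  have eq: "(\<lambda>x. indicator ({0..} \<times> {0..}) x *\<^sub>R (case x of (s, t) \<Rightarrow> K0 s t * f s * g t * exp (- a * (s + t)))) =
      (\<lambda>(s, t). K0 s t * ?f s * ?g t * exp (- a * (s + t)))"
    by (auto simp: fun_eq_iff indicator_def)
  show ?thesis
    unfolding set_integrable_def eq
  proof (rule Bochner_Integration.integrable_bound)
    show "integrable (lborel \<Otimes>\<^sub>M lborel) (\<lambda>(s, t).
        ?w f s * ?w g t)"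
      by (intro product_integrable sigma_finite_lborel exp_int f g)
    have "(\<lambda>(s, t). K0 s t * ?f s * ?g t * exp (- a * (s + t))) \<in> borel_measurable (borel \<Otimes>\<^sub>M borel)"
      by measurable
    then show "(\<lambda>(s, t). K0 s t * ?f s * ?g t * exp (- a * (s + t))) \<in> borel_measurable (lborel \<Otimes>\<^sub>M lborel)"
      by (simp cong: measurable_cong_sets)
    have "\<bar>K0 s t * ?f s * ?g t * exp (- a * (s + t))\<bar> \<le>
      ?w f s * ?w g t" for s t
    proof (cases "0 \<le> s \<and> 0 \<le> t")
      case True
      have "\<bar>K0 s t * ?f s * ?g t * exp (- a * (s + t))\<bar> = K0 s t * (\<bar>f s\<bar> * \<bar>g t\<bar> * exp (- a * (s + t)))"
        using True K0_nonneg[of s t] by (simp add: abs_mult)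
      also have "\<dots> \<le> (exp (- s / 2) * exp (- t / 2)) * (\<bar>f s\<bar> * \<bar>g t\<bar> * exp (- a * (s + t)))"
        by (intro mult_right_mono K0_le) auto
      finally have le: "\<bar>K0 s t * ?f s * ?g t * exp (- a * (s + t))\<bar> \<le>
        (exp (- s / 2) * exp (- t / 2)) * (\<bar>f s\<bar> * \<bar>g t\<bar> * exp (- a * (s + t)))" .
      have ex: "exp (- a * (s + t)) = exp (- a * s) * exp (- a * t)"
        by (simp add: exp_add[symmetric] algebra_simps)
      show ?thesis using True le unfolding ex by (simp add: abs_mult mult_ac)
    qed (auto simp: indicator_def)
    then show "AE x in lborel \<Otimes>\<^sub>M lborel. norm (case x of (s, t) \<Rightarrow> K0 s t * ?f s * ?g t * exp (- a * (s + t))) \<le>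
      norm (case x of (s, t) \<Rightarrow> ?w f s * ?w g t)"
      by (intro AE_I2) (auto split: prod.split intro: order_trans[OF _ abs_ge_self] simp del: abs_mult)
  qed
qed

text \<open>Dominated convergence on the product space: the Schauder functions and the remainder are
  nonnegative, so the partial kernels lie between 0 and \<open>K0\<close>, and one majorant serves
  all \<open>n\<close>.\<close>

lemma K0_form_conv:
  assumes a: "0 \<le> a" and f: "f \<in> Ha a" and g: "g \<in> Ha a"
  shows "(\<lambda>n. \<Sum>m\<in>level_set n. Ha_inner a (schauder_seq m) f * Ha_inner a (schauder_seq m) g) \<longlonglongrightarrow> K0_form a f g"
proof -
  let ?S = "\<lambda>n s t. \<Sum>m\<in>level_set n. schauder_seq m s * schauder_seq m t"
    and ?w = "\<lambda>s t. \<bar>exp (- s / 2) * f s\<bar> * \<bar>exp (- t / 2) * g t\<bar>"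
  interpret mu: sigma_finite_measure "mu a" by (rule sigma_finite_mu)
  interpret pair_sigma_finite "mu a" "mu a" ..
  note [measurable] = Ha_measurable[OF f] Ha_measurable[OF g]
  have [measurable]: "(\<lambda>(s, t). K0 s t) \<in> borel_measurable (mu a \<Otimes>\<^sub>M mu a)"
    by (rule measurable_mu_pair) measurable
  have [measurable]: "schauder_seq m \<in> borel_measurable (mu a)" for m
    by (rule borel_measurable_muI) measurable
  have dom: "integrable (mu a \<Otimes>\<^sub>M mu a) (\<lambda>(s, t). ?w s t)"
    by (intro product_integrable sigma_finite_mu integrable_abs Ha_mult_integrable exp_half_Ha a f g)
  have KF: "\<bar>c * f s * g t\<bar> \<le> ?w s t" if "0 \<le> c" "c \<le> K0 s t" for c s t
  proof -
    have "\<bar>c * f s * g t\<bar> = c * (\<bar>f s\<bar> * \<bar>g t\<bar>)" using that by (simp add: abs_mult)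
    also have "\<dots> \<le> (exp (- s / 2) * exp (- t / 2)) * (\<bar>f s\<bar> * \<bar>g t\<bar>)"
      using that K0_le[of s t] by (intro mult_right_mono) auto
    finally show ?thesis by (simp add: abs_mult mult_ac)
  qed
  have Kint: "integrable (mu a \<Otimes>\<^sub>M mu a) (\<lambda>(s, t). K0 s t * f s * g t)"
  proof (rule Bochner_Integration.integrable_bound[OF dom])
    show "AE x in mu a \<Otimes>\<^sub>M mu a. norm (case x of (s, t) \<Rightarrow> K0 s t * f s * g t) \<le> norm (case x of (s, t) \<Rightarrow> ?w s t)"
      using KF[OF K0_nonneg order_refl] by (intro AE_I2) (auto simp: space_pair_measure intro: order_trans[OF _ abs_ge_self] simp del: abs_mult)
  qed measurable
  have eq: "(\<Sum>m\<in>level_set n. Ha_inner a (schauder_seq m) f * Ha_inner a (schauder_seq m) g) =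
      (\<integral>(s, t). ?S n s t * f s * g t \<partial>(mu a \<Otimes>\<^sub>M mu a))" for n
  proof -
    have int: "integrable (mu a \<Otimes>\<^sub>M mu a) (\<lambda>(s, t). (schauder_seq m s * f s) * (schauder_seq m t * g t))" if "m \<in> level_set n" for m
      using that by (intro product_integrable sigma_finite_mu Ha_mult_integrable schauder_seq_Ha a f g)
    have "Ha_inner a (schauder_seq m) f * Ha_inner a (schauder_seq m) g =
        (\<integral>(s, t). (schauder_seq m s * f s) * (schauder_seq m t * g t) \<partial>(mu a \<Otimes>\<^sub>M mu a))" if m: "m \<in> level_set n" for m
      using integral_fst[OF int[OF m]] by (simp add: Ha_inner_def)
    then have "(\<Sum>m\<in>level_set n. Ha_inner a (schauder_seq m) f * Ha_inner a (schauder_seq m) g) =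
        (\<integral>x. (\<Sum>m\<in>level_set n. case x of (s, t) \<Rightarrow> (schauder_seq m s * f s) * (schauder_seq m t * g t)) \<partial>(mu a \<Otimes>\<^sub>M mu a))"
      using int by (subst Bochner_Integration.integral_sum) auto
    also have "(\<lambda>x. \<Sum>m\<in>level_set n. case x of (s, t) \<Rightarrow> (schauder_seq m s * f s) * (schauder_seq m t * g t)) =
        (\<lambda>(s, t). ?S n s t * f s * g t)"
      by (auto simp: fun_eq_iff sum_distrib_left mult_ac)
    finally show ?thesis .
  qed
  have "(\<lambda>n. \<integral>(s, t). ?S n s t * f s * g t \<partial>(mu a \<Otimes>\<^sub>M mu a)) \<longlonglongrightarrow>
      (\<integral>(s, t). K0 s t * f s * g t \<partial>(mu a \<Otimes>\<^sub>M mu a))"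
  proof (rule integral_dominated_convergence[OF _ _ dom])
    show "AE x in mu a \<Otimes>\<^sub>M mu a. (\<lambda>n. case x of (s, t) \<Rightarrow> ?S n s t * f s * g t)
        \<longlonglongrightarrow> (case x of (s, t) \<Rightarrow> K0 s t * f s * g t)"
      by (intro AE_I2) (auto simp: space_pair_measure intro!: tendsto_intros schauder_kernel_conv)
    show "AE x in mu a \<Otimes>\<^sub>M mu a. norm (case x of (s, t) \<Rightarrow> ?S n s t * f s * g t)
        \<le> (case x of (s, t) \<Rightarrow> ?w s t)" for n
    proof (intro AE_I2)
      fix x assume "x \<in> space (mu a \<Otimes>\<^sub>M mu a)"
      then obtain s t where x: "x = (s, t)" "0 \<le> s" "0 \<le> t" by (auto simp: space_pair_measure)
      have "0 \<le> ?S n s t"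
        by (intro sum_nonneg mult_nonneg_nonneg schauder_seq_nonneg)
      moreover have "?S n s t \<le> K0 s t"
        using schauder_kernel_sum[OF x(2,3), of n] remainder_bounds(1)[of n s t] by simp
      ultimately show "norm (case x of (s, t) \<Rightarrow> ?S n s t * f s * g t)
        \<le> (case x of (s, t) \<Rightarrow> ?w s t)"
        using KF[of _ s t] x by simp
    qed
  qed measurable
  moreover have "(\<integral>(s, t). K0 s t * f s * g t \<partial>(mu a \<Otimes>\<^sub>M mu a)) = K0_form a f g"
  proof -
    have m1: "(\<lambda>t. \<integral>s. K0 s t * f s * g t \<partial>mu a) \<in> borel_measurable (mu a)"
      by (rule borel_measurable_integrable[OF integrable_snd[OF Kint]])
    have m2: "(\<lambda>s. K0 s t * f s * g t) \<in> borel_measurable (mu a)" for t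
    proof -
      have "(\<lambda>s. K0 s t) \<in> borel_measurable (mu a)"
        unfolding K0_def by (rule borel_measurable_muI) measurable
      then show ?thesis by measurable
    qed
    have "(\<integral>(s, t). K0 s t * f s * g t \<partial>(mu a \<Otimes>\<^sub>M mu a)) = (\<integral>t. (\<integral>s. K0 s t * f s * g t \<partial>mu a) \<partial>mu a)"
      by (rule integral_snd[OF Kint, symmetric])
    also have "\<dots> = (LINT t:{0..}|lborel. (LINT s:{0..}|lborel. K0 s t * f s * g t * exp (- a * s)) * exp (- a * t))"
      by (subst integral_mu[OF m1]) (simp only: integral_mu[OF m2])
    also have "\<dots> = K0_form a f g"
      unfolding K0_form_def set_integral_mult_left[symmetric]
      by (simp add: mult.assoc exp_add[symmetric] algebra_simps)
    finally show ?thesis .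
  qed
  ultimately show ?thesis by (simp add: eq)
qed

lemma K0_form_nonneg:
  assumes "0 \<le> a" "f \<in> Ha a"
  shows "0 \<le> K0_form a f f"
  by (rule LIMSEQ_le_const[OF K0_form_conv[OF assms(1,2,2)]]) (auto intro!: sum_nonneg)

text \<open>Polarisation holds term by term in the approximating sums and passes to the
  limit.\<close>

lemma K0_form_polar:
  assumes a: "0 \<le> a" and f: "f \<in> Ha a" and g: "g \<in> Ha a"
  shows "K0_form a (\<lambda>t. f t + g t) (\<lambda>t. f t + g t) - K0_form a (\<lambda>t. f t - g t) (\<lambda>t. f t - g t) = 4 * K0_form a f g"
proof (rule LIMSEQ_unique)
  let ?p = "\<lambda>m h. Ha_inner a (schauder_seq m) h"
  show "(\<lambda>n. (\<Sum>m\<in>level_set n. ?p m (\<lambda>t. f t + g t) * ?p m (\<lambda>t. f t + g t)) - (\<Sum>m\<in>level_set n. ?p m (\<lambda>t. f t - g t) * ?p m (\<lambda>t. f t - g t)))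
      \<longlonglongrightarrow> K0_form a (\<lambda>t. f t + g t) (\<lambda>t. f t + g t) - K0_form a (\<lambda>t. f t - g t) (\<lambda>t. f t - g t)"
    by (intro tendsto_diff K0_form_conv Ha_add Ha_diff a f g)
  have "(\<Sum>m\<in>level_set n. ?p m (\<lambda>t. f t + g t) * ?p m (\<lambda>t. f t + g t)) - (\<Sum>m\<in>level_set n. ?p m (\<lambda>t. f t - g t) * ?p m (\<lambda>t. f t - g t)) =
      4 * (\<Sum>m\<in>level_set n. ?p m f * ?p m g)" for n
    unfolding sum_subtractf[symmetric] sum_distrib_left
  proof (rule sum.cong)
    fix m assume "m \<in> level_set n"
    then have s: "schauder_seq m \<in> Ha a" by (rule schauder_seq_Ha[OF a])
    show "?p m (\<lambda>t. f t + g t) * ?p m (\<lambda>t. f t + g t) - ?p m (\<lambda>t. f t - g t) * ?p m (\<lambda>t. f t - g t) = 4 * (?p m f * ?p m g)"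
      unfolding Ha_inner_commute[of a "schauder_seq m"]
      by (simp add: Ha_inner_add[OF f g s] Ha_inner_diff[OF f g s] algebra_simps)
  qed simp
  then show "(\<lambda>n. (\<Sum>m\<in>level_set n. ?p m (\<lambda>t. f t + g t) * ?p m (\<lambda>t. f t + g t)) - (\<Sum>m\<in>level_set n. ?p m (\<lambda>t. f t - g t) * ?p m (\<lambda>t. f t - g t)))
      \<longlonglongrightarrow> 4 * K0_form a f g"
    using tendsto_mult_left[OF K0_form_conv[OF a f g], of 4] by simp
qed

text \<open>Pairing a partial sum with \<open>f\<close> gives a finite normal combination with
  explicit characteristic function. Bounded convergence leads to the limit; the set of infinite
  energy is discarded as a null set.\<close>

lemma bridge_limit_char:
  assumes a: "0 \<le> a" and f: "f \<in> Ha a"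
  shows "(\<integral>z. iexp (u * Ha_inner a (bridge_limit a z) f) \<partial>gauss) = exp (- (u\<^sup>2 * K0_form a f f) / 2)"
proof (rule LIMSEQ_unique)
  let ?q = "\<lambda>n. \<Sum>m\<in>level_set n. Ha_inner a (schauder_seq m) f * Ha_inner a (schauder_seq m) f"
  interpret G: prob_space gauss by (rule prob_space_gauss)
  show "(\<lambda>n. \<integral>z. iexp (u * Ha_inner a (cut_path a n z) f) \<partial>gauss) \<longlonglongrightarrow> (\<integral>z. iexp (u * Ha_inner a (bridge_limit a z) f) \<partial>gauss)"
  proof (rule integral_dominated_convergence[where w="\<lambda>_. 1"])
    show "(\<lambda>z. iexp (u * Ha_inner a (bridge_limit a z) f)) \<in> borel_measurable gauss"
      using measurable_Ha_inner_bridge_limit[OF a f] by measurable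
    show "(\<lambda>z. iexp (u * Ha_inner a (cut_path a n z) f)) \<in> borel_measurable gauss" for n
      unfolding Ha_inner_cut_path[OF a f] by measurable
    show "AE z in gauss. (\<lambda>n. iexp (u * Ha_inner a (cut_path a n z) f)) \<longlonglongrightarrow> iexp (u * Ha_inner a (bridge_limit a z) f)"
      by (intro AE_I2 tendsto_intros Ha_inner_bridge_limit_conv[OF a f])
  qed auto
  have "(\<integral>z. iexp (u * Ha_inner a (cut_path a n z) f) \<partial>gauss) =
      exp (- (u\<^sup>2 * (?q n)) / 2)" for n
  proof -
    have "(\<integral>z. iexp (u * Ha_inner a (cut_path a n z) f) \<partial>gauss) =
        (\<integral>z. iexp (\<Sum>m\<in>level_set n. (u * Ha_inner a (schauder_seq m) f) * z m) \<partial>gauss)"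
    proof (rule integral_cong_AE)
      show "AE z in gauss. iexp (u * Ha_inner a (cut_path a n z) f) = iexp (\<Sum>m\<in>level_set n. (u * Ha_inner a (schauder_seq m) f) * z m)"
        using energy_finite_AE[OF a] by eventually_elim (simp add: Ha_inner_cut_path[OF a f] sum_distrib_left mult.assoc)
      show "(\<lambda>z. iexp (u * Ha_inner a (cut_path a n z) f)) \<in> borel_measurable gauss"
        unfolding Ha_inner_cut_path[OF a f] by measurable
    qed measurable
    also have "\<dots> = exp (- (\<Sum>m\<in>level_set n. (u * Ha_inner a (schauder_seq m) f)\<^sup>2) / 2)"
      by (rule char_gauss) simp
    also have "(\<Sum>m\<in>level_set n. (u * Ha_inner a (schauder_seq m) f)\<^sup>2) =
        u\<^sup>2 * (?q n)"
      by (simp add: power2_eq_square sum_distrib_left mult_ac)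
    finally show ?thesis .
  qed
  moreover have "(\<lambda>n. complex_of_real (exp (- (u\<^sup>2 * (?q n)) / 2)))
      \<longlonglongrightarrow> complex_of_real (exp (- (u\<^sup>2 * K0_form a f f) / 2))"
    by (intro tendsto_intros K0_form_conv a f) auto
  ultimately show "(\<lambda>n. \<integral>z. iexp (u * Ha_inner a (cut_path a n z) f) \<partial>gauss) \<longlonglongrightarrow> exp (- (u\<^sup>2 * K0_form a f f) / 2)"
    by simp
qed

lemmas bridge_limit_normal = prob_space.gaussian_char_normal[OF prob_space_gauss
    measurable_Ha_inner_bridge_limit K0_form_nonneg bridge_limit_char]

lemma gaussian_element_bridge_limit:
  assumes a: "0 \<le> a"
  shows "gaussian_element gauss a (bridge_limit a)"
  unfolding gaussian_element_def
  using measurable_bridge_limit_Ha[OF a] bridge_limit_normal(1)[OF a _ a _ a] by blast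

lemma centred_bridge_limit:
  assumes a: "0 \<le> a"
  shows "centred gauss a (bridge_limit a)"
  unfolding centred_def using bridge_limit_normal(2,3)[OF a _ a _ a] by blast

text \<open>Characteristic functions of single pairings yield variances only. Products are recovered
  from the variances of the pairings with \<open>f + g\<close> and \<open>f - g\<close>.\<close>

lemma covariance_bridge_limit:
  assumes a: "0 \<le> a"
  shows "has_covariance_kernel gauss a (bridge_limit a) K0"
  unfolding has_covariance_kernel_def K0_form_def[symmetric]
proof (intro ballI conjI)
  fix f g assume f: "f \<in> Ha a" and g: "g \<in> Ha a"
  let ?Y = "\<lambda>h z. Ha_inner a (bridge_limit a z) h"
  have sum: "?Y (\<lambda>t. f t + g t) z = ?Y f z + ?Y g z" "?Y (\<lambda>t. f t - g t) z = ?Y f z - ?Y g z" for z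
    using Ha_inner_add[OF f g bridge_limit_conv(1)[OF a]] Ha_inner_diff[OF f g bridge_limit_conv(1)[OF a]]
    by (simp_all add: Ha_inner_commute[of a "bridge_limit a z"])
  have eq: "?Y f z * ?Y g z = ((?Y (\<lambda>t. f t + g t) z)\<^sup>2 - (?Y (\<lambda>t. f t - g t) z)\<^sup>2) / 4" for z
    unfolding sum by (simp add: power2_eq_square algebra_simps)
  note n = bridge_limit_normal(4,5)[OF a _ a _ a]
  note np = n[OF Ha_add Ha_add Ha_add, OF f g f g f g] and nm = n[OF Ha_diff Ha_diff Ha_diff, OF f g f g f g]
  show "integrable gauss (\<lambda>z. ?Y f z * ?Y g z)"
    unfolding eq by (intro integrable_divide Bochner_Integration.integrable_diff np nm)
  show "(\<integral>z. ?Y f z * ?Y g z \<partial>gauss) = K0_form a f g"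
    unfolding eq using K0_form_polar[OF a f g] np nm by simp
  show "set_integrable (lborel \<Otimes>\<^sub>M lborel) ({0..} \<times> {0..}) (\<lambda>(s, t). K0 s t * f s * g t * exp (- a * (s + t)))"
    by (rule K0_form_integrable[OF a f g])
qed

section \<open>The empirical process of an exponential sample\<close>

text \<open>The memoryless property: the shift by \<open>t\<close> takes out the factor
  \<open>exp (- t)\<close> and leaves a Gamma integral. The case \<open>k = 0\<close> is the
  survival function.\<close>

lemma (in prob_space) exponential_excess_moment:
  assumes Y: "distributed M lborel Y (\<lambda>x. ennreal (exponential_density 1 x))" and t: "0 \<le> t"
  shows "has_bochner_integral M (\<lambda>w. (Y w - t) ^ k * of_bool (t < Y w)) (exp (- t) * fact k)"
proof (rule has_bochner_integral_nn_integral)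
  have [measurable]: "Y \<in> borel_measurable M" using distributed_measurable[OF Y] by simp
  show "(\<lambda>w. (Y w - t) ^ k * of_bool (t < Y w)) \<in> borel_measurable M" by measurable
  show "AE w in M. 0 \<le> (Y w - t) ^ k * of_bool (t < Y w)" by auto
  have "(\<integral>\<^sup>+w. ennreal ((Y w - t) ^ k * of_bool (t < Y w)) \<partial>M) =
      (\<integral>\<^sup>+x. ennreal (exponential_density 1 x) * ennreal ((x - t) ^ k * of_bool (t < x)) \<partial>lborel)"
  proof (rule distributed_nn_integral[OF Y, symmetric])
    have "(\<lambda>x. ennreal ((x - t) ^ k * of_bool (t < x))) \<in> borel_measurable borel" by measurable
    then show "(\<lambda>x. ennreal ((x - t) ^ k * of_bool (t < x))) \<in> borel_measurable lborel" by simp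
  qed
  also have "\<dots> = (\<integral>\<^sup>+x. ennreal (exponential_density 1 (t + 1 * x)) * ennreal ((t + 1 * x - t) ^ k * of_bool (t < t + 1 * x)) \<partial>lborel)"
    by (subst nn_integral_real_affine[where c=1 and t=t]) auto
  also have "\<dots> = (\<integral>\<^sup>+x. ennreal (exp (- t)) * (ennreal (x ^ k * exp (- x)) * indicator {0..} x) \<partial>lborel)"
  proof (rule nn_integral_cong_AE)
    show "AE x in lborel. ennreal (exponential_density 1 (t + 1 * x)) * ennreal ((t + 1 * x - t) ^ k * of_bool (t < t + 1 * x)) =
        ennreal (exp (- t)) * (ennreal (x ^ k * exp (- x)) * indicator {0..} x)"
      \<comment> \<open>For \<open>k = 0\<close> the two sides differ at \<open>x = 0\<close>, where
        a strict inequality meets a closed interval.\<close>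
      using AE_lborel_singleton[of 0]
    proof eventually_elim
      case (elim x)
      show ?case
      proof (cases "0 < x")
        case True
        have "exponential_density 1 (t + 1 * x) * ((t + 1 * x - t) ^ k * of_bool (t < t + 1 * x)) = exp (- t) * (x ^ k * exp (- x))"
          using True t by (simp add: exponential_density_def exp_add[symmetric] mult.commute mult.left_commute)
        then show ?thesis
          using True by (simp add: ennreal_mult[symmetric] exponential_density_nonneg)
      next
        case False
        then show ?thesis using elim by simp
      qed
    qed
  qed
  also have "\<dots> = ennreal (exp (- t)) * ennreal (fact k)"
    by (simp add: nn_integral_cmult nn_intergal_power_times_exp_Ici)
  finally show "(\<integral>\<^sup>+w. ennreal ((Y w - t) ^ k * of_bool (t < Y w)) \<partial>M) = ennreal (exp (- t) * fact k)"
    by (simp add: ennreal_mult)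
qed simp

definition excess :: "real \<Rightarrow> real \<Rightarrow> real" where
  "excess x t = (x - t - 1) * of_bool (t < x)"

text \<open>The summand for the true mean 1, corrected by the first-order effect of estimating it:
  replacing 1 by the sample mean subtracts the mean error times the frequency of
  \<open>t < x\<close>, whose expectation is \<open>exp (- t)\<close>.\<close>

definition psi :: "real \<Rightarrow> real \<Rightarrow> real" where
  "psi x t = excess x t - (x - 1) * exp (- t)"

lemma (in prob_space) excess_mean:
  assumes Y: "distributed M lborel Y (\<lambda>x. ennreal (exponential_density 1 x))" and t: "0 \<le> t"
  shows "has_bochner_integral M (\<lambda>w. excess (Y w) t) 0"
proof -
  have "has_bochner_integral M (\<lambda>w. (Y w - t) ^ 1 * of_bool (t < Y w) - (Y w - t) ^ 0 * of_bool (t < Y w))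
     (exp (- t) * fact 1 - exp (- t) * fact 0)"
    by (intro has_bochner_integral_diff exponential_excess_moment[OF Y t])
  then show ?thesis by (simp add: excess_def algebra_simps)
qed

lemma (in prob_space) excess_cov:
  assumes Y: "distributed M lborel Y (\<lambda>x. ennreal (exponential_density 1 x))" and st: "0 \<le> s" "0 \<le> t"
  shows "has_bochner_integral M (\<lambda>w. excess (Y w) s * excess (Y w) t) (exp (- max s t))"
proof -
  have *: "has_bochner_integral M (\<lambda>w. excess (Y w) s * excess (Y w) t) (exp (- t))" if "0 \<le> s" "s \<le> t" for s t
  proof -
    let ?e = "\<lambda>k w. (Y w - t) ^ k * of_bool (t < Y w)"
    have "0 \<le> t" using that by simp
    note m = exponential_excess_moment[OF Y this]
    \<comment> \<open>With \<open>e = Y - t\<close> and \<open>d = t - s\<close> the product is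
      \<open>(e + d - 1) * (e - 1)\<close> on the event \<open>t < Y\<close>; it is expanded in
      powers of \<open>e\<close>.\<close>
    have "has_bochner_integral M (\<lambda>w. ?e 2 w + (t - s - 2) * ?e 1 w + (1 - (t - s)) * ?e 0 w)
        (exp (- t) * fact 2 + (t - s - 2) * (exp (- t) * fact 1) + (1 - (t - s)) * (exp (- t) * fact 0))"
      by (intro has_bochner_integral_add has_bochner_integral_mult_right m)
    also have "(\<lambda>w. ?e 2 w + (t - s - 2) * ?e 1 w + (1 - (t - s)) * ?e 0 w) = (\<lambda>w. excess (Y w) s * excess (Y w) t)"
      using that by (auto simp: fun_eq_iff excess_def power2_eq_square algebra_simps)
    also have "exp (- t) * fact 2 + (t - s - 2) * (exp (- t) * fact 1) + (1 - (t - s)) * (exp (- t) * fact 0) = exp (- t)"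
      by (simp add: algebra_simps)
    finally show ?thesis .
  qed
  show ?thesis
  proof (cases "s \<le> t")
    case True then show ?thesis using *[of s t] st by (simp add: max_def)
  next
    case False then show ?thesis using *[of t s] st by (simp add: max_def mult.commute)
  qed
qed

text \<open>The variable is almost surely positive. Hence the linear term of \<open>psi\<close> is
  itself an \<open>excess\<close>, and the same moment formulas apply to it.\<close>

lemma (in prob_space) exponential_AE_excess_0:
  assumes Y: "distributed M lborel Y (\<lambda>x. ennreal (exponential_density 1 x))"
  shows "AE w in M. excess (Y w) 0 = Y w - 1"
proof -
  have "AE x in lborel. 0 < ennreal (exponential_density 1 x) \<longrightarrow> excess x 0 = x - 1"
    using AE_lborel_singleton[of 0] by eventually_elim (auto simp: exponential_density_def excess_def)
  moreover have "Measurable.pred lborel (\<lambda>x. excess x 0 = x - 1)"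
  proof -
    have "Measurable.pred borel (\<lambda>x. excess x 0 = x - 1)" unfolding excess_def by measurable
    then show ?thesis by simp
  qed
  ultimately show ?thesis
    by (simp only: distributed_AE2[OF Y, of "\<lambda>x. excess x 0 = x - 1"])
qed

lemma measurable_excess [measurable]: "(\<lambda>(x, t). excess x t) \<in> borel_measurable (borel \<Otimes>\<^sub>M borel)"
  unfolding excess_def by measurable

lemma measurable_psi [measurable]: "(\<lambda>(x, t). psi x t) \<in> borel_measurable (borel \<Otimes>\<^sub>M borel)"
  unfolding psi_def by measurable

text \<open>After \<open>Y - 1\<close> is replaced by the excess at 0, four instances of the
  covariance \<open>exp (- max s t)\<close> combine; three of them contribute multiples of
  \<open>exp (- s) * exp (- t)\<close> that add up to minus one.\<close>

lemma (in prob_space) psi_moments: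
  assumes Y: "distributed M lborel Y (\<lambda>x. ennreal (exponential_density 1 x))"
  shows "0 \<le> t \<Longrightarrow> has_bochner_integral M (\<lambda>w. psi (Y w) t) 0"
    and "0 \<le> s \<Longrightarrow> 0 \<le> t \<Longrightarrow> has_bochner_integral M (\<lambda>w. psi (Y w) s * psi (Y w) t) (K0 s t)"
proof -
  have [measurable]: "Y \<in> borel_measurable M" using distributed_measurable[OF Y] by simp
  define psi' where "psi' x t = excess x t - excess x 0 * exp (- t)" for x t :: real
  have [measurable]: "(\<lambda>w. psi' (Y w) t) \<in> borel_measurable M" for t unfolding psi'_def by measurable
  have ae: "AE w in M. psi' (Y w) t = psi (Y w) t" for t
    using exponential_AE_excess_0[OF Y] by eventually_elim (simp add: psi_def psi'_def)
  show "has_bochner_integral M (\<lambda>w. psi (Y w) t) 0" if "0 \<le> t"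
  proof -
    have "has_bochner_integral M (\<lambda>w. psi' (Y w) t) (0 - 0 * exp (- t))"
      unfolding psi'_def using that by (intro has_bochner_integral_diff has_bochner_integral_mult_left excess_mean[OF Y]) auto
    then show ?thesis
      using has_bochner_integral_cong_AE[OF _ _ ae, of t 0] by simp
  qed
  show "has_bochner_integral M (\<lambda>w. psi (Y w) s * psi (Y w) t) (K0 s t)" if "0 \<le> s" "0 \<le> t"
  proof -
    have "has_bochner_integral M (\<lambda>w. excess (Y w) s * excess (Y w) t - excess (Y w) s * excess (Y w) 0 * exp (- t)
        - excess (Y w) 0 * excess (Y w) t * exp (- s) + excess (Y w) 0 * excess (Y w) 0 * (exp (- s) * exp (- t)))
       (exp (- max s t) - exp (- max s 0) * exp (- t) - exp (- max 0 t) * exp (- s) + exp (- max 0 0) * (exp (- s) * exp (- t)))"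
      using that by (intro has_bochner_integral_add has_bochner_integral_diff has_bochner_integral_mult_left excess_cov[OF Y]) auto
    also have "(\<lambda>w. excess (Y w) s * excess (Y w) t - excess (Y w) s * excess (Y w) 0 * exp (- t)
        - excess (Y w) 0 * excess (Y w) t * exp (- s) + excess (Y w) 0 * excess (Y w) 0 * (exp (- s) * exp (- t))) =
        (\<lambda>w. psi' (Y w) s * psi' (Y w) t)"
      by (simp add: fun_eq_iff psi'_def algebra_simps)
    also have "exp (- max s t) - exp (- max s 0) * exp (- t) - exp (- max 0 t) * exp (- s) + exp (- max 0 0) * (exp (- s) * exp (- t)) = K0 s t"
      using that by (simp add: K0_eq max_def)
    finally have p: "has_bochner_integral M (\<lambda>w. psi' (Y w) s * psi' (Y w) t) (K0 s t)" .
    have ae2: "AE w in M. psi' (Y w) s * psi' (Y w) t = psi (Y w) s * psi (Y w) t"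
      using ae[of s] ae[of t] by eventually_elim simp
    show ?thesis
      using has_bochner_integral_cong_AE[OF _ _ ae2, of "K0 s t"] p by simp
  qed
qed

lemma (in prob_space) psi_comb_moments:
  fixes k :: nat
  assumes Y: "distributed M lborel Y (\<lambda>x. ennreal (exponential_density 1 x))" and y: "\<And>i. i < k \<Longrightarrow> 0 \<le> y i"
  shows "has_bochner_integral M (\<lambda>w. \<Sum>i<k. c i * psi (Y w) (y i)) 0"
    and "has_bochner_integral M (\<lambda>w. (\<Sum>i<k. c i * psi (Y w) (y i))\<^sup>2) (\<Sum>i<k. \<Sum>j<k. c i * c j * K0 (y i) (y j))"
proof -
  have "has_bochner_integral M (\<lambda>w. \<Sum>i<k. c i * psi (Y w) (y i)) (\<Sum>i<k. c i * 0)"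
    using y by (intro has_bochner_integral_sum has_bochner_integral_mult_right psi_moments[OF Y]) auto
  then show "has_bochner_integral M (\<lambda>w. \<Sum>i<k. c i * psi (Y w) (y i)) 0" by simp
  have "has_bochner_integral M (\<lambda>w. \<Sum>i<k. \<Sum>j<k. c i * c j * (psi (Y w) (y i) * psi (Y w) (y j))) (\<Sum>i<k. \<Sum>j<k. c i * c j * K0 (y i) (y j))"
    using y by (intro has_bochner_integral_sum has_bochner_integral_mult_right psi_moments[OF Y]) auto
  then show "has_bochner_integral M (\<lambda>w. (\<Sum>i<k. c i * psi (Y w) (y i))\<^sup>2) (\<Sum>i<k. \<Sum>j<k. c i * c j * K0 (y i) (y j))"
    by (simp add: power2_eq_square sum_product mult_ac)
qed

section \<open>Second moments and the central limit theorem for the empirical process\<close>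

locale exp_sample = prob_space M for M :: "'w measure" +
  fixes X :: "nat \<Rightarrow> 'w \<Rightarrow> real"
  assumes X_indep: "indep_vars (\<lambda>_. borel) X UNIV"
    and X_exp: "\<And>j. distributed M lborel (X j) (\<lambda>x. ennreal (exponential_density 1 x))"
begin

lemma X_measurable [measurable]: "X j \<in> borel_measurable M"
  using distributed_measurable[OF X_exp[of j]] by simp

lemma second_moment_sum:
  assumes \<eta>[measurable]: "\<eta> \<in> borel_measurable borel"
    and mean: "\<And>j. has_bochner_integral M (\<lambda>w. \<eta> (X j w)) 0"
    and sq: "\<And>j. has_bochner_integral M (\<lambda>w. (\<eta> (X j w))\<^sup>2) q"
  shows "(\<integral>\<^sup>+w. ennreal ((\<Sum>j<n. \<eta> (X j w))\<^sup>2) \<partial>M) = ennreal (real n * q)"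
proof -
  have ind: "indep_vars (\<lambda>_. borel) (\<lambda>j w. \<eta> (X j w)) {..<n}"
    by (rule indep_vars_compose2[OF indep_vars_subset[OF X_indep]]) auto
  note s = indep_second_moment_sum[OF _ ind]
  have i: "integrable M (\<lambda>w. (\<eta> (X j w))\<^sup>2)" "expectation (\<lambda>w. \<eta> (X j w)) = 0" "expectation (\<lambda>w. (\<eta> (X j w))\<^sup>2) = q" for j
    using mean[of j] sq[of j] by (auto simp: has_bochner_integral_iff)
  show ?thesis
    using s i by (subst nn_integral_eq_integral) auto
qed

definition empirical :: "nat \<Rightarrow> 'w \<Rightarrow> real \<Rightarrow> real" where
  "empirical n w t = (\<Sum>j<n. psi (X j w) t) / sqrt (real n)"

lemma empirical_comb: "(\<Sum>i<k. c i * empirical n w (y i)) = (\<Sum>j<n. \<Sum>i<k. c i * psi (X j w) (y i)) / sqrt (real n)"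
  unfolding empirical_def sum_divide_distrib sum_distrib_left by (subst sum.swap) simp

text \<open>Independence gives equality for \<open>0 < n\<close>; the inequality also includes
  \<open>n = 0\<close>, where \<open>empirical\<close> is 0.\<close>

lemma empirical_comb_second_moment:
  fixes k :: nat
  assumes y: "\<And>i. i < k \<Longrightarrow> 0 \<le> y i"
  shows "(\<integral>\<^sup>+w. ennreal ((\<Sum>i<k. c i * empirical n w (y i))\<^sup>2) \<partial>M) \<le> ennreal (\<Sum>i<k. \<Sum>j<k. c i * c j * K0 (y i) (y j))"
proof (cases "n = 0")
  case False
  let ?q = "\<Sum>i<k. \<Sum>j<k. c i * c j * K0 (y i) (y j)"
  have "(\<integral>\<^sup>+w. ennreal ((\<Sum>i<k. c i * empirical n w (y i))\<^sup>2) \<partial>M) =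
      (\<integral>\<^sup>+w. ennreal (1 / real n) * ennreal ((\<Sum>j<n. \<Sum>i<k. c i * psi (X j w) (y i))\<^sup>2) \<partial>M)"
    unfolding empirical_comb using False by (simp add: ennreal_mult[symmetric] power_divide)
  also have "\<dots> = ennreal (1 / real n) * ennreal (real n * ?q)"
    using second_moment_sum[of "\<lambda>x. \<Sum>i<k. c i * psi x (y i)" ?q n, OF _ psi_comb_moments[OF X_exp y]]
    by (subst nn_integral_cmult) (auto simp: ennreal_mult)
  also have "\<dots> = ennreal ?q"
    using False by (subst ennreal_mult'[symmetric]) auto
  finally show ?thesis by simp
qed (simp add: empirical_def)

lemma bridge_bounds_empirical: "bridge_bounds M (empirical n)"
  unfolding bridge_bounds_def
proof (intro conjI allI impI)
  show "(\<lambda>(w, t). empirical n w t) \<in> borel_measurable (M \<Otimes>\<^sub>M borel)"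
    unfolding empirical_def by measurable
  fix t :: real assume t: "0 \<le> t"
  have "(\<integral>\<^sup>+w. ennreal ((empirical n w t)\<^sup>2) \<partial>M) \<le> ennreal (K0 t t)"
    using empirical_comb_second_moment[of "Suc 0" "\<lambda>_. t" "\<lambda>_. 1" n] t by simp
  also have "\<dots> \<le> ennreal (exp (- t))" by (intro ennreal_leI K0_diag_le t)
  finally show "(\<integral>\<^sup>+w. ennreal ((empirical n w t)\<^sup>2) \<partial>M) \<le> ennreal (exp (- t))" .
  fix s :: real assume s: "0 \<le> s"
  have sym: "K0 s t = K0 t s" by (simp add: K0_def max.commute add.commute)
  have sum2: "(\<Sum>i<2::nat. f i) = f 0 + f 1" for f :: "nat \<Rightarrow> real" by (simp add: numeral_2_eq_2)
  have "(\<integral>\<^sup>+w. ennreal ((empirical n w s - empirical n w t)\<^sup>2) \<partial>M) \<le> ennreal (K0 s s - 2 * K0 s t + K0 t t)"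
    using empirical_comb_second_moment[of 2 "\<lambda>i. if i = 0 then s else t" "\<lambda>i. if i = 0 then 1 else - 1" n] s t sym
    by (simp add: sum2 algebra_simps)
  also have "\<dots> \<le> ennreal \<bar>s - t\<bar>" by (intro ennreal_leI K0_increment_le s t)
  finally show "(\<integral>\<^sup>+w. ennreal ((empirical n w s - empirical n w t)\<^sup>2) \<partial>M) \<le> ennreal \<bar>s - t\<bar>" .
qed

text \<open>A linear combination of values is a normalised i.i.d. sum, to which the central limit
  theorem applies when its variance \<open>q\<close> is positive; evaluating the characteristic
  function at \<open>sqrt q\<close> undoes the standardisation. If \<open>q = 0\<close>, as when all
  times are 0, the summands vanish almost surely.\<close>

lemma empirical_char_conv:
  fixes k :: nat
  assumes y: "\<And>i. i < k \<Longrightarrow> 0 \<le> y i"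
  shows "(\<lambda>n. \<integral>w. iexp (\<Sum>i<k. c i * empirical n w (y i)) \<partial>M) \<longlonglongrightarrow> gauss_char K0 k c y"
proof -
  define \<eta> where "\<eta> x = (\<Sum>i<k. c i * psi x (y i))" for x
  define q where "q = (\<Sum>i<k. \<Sum>j<k. c i * c j * K0 (y i) (y j))"
  have [measurable]: "\<eta> \<in> borel_measurable borel" unfolding \<eta>_def by measurable
  have mean: "expectation (\<lambda>w. \<eta> (X j w)) = 0" and sqi: "integrable M (\<lambda>w. (\<eta> (X j w))\<^sup>2)" and sq: "expectation (\<lambda>w. (\<eta> (X j w))\<^sup>2) = q" for j
    using psi_comb_moments[OF X_exp[of j] y, where c=c] by (auto simp: has_bochner_integral_iff \<eta>_def q_def)
  have "0 \<le> expectation (\<lambda>w. (\<eta> (X 0 w))\<^sup>2)" by (rule integral_nonneg_AE) simp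
  then have q0: "0 \<le> q" by (simp only: sq)
  have comb: "(\<Sum>i<k. c i * empirical n w (y i)) = (\<Sum>j<n. \<eta> (X j w)) / sqrt (real n)" for n w
    unfolding empirical_comb \<eta>_def ..
  have "(\<lambda>n. \<integral>w. iexp ((\<Sum>j<n. \<eta> (X j w)) / sqrt (real n)) \<partial>M) \<longlonglongrightarrow> complex_of_real (exp (- q / 2))"
  proof (cases "q = 0")
    case True
    have z: "AE w in M. \<eta> (X j w) = 0" for j
      using integral_nonneg_eq_0_iff_AE[OF sqi[of j]] sq[of j] True by simp
    have "(\<integral>w. iexp ((\<Sum>j<n. \<eta> (X j w)) / sqrt (real n)) \<partial>M) = 1" for n
    proof -
      have "AE w in M. \<forall>j. \<eta> (X j w) = 0" using z by (simp add: AE_all_countable)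
      then have "(\<integral>w. iexp ((\<Sum>j<n. \<eta> (X j w)) / sqrt (real n)) \<partial>M) = (\<integral>w. 1 \<partial>M)"
        by (intro integral_cong_AE) auto
      then show ?thesis by (simp add: prob_space)
    qed
    then show ?thesis using True by simp
  next
    case False
    define \<sigma> where "\<sigma> = sqrt q"
    have \<sigma>: "0 < \<sigma>" "\<sigma>\<^sup>2 = q" using q0 False by (auto simp: \<sigma>_def)
    have d: "distr M borel (\<lambda>w. \<eta> (X n w)) = distr M borel (\<lambda>w. \<eta> (X 0 w))" for n
    proof -
      have "distr M borel (X j) = density lborel (\<lambda>x. ennreal (exponential_density 1 x))" for j
        using distributed_distr_eq_density[OF X_exp[of j]] by (metis distr_cong sets_lborel)
      then have "distr (distr M borel (X n)) borel \<eta> = distr (distr M borel (X 0)) borel \<eta>" by simp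
      then show ?thesis by (simp add: distr_distr comp_def)
    qed
    have wc: "weak_conv_m (\<lambda>n. distr M borel (\<lambda>w. (\<Sum>j<n. \<eta> (X j w)) / sqrt (real n * \<sigma>\<^sup>2))) std_normal_distribution"
      by (rule central_limit_theorem_zero_mean[where X="\<lambda>j w. \<eta> (X j w)" and \<mu>="distr M borel (\<lambda>w. \<eta> (X 0 w))"])
         (use mean sqi sq \<sigma> d indep_vars_compose2[OF X_indep, of "\<lambda>_. \<eta>"] in auto)
    have "(\<lambda>n. char (distr M borel (\<lambda>w. (\<Sum>j<n. \<eta> (X j w)) / sqrt (real n * \<sigma>\<^sup>2))) \<sigma>) \<longlonglongrightarrow> char std_normal_distribution \<sigma>"
      by (intro levy_continuity1 wc real_dist_normal_dist real_distribution_distr) measurable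
    moreover have "char (distr M borel (\<lambda>w. (\<Sum>j<n. \<eta> (X j w)) / sqrt (real n * \<sigma>\<^sup>2))) \<sigma> = (\<integral>w. iexp ((\<Sum>j<n. \<eta> (X j w)) / sqrt (real n)) \<partial>M)" for n
      using \<sigma>(1) by (simp add: char_def integral_distr real_sqrt_mult)
    ultimately show ?thesis by (simp add: char_std_normal_distribution \<sigma>(2))
  qed
  then show ?thesis unfolding comb gauss_char_def q_def by simp
qed

end

section \<open>Replacing the sample mean by one\<close>

lemma Ha_exp_bounded:
  assumes a: "0 \<le> a" and f[measurable]: "f \<in> borel_measurable borel" and le: "\<And>t. 0 \<le> t \<Longrightarrow> \<bar>f t\<bar> \<le> C * exp (- t)"
  shows "f \<in> Ha a"
  unfolding Ha_def
proof (intro CollectI conjI)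
  show [measurable]: "f \<in> borel_measurable (mu a)" by (rule borel_measurable_muI) simp
  have C: "0 \<le> C" using le[of 0] by (metis abs_ge_zero exp_zero minus_zero mult.right_neutral order_refl order_trans)
  have "(f t)\<^sup>2 \<le> C\<^sup>2 * exp (- 1 * t)" if "0 \<le> t" for t
  proof -
    have "(f t)\<^sup>2 \<le> (C * exp (- t))\<^sup>2" using power_mono[OF le[OF that], of 2] by simp
    also have "\<dots> = C\<^sup>2 * (exp (- t) * exp (- t))"
      by (simp add: power2_eq_square)
    also have "\<dots> \<le> C\<^sup>2 * exp (- 1 * t)"
      using that by (intro mult_left_mono) (auto simp: mult_left_le)
    finally show ?thesis .
  qed
  then have "(\<integral>\<^sup>+t. ennreal ((f t)\<^sup>2) \<partial>mu a) \<le> (\<integral>\<^sup>+t. ennreal (C\<^sup>2) * ennreal (exp (- 1 * t)) \<partial>mu a)"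
    by (intro nn_integral_mono) (auto simp: ennreal_mult[symmetric] intro!: ennreal_leI)
  also have "\<dots> = ennreal (C\<^sup>2) * (\<integral>\<^sup>+t. ennreal (exp (- 1 * t)) \<partial>mu a)"
    by (intro nn_integral_cmult) (auto intro!: borel_measurable_muI)
  also have "\<dots> \<le> ennreal (C\<^sup>2) * ennreal (1 / 1)"
    by (intro mult_left_mono nn_integral_mu_exp a) auto
  also have "\<dots> < \<infinity>" by (simp add: ennreal_mult_less_top)
  finally show "integrable (mu a) (\<lambda>t. (f t)\<^sup>2)"
    by (intro integrableI_nonneg) auto
qed

lemma indicator_le_exp: "0 \<le> t \<Longrightarrow> of_bool (t < x) \<le> exp \<bar>x\<bar> * exp (- t)" for x t :: real
  by (auto simp: of_bool_def exp_add[symmetric])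

lemma indicator_Ha: "0 \<le> a \<Longrightarrow> (\<lambda>t. of_bool (t < x)) \<in> Ha a"
  by (rule Ha_exp_bounded[where C="exp \<bar>x\<bar>"]) (auto simp: indicator_le_exp)

lemma exp_Ha: "0 \<le> a \<Longrightarrow> (\<lambda>t. exp (- t)) \<in> Ha a"
  by (rule Ha_exp_bounded[where C=1]) auto

lemma psi_Ha:
  assumes "0 \<le> a"
  shows "psi x \<in> Ha a"
proof -
  have "(\<lambda>t. excess x t) \<in> Ha a"
  proof (rule Ha_exp_bounded[where C="(\<bar>x\<bar> + 1) * exp \<bar>x\<bar>"])
    fix t :: real assume t: "0 \<le> t"
    have "\<bar>excess x t\<bar> \<le> (\<bar>x\<bar> + 1) * of_bool (t < x)"
      using t by (auto simp: excess_def)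
    also have "\<dots> \<le> (\<bar>x\<bar> + 1) * (exp \<bar>x\<bar> * exp (- t))"
      by (intro mult_left_mono indicator_le_exp t) auto
    finally show "\<bar>excess x t\<bar> \<le> (\<bar>x\<bar> + 1) * exp \<bar>x\<bar> * exp (- t)" by (simp add: mult.assoc)
  qed (use assms in auto)
  from Ha_diff[OF this Ha_scale[OF exp_Ha[OF assms], of "x - 1"]] show ?thesis
    by (simp add: psi_def[abs_def])
qed

text \<open>Moving the weight into the integrand allows integrals with the random rate
  \<open>a / m\<close> and with the rate \<open>a\<close> to be compared under one measure.\<close>

lemma integral_mu_0:
  assumes f[measurable]: "f \<in> borel_measurable borel"
  shows "(\<integral>t. f t \<partial>mu a) = (\<integral>t. f t * exp (- a * t) \<partial>mu 0)"
  by (subst (1 2) integral_mu) (auto intro!: borel_measurable_muI)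

text \<open>The bound is uniform in \<open>t\<close>. The cube contributes
  \<open>38 * \<delta>\<close>, with 38 equal to 8 times \<open>1 + 3 / 2 + 9 / 4\<close>, and the
  exponentials contribute \<open>3 * \<delta>\<close>.\<close>

lemma weight_diff:
  fixes a m t \<delta> :: real
  assumes a: "0 \<le> a" and t: "0 \<le> t" and m: "\<bar>m - 1\<bar> \<le> \<delta>" "\<delta> \<le> 1 / 2"
  shows "\<bar>exp (- (a / m) * t) / m ^ 3 - exp (- a * t)\<bar> \<le> 41 * \<delta>"
proof -
  have mb: "1 / 2 \<le> m" "m \<le> 3 / 2" "0 \<le> \<delta>" using m by linarith+
  have 1: "\<bar>1 / m ^ 3 - 1\<bar> \<le> 38 * \<delta>"
  proof -
    have "1 / m ^ 3 - 1 = (1 - m) * (1 + m + m\<^sup>2) * (1 / m) ^ 3"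
      using mb by (simp add: field_simps power2_eq_square power3_eq_cube)
    then have "\<bar>1 / m ^ 3 - 1\<bar> = \<bar>1 - m\<bar> * (1 + m + m\<^sup>2) * (1 / m) ^ 3"
      using mb by (simp add: abs_mult)
    also have "\<dots> \<le> \<delta> * (1 + 3 / 2 + (3 / 2)\<^sup>2) * 2 ^ 3"
      using mb m by (intro mult_mono power_mono add_mono) (auto simp: field_simps)
    also have "\<dots> = 38 * \<delta>" by (simp add: power2_eq_square)
    finally show ?thesis .
  qed
  define q where "q = a * t"
  have q: "0 \<le> q" using a t by (simp add: q_def)
  \<comment> \<open>The unbounded factor \<open>x\<close> in the Lipschitz estimate is absorbed by
    \<open>exp (- x) * x\<close>, which is at most 1. The ratio \<open>r\<close> is at least 1, so
    \<open>m\<close> up to 1 is treated with base \<open>q\<close> and larger \<open>m\<close> with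
    base \<open>q / m\<close>.\<close>
  have gap: "\<bar>exp (- x) - exp (- x * r)\<bar> \<le> r - 1" if "0 \<le> x" "1 \<le> r" for x r :: real
  proof -
    have "exp (- x) - exp (- x * r) = exp (- x) * (1 - exp (- (x * (r - 1))))"
      by (simp add: right_diff_distrib exp_add[symmetric] algebra_simps)
    moreover have "0 \<le> 1 - exp (- (x * (r - 1)))" using that by simp
    moreover have "1 - exp (- (x * (r - 1))) \<le> x * (r - 1)"
      using exp_ge_add_one_self[of "- (x * (r - 1))"] by linarith
    moreover have "exp (- x) * x \<le> 1"
    proof -
      have "x \<le> exp x" using exp_ge_add_one_self[of x] by linarith
      then show ?thesis by (simp add: exp_minus field_simps)
    qed
    ultimately have "\<bar>exp (- x) - exp (- x * r)\<bar> \<le> exp (- x) * (x * (r - 1))"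
      by (simp add: abs_mult mult_left_mono)
    also have "\<dots> = (exp (- x) * x) * (r - 1)" by simp
    also have "\<dots> \<le> 1 * (r - 1)" using \<open>exp (- x) * x \<le> 1\<close> that by (intro mult_right_mono) auto
    finally show ?thesis by simp
  qed
  have 2: "\<bar>exp (- (a / m) * t) - exp (- a * t)\<bar> \<le> 3 * \<delta>"
  proof (cases "m \<le> 1")
    case True
    have "\<bar>exp (- q) - exp (- q * (1 / m))\<bar> \<le> 1 / m - 1"
      using True mb by (intro gap q) auto
    also have "\<dots> = (1 - m) * (1 / m)" using mb by (simp add: field_simps)
    also have "\<dots> \<le> \<delta> * 2" using mb m by (intro mult_mono) (auto simp: field_simps)
    finally show ?thesis using mb by (simp add: q_def abs_minus_commute mult.commute)
  next
    case False
    have "\<bar>exp (- (q / m)) - exp (- (q / m) * m)\<bar> \<le> m - 1"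
      using False mb q by (intro gap) auto
    moreover have "q / m * m = q" using mb by simp
    ultimately show ?thesis using m mb by (simp add: q_def)
  qed
  have "exp (- (a / m) * t) / m ^ 3 - exp (- a * t) =
      (1 / m ^ 3 - 1) * exp (- (a / m) * t) + (exp (- (a / m) * t) - exp (- a * t))"
    by (simp add: algebra_simps)
  moreover have "\<bar>(1 / m ^ 3 - 1) * exp (- (a / m) * t)\<bar> \<le> 38 * \<delta> * 1"
    unfolding abs_mult using 1 a t mb by (intro mult_mono) auto
  ultimately show ?thesis using 2 by linarith
qed

text \<open>The change of weight costs \<open>41 * \<delta>\<close> times the squared norm of
  \<open>V - R\<close>. The cross term is split by Young's inequality into \<delta> times the square
  of \<open>V\<close> and \<open>1 / \<delta>\<close> times the square of \<open>R\<close>; the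
  latter is of order \<delta> because the integral of the square of \<open>R\<close> is at most the
  square of \<delta>. The total \<open>(83 * L + 43) * \<delta>\<close> is rounded up.\<close>

lemma perturbed_norm_diff:
  assumes a: "0 \<le> a" and V: "V \<in> Ha 0" and R: "R \<in> Ha 0"
    and Vb[measurable]: "V \<in> borel_measurable borel" and Rb[measurable]: "R \<in> borel_measurable borel"
    and d: "0 < \<delta>" "\<delta> \<le> 1 / 2" and m: "\<bar>m - 1\<bar> \<le> \<delta>"
    and A: "(\<integral>t. (V t)\<^sup>2 \<partial>mu 0) \<le> L" and B: "(\<integral>t. (R t)\<^sup>2 \<partial>mu 0) \<le> \<delta>\<^sup>2"
  shows "\<bar>(\<integral>t. (V t - R t)\<^sup>2 \<partial>mu (a / m)) / m ^ 3 - (\<integral>t. (V t)\<^sup>2 \<partial>mu a)\<bar> \<le> 100 * \<delta> * (L + 1)"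
proof -
  have mb: "1 / 2 \<le> m" using m d by linarith
  have g: "(\<lambda>t. V t - R t) \<in> Ha 0" by (rule Ha_diff[OF V R])
  have Ai: "integrable (mu 0) (\<lambda>t. (V t)\<^sup>2)" and Bi: "integrable (mu 0) (\<lambda>t. (R t)\<^sup>2)" and gi: "integrable (mu 0) (\<lambda>t. (V t - R t)\<^sup>2)"
    using Ha_sq_integrable V R g by auto
  let ?w = "\<lambda>b t. exp (- b * t)"
  have wi: "integrable (mu 0) (\<lambda>t. f t * ?w b t)" if fi: "integrable (mu 0) f" and b: "0 \<le> b" for f b
  proof (rule Bochner_Integration.integrable_bound[OF fi])
    have [measurable]: "?w b \<in> borel_measurable (mu 0)" by (rule borel_measurable_muI) measurable
    show "(\<lambda>t. f t * ?w b t) \<in> borel_measurable (mu 0)"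
      using borel_measurable_integrable[OF fi] by measurable
    show "AE t in mu 0. norm (f t * ?w b t) \<le> norm (f t)"
      using b by (intro AE_I2) (auto simp: abs_mult mult_left_le)
  qed
  have am: "0 \<le> a / m" using a mb by simp
  have eq: "(\<integral>t. (V t - R t)\<^sup>2 \<partial>mu (a / m)) / m ^ 3 - (\<integral>t. (V t)\<^sup>2 \<partial>mu a) =
      (\<integral>t. (V t - R t)\<^sup>2 * ?w (a / m) t / m ^ 3 - (V t)\<^sup>2 * ?w a t \<partial>mu 0)"
    using wi[OF gi am] wi[OF Ai a] by (subst (1 2) integral_mu_0) auto
  have "\<bar>\<integral>t. (V t - R t)\<^sup>2 * ?w (a / m) t / m ^ 3 - (V t)\<^sup>2 * ?w a t \<partial>mu 0\<bar> \<le> (\<integral>t. 41 * \<delta> * (V t - R t)\<^sup>2 + ((R t)\<^sup>2 * (1 + 1 / \<delta>) + \<delta> * (V t)\<^sup>2) \<partial>mu 0)"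
  proof (intro abs_integral_le)
    fix t assume "t \<in> space (mu 0)"
    then have t: "0 \<le> t" by simp
    have "(V t - R t)\<^sup>2 * ?w (a / m) t / m ^ 3 - (V t)\<^sup>2 * ?w a t =
        (V t - R t)\<^sup>2 * (?w (a / m) t / m ^ 3 - ?w a t) + ((V t - R t)\<^sup>2 - (V t)\<^sup>2) * ?w a t"
      by (simp add: algebra_simps)
    moreover have "\<bar>(V t - R t)\<^sup>2 * (?w (a / m) t / m ^ 3 - ?w a t)\<bar> \<le> (V t - R t)\<^sup>2 * (41 * \<delta>)"
      unfolding abs_mult using weight_diff[OF a t m d(2)] by (simp add: mult_left_mono)
    moreover have "\<bar>((V t - R t)\<^sup>2 - (V t)\<^sup>2) * ?w a t\<bar> \<le> (R t)\<^sup>2 * (1 + 1 / \<delta>) + \<delta> * (V t)\<^sup>2"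
    proof -
      have "(V t - R t)\<^sup>2 - (V t)\<^sup>2 = (R t)\<^sup>2 - 2 * (V t * R t)"
        by (simp add: power2_eq_square algebra_simps)
      then have "\<bar>((V t - R t)\<^sup>2 - (V t)\<^sup>2) * ?w a t\<bar> = \<bar>(R t)\<^sup>2 - 2 * (V t * R t)\<bar> * ?w a t"
        by (simp add: abs_mult)
      also have "\<dots> \<le> \<bar>(R t)\<^sup>2 - 2 * (V t * R t)\<bar> * 1"
        using a t by (intro mult_left_mono) auto
      also have "\<dots> \<le> (R t)\<^sup>2 + 2 * (\<bar>V t\<bar> * \<bar>R t\<bar>)"
        using abs_triangle_ineq4[of "(R t)\<^sup>2" "2 * (V t * R t)"] by (simp add: abs_mult)
      finally have le: "\<bar>((V t - R t)\<^sup>2 - (V t)\<^sup>2) * ?w a t\<bar> \<le> (R t)\<^sup>2 + 2 * (\<bar>V t\<bar> * \<bar>R t\<bar>)" .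
      have "0 \<le> (\<delta> * \<bar>V t\<bar> - \<bar>R t\<bar>)\<^sup>2" by simp
      then have "2 * (\<bar>V t\<bar> * \<bar>R t\<bar>) * \<delta> \<le> (\<delta> * (V t)\<^sup>2 + (R t)\<^sup>2 / \<delta>) * \<delta>"
        using d by (simp add: power2_diff power_mult_distrib power2_eq_square algebra_simps)
      then have "2 * (\<bar>V t\<bar> * \<bar>R t\<bar>) \<le> \<delta> * (V t)\<^sup>2 + (R t)\<^sup>2 / \<delta>"
        using d by simp
      with le show ?thesis by (simp add: algebra_simps)
    qed
    ultimately show "\<bar>(V t - R t)\<^sup>2 * ?w (a / m) t / m ^ 3 - (V t)\<^sup>2 * ?w a t\<bar> \<le> 41 * \<delta> * (V t - R t)\<^sup>2 + ((R t)\<^sup>2 * (1 + 1 / \<delta>) + \<delta> * (V t)\<^sup>2)"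
      by (smt (verit) mult.commute)
  qed (use Ai Bi gi wi[OF gi am] wi[OF Ai a] in auto)
  also have "\<dots> = 41 * \<delta> * (\<integral>t. (V t - R t)\<^sup>2 \<partial>mu 0) + ((\<integral>t. (R t)\<^sup>2 \<partial>mu 0) * (1 + 1 / \<delta>) + \<delta> * (\<integral>t. (V t)\<^sup>2 \<partial>mu 0))"
    using Ai Bi gi by simp
  also have "\<dots> \<le> 41 * \<delta> * (2 * L + 1) + (\<delta>\<^sup>2 * (1 + 1 / \<delta>) + \<delta> * L)"
  proof (intro add_mono mult_left_mono mult_right_mono A B)
    have "(\<integral>t. (V t - R t)\<^sup>2 \<partial>mu 0) \<le> (\<integral>t. 2 * (V t)\<^sup>2 + 2 * (R t)\<^sup>2 \<partial>mu 0)"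
    proof (rule integral_mono[OF gi])
      show "(V t - R t)\<^sup>2 \<le> 2 * (V t)\<^sup>2 + 2 * (R t)\<^sup>2" for t
        using sum_squares_bound[of "V t" "- R t"] by (simp add: power2_diff)
    qed (use Ai Bi in auto)
    also have "\<dots> = 2 * (\<integral>t. (V t)\<^sup>2 \<partial>mu 0) + 2 * (\<integral>t. (R t)\<^sup>2 \<partial>mu 0)" using Ai Bi by simp
    also have "\<dots> \<le> 2 * L + 2 * (1 / 2)\<^sup>2"
      using A B power_mono[OF d(2), of 2] d by (intro add_mono mult_left_mono) (auto intro: order_trans)
    finally show "(\<integral>t. (V t - R t)\<^sup>2 \<partial>mu 0) \<le> 2 * L + 1" by (simp add: power2_eq_square)
  qed (use d in auto)
  also have "\<dots> \<le> 100 * \<delta> * (L + 1)"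
  proof -
    have "0 \<le> (\<integral>t. (V t)\<^sup>2 \<partial>mu 0)" by simp
    then have L: "0 \<le> L" using A by linarith
    have "\<delta>\<^sup>2 * (1 + 1 / \<delta>) = \<delta> * \<delta> + \<delta>" using d by (simp add: power2_eq_square field_simps)
    also have "\<dots> \<le> \<delta> * 1 + \<delta>" using d by (intro add_mono mult_left_mono) auto
    finally have "\<delta>\<^sup>2 * (1 + 1 / \<delta>) \<le> 2 * \<delta>" by simp
    moreover have "0 \<le> \<delta> * L" using d L by simp
    ultimately show ?thesis using d by (simp add: algebra_simps)
  qed
  finally show ?thesis unfolding eq .
qed

section \<open>Rescaling the statistic and splitting off the estimation error\<close>

definition centred_sum :: "nat \<Rightarrow> (nat \<Rightarrow> real) \<Rightarrow> real \<Rightarrow> real" where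
  "centred_sum n x t = (\<Sum>j<n. (x j - t - sample_mean n x) * of_bool (t < x j)) / sqrt (real n)"

text \<open>The cube collects one factor from the line element and two from the squared summand
  \<open>(x j - y - m) / m\<close>. Positivity of the mean preserves the half-line and the
  inequality in the indicator.\<close>

lemma test_statistic_rescaled:
  assumes m: "0 < sample_mean n x"
  shows "test_statistic n a x = (\<integral>t. (centred_sum n x t)\<^sup>2 \<partial>mu (a / sample_mean n x)) / sample_mean n x ^ 3"
proof -
  let ?S = "\<lambda>u. \<Sum>j<n. (scaled n x j - u - 1) * (if scaled n x j > u then 1 else 0)"
  define m where "m = sample_mean n x"
  have m: "0 < m" using assms by (simp add: m_def)
  have n: "0 < n" using assms by (cases "n = 0") (auto simp: sample_mean_def)
  have [measurable]: "centred_sum n x \<in> borel_measurable borel" unfolding centred_sum_def[abs_def] by measurable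
  have summand: "(scaled n x j - y / m - 1) * (if scaled n x j > y / m then 1 else 0) = (x j - y - m) * of_bool (y < x j) / m" for j y
    using m by (auto simp: scaled_def m_def[symmetric] field_simps)
  have pt: "real n * (\<bar>?S (y / m) / real n\<bar>\<^sup>2) = (centred_sum n x y)\<^sup>2 / m\<^sup>2" for y
  proof -
    have "?S (y / m) = (\<Sum>j<n. (x j - y - m) * of_bool (y < x j)) / m"
      unfolding summand by (simp only: sum_divide_distrib)
    then show ?thesis
      using n by (simp add: centred_sum_def m_def[symmetric] power_divide power2_eq_square)
  qed
  have "test_statistic n a x = real n * (LINT y|lborel. indicator {0..} y *
      (\<bar>(\<Sum>j<n. (scaled n x j - y - 1) * (if scaled n x j > y then 1 else 0)) / real n\<bar>\<^sup>2 * exp (- a * y)))"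
    by (simp add: test_statistic_def set_lebesgue_integral_def)
  also have "\<dots> = real n * (\<bar>1 / m\<bar> * (LINT y|lborel. indicator {0..} (0 + 1 / m * y) *
      (\<bar>(\<Sum>j<n. (scaled n x j - (0 + 1 / m * y) - 1) * (if scaled n x j > (0 + 1 / m * y) then 1 else 0)) / real n\<bar>\<^sup>2 * exp (- a * (0 + 1 / m * y)))))"
    using m by (subst lborel_integral_real_affine[where c="1 / m" and t=0]) auto
  also have "\<dots> = 1 / m * (LINT y|lborel. real n * (indicator {0..} (y / m) *
      (\<bar>?S (y / m) / real n\<bar>\<^sup>2 * exp (- a * (y / m)))))"
    using m by simp
  also have "\<dots> = 1 / m * (LINT y|lborel. indicator {0..} y * ((centred_sum n x y)\<^sup>2 * exp (- (a / m) * y)) / m\<^sup>2)"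
  proof (rule arg_cong[where f="\<lambda>z. 1 / m * z"], rule Bochner_Integration.integral_cong[OF refl])
    fix y
    have "indicator {0..} (y / m) = (indicator {0..} y :: real)"
      using m by (auto simp: indicator_def zero_le_divide_iff)
    moreover have "exp (- a * (y / m)) = exp (- (a / m) * y)" by simp
    ultimately have "real n * (indicator {0..} (y / m) * (\<bar>?S (y / m) / real n\<bar>\<^sup>2 * exp (- a * (y / m)))) =
      indicator {0..} y * exp (- (a / m) * y) * (real n * (\<bar>?S (y / m) / real n\<bar>\<^sup>2))"
      by (simp only: mult_ac)
    also have "\<dots> = indicator {0..} y * ((centred_sum n x y)\<^sup>2 * exp (- (a / m) * y)) / m\<^sup>2"
      unfolding pt by simp
    finally show "real n * (indicator {0..} (y / m) * (\<bar>?S (y / m) / real n\<bar>\<^sup>2 * exp (- a * (y / m)))) =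
      indicator {0..} y * ((centred_sum n x y)\<^sup>2 * exp (- (a / m) * y)) / m\<^sup>2" .
  qed
  also have "\<dots> = (\<integral>t. (centred_sum n x t)\<^sup>2 \<partial>mu (a / m)) / m ^ 3"
    by (subst integral_mu) (auto intro!: borel_measurable_muI simp: set_lebesgue_integral_def power2_eq_square power3_eq_cube)
  finally show ?thesis by (simp add: m_def)
qed

definition tail_error :: "nat \<Rightarrow> (nat \<Rightarrow> real) \<Rightarrow> real \<Rightarrow> real" where
  "tail_error n x t = (\<Sum>j<n. of_bool (t < x j) - exp (- t)) / real n"

lemma measurable_tail_error [measurable]: "tail_error n x \<in> borel_measurable borel"
  unfolding tail_error_def[abs_def] by measurable

lemma tail_error_Ha: "0 \<le> a \<Longrightarrow> tail_error n x \<in> Ha a"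
proof -
  assume a: "0 \<le> a"
  have "(\<lambda>t. 1 / real n * (\<Sum>j<n. of_bool (t < x j) - exp (- t))) \<in> Ha a"
    by (intro Ha_scale Ha_sum Ha_diff indicator_Ha exp_Ha a)
  then show ?thesis by (simp add: tail_error_def[abs_def])
qed

text \<open>Centring at the sample mean instead of 1 subtracts \<open>(m - 1) * S0\<close>. The
  expected part of \<open>S0\<close> enters \<open>psi\<close>, because \<open>n * (m - 1)\<close>
  is the sum of the \<open>x j - 1\<close>; its fluctuation is \<open>tail_error\<close>.\<close>

lemma centred_sum_decomp:
  assumes n: "0 < n"
  shows "centred_sum n x t = (\<Sum>j<n. psi (x j) t) / sqrt (real n) - sqrt (real n) * (sample_mean n x - 1) * tail_error n x t"
proof -
  define m where "m = sample_mean n x"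
  define s where "s = sqrt (real n)"
  have s: "0 < s" "real n = s * s" using n by (auto simp: s_def)
  define S0 S1 where "S0 = (\<Sum>j<n. of_bool (t < x j) :: real)" and "S1 = (\<Sum>j<n. excess (x j) t)"
  have "(\<Sum>j<n. x j) = real n * m" using n by (simp add: m_def sample_mean_def)
  then have x1: "(\<Sum>j<n. x j - 1) = real n * (m - 1)" by (simp add: sum_subtractf algebra_simps)
  have f1: "(\<Sum>j<n. (x j - t - m) * of_bool (t < x j)) = S1 - (m - 1) * S0"
    unfolding S1_def S0_def excess_def sum_distrib_left sum_subtractf[symmetric]
    by (intro sum.cong) (auto simp: algebra_simps)
  have f2: "(\<Sum>j<n. psi (x j) t) = S1 - real n * (m - 1) * exp (- t)"
    unfolding S1_def x1[symmetric] sum_distrib_right sum_subtractf[symmetric] psi_def ..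
  have f3: "tail_error n x t = (S0 - real n * exp (- t)) / real n"
    unfolding tail_error_def sum_subtractf S0_def by simp
  show ?thesis
    unfolding centred_sum_def m_def[symmetric] s_def[symmetric] f1 f2 f3 s(2) using s(1)
    by (simp add: field_simps)
qed

section \<open>Comparison of the Laplace transforms of the statistic and of the empirical
  norm\<close>

context exp_sample
begin

lemma sample_mean_second_moment:
  assumes n: "0 < n"
  shows "(\<integral>\<^sup>+w. ennreal ((sample_mean n (\<lambda>j. X j w) - 1)\<^sup>2) \<partial>M) = ennreal (1 / real n)"
proof -
  have ae: "AE w in M. excess (X j w) 0 = X j w - 1" for j by (rule exponential_AE_excess_0[OF X_exp])
  have mean: "has_bochner_integral M (\<lambda>w. excess (X j w) 0) 0" for j
    using excess_mean[OF X_exp, of 0] by simp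
  have sq: "has_bochner_integral M (\<lambda>w. (excess (X j w) 0)\<^sup>2) 1" for j
    using excess_cov[OF X_exp, of 0 0] by (simp add: power2_eq_square)
  have "AE w in M. \<forall>j. excess (X j w) 0 = X j w - 1" using ae by (simp add: AE_all_countable)
  then have "(\<integral>\<^sup>+w. ennreal ((sample_mean n (\<lambda>j. X j w) - 1)\<^sup>2) \<partial>M) = (\<integral>\<^sup>+w. ennreal (1 / (real n)\<^sup>2) * ennreal ((\<Sum>j<n. excess (X j w) 0)\<^sup>2) \<partial>M)"
  proof (intro nn_integral_cong_AE, eventually_elim)
    case (elim w)
    have "sample_mean n (\<lambda>j. X j w) - 1 = (\<Sum>j<n. X j w - 1) / real n"
      using n by (simp add: sample_mean_def sum_subtractf field_simps)
    also have "(\<Sum>j<n. X j w - 1) = (\<Sum>j<n. excess (X j w) 0)" using elim by simp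
    finally show ?case by (simp add: power_divide ennreal_mult[symmetric])
  qed
  also have "\<dots> = ennreal (1 / (real n)\<^sup>2) * ennreal (real n * 1)"
    using second_moment_sum[of "\<lambda>x. excess x 0" 1 n, OF _ mean sq]
    by (subst nn_integral_cmult) auto
  also have "\<dots> = ennreal (1 / real n)"
    using n by (subst ennreal_mult[symmetric]) (auto simp: power2_eq_square)
  finally show ?thesis .
qed

text \<open>The variance of an indicator with mean \<open>exp (- t)\<close> is at most
  \<open>exp (- t)\<close>; keeping this decay makes the bound integrable over the
  half-line.\<close>

lemma tail_error_second_moment:
  assumes n: "0 < n" and t: "0 \<le> t"
  shows "(\<integral>\<^sup>+w. ennreal ((tail_error n (\<lambda>j. X j w) t)\<^sup>2) \<partial>M) \<le> ennreal (1 / real n) * ennreal (exp (- 1 * t))"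
proof -
  define \<eta> where "\<eta> x = of_bool (t < x) - exp (- t)" for x :: real
  have [measurable]: "\<eta> \<in> borel_measurable borel" unfolding \<eta>_def by measurable
  have b: "has_bochner_integral M (\<lambda>w. of_bool (t < X j w)) (exp (- t))" for j
    using exponential_excess_moment[OF X_exp t, of j 0] by simp
  have c: "has_bochner_integral M (\<lambda>w. c) c" for c :: real
    by (simp add: has_bochner_integral_iff prob_space)
  have mean: "has_bochner_integral M (\<lambda>w. \<eta> (X j w)) 0" for j
    using has_bochner_integral_diff[OF b c, of j "exp (- t)"] by (simp add: \<eta>_def)
  have sq: "has_bochner_integral M (\<lambda>w. (\<eta> (X j w))\<^sup>2) (exp (- t) - exp (- t) * exp (- t))" for j
  proof -
    have "has_bochner_integral M (\<lambda>w. (1 - 2 * exp (- t)) * of_bool (t < X j w) + exp (- t) * exp (- t)) ((1 - 2 * exp (- t)) * exp (- t) + exp (- t) * exp (- t))"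
      by (intro has_bochner_integral_add has_bochner_integral_mult_right b c)
    also have "(\<lambda>w. (1 - 2 * exp (- t)) * of_bool (t < X j w) + exp (- t) * exp (- t)) = (\<lambda>w. (\<eta> (X j w))\<^sup>2)"
      by (auto simp: fun_eq_iff \<eta>_def power2_eq_square algebra_simps)
    finally show ?thesis by (simp add: algebra_simps)
  qed
  have "(\<integral>\<^sup>+w. ennreal ((tail_error n (\<lambda>j. X j w) t)\<^sup>2) \<partial>M) = (\<integral>\<^sup>+w. ennreal (1 / (real n)\<^sup>2) * ennreal ((\<Sum>j<n. \<eta> (X j w))\<^sup>2) \<partial>M)"
    unfolding tail_error_def \<eta>_def by (simp add: power_divide ennreal_mult[symmetric])
  also have "\<dots> = ennreal (1 / (real n)\<^sup>2) * ennreal (real n * (exp (- t) - exp (- t) * exp (- t)))"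
    using second_moment_sum[of \<eta> _ n, OF _ mean sq] by (subst nn_integral_cmult) auto
  also have "\<dots> = ennreal (1 / real n * (exp (- t) - exp (- t) * exp (- t)))"
    using n by (subst ennreal_mult'[symmetric]) (auto simp: power2_eq_square)
  also have "\<dots> \<le> ennreal (1 / real n * exp (- 1 * t))"
    using n by (intro ennreal_leI mult_left_mono) auto
  also have "\<dots> = ennreal (1 / real n) * ennreal (exp (- 1 * t))"
    by (rule ennreal_mult) auto
  finally show ?thesis .
qed

lemma measurable_sample_mean [measurable]: "(\<lambda>w. sample_mean n (\<lambda>j. X j w)) \<in> borel_measurable M"
  unfolding sample_mean_def by measurable

lemma measurable_test_statistic: "(\<lambda>w. test_statistic n a (\<lambda>j. X j w)) \<in> borel_measurable M"
proof -
  have "(\<lambda>(w, y). scaled n (\<lambda>j. X j w) i) \<in> borel_measurable (M \<Otimes>\<^sub>M lborel)" for i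
    unfolding scaled_def by measurable
  note [measurable] = this
  have [measurable]: "Measurable.pred (M \<Otimes>\<^sub>M lborel) (\<lambda>(w, y). scaled n (\<lambda>j. X j w) i > y)" for i
  proof -
    have [measurable]: "(\<lambda>p. snd p) \<in> borel_measurable (M \<Otimes>\<^sub>M lborel)"
      using measurable_snd[of M lborel] by simp
    show ?thesis unfolding scaled_def case_prod_unfold by measurable
  qed
  show ?thesis
    unfolding test_statistic_def set_lebesgue_integral_def scaled_def by measurable
qed

lemma mean_tail_error:
  assumes n: "0 < n"
  shows "(\<integral>\<^sup>+w. ennreal (\<integral>t. (tail_error n (\<lambda>j. X j w) t)\<^sup>2 \<partial>mu 0) \<partial>M) \<le> ennreal (1 / real n)"
    and "(\<lambda>w. \<integral>t. (tail_error n (\<lambda>j. X j w) t)\<^sup>2 \<partial>mu 0) \<in> borel_measurable M"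
proof -
  let ?Q = "\<lambda>w. \<integral>t. (tail_error n (\<lambda>j. X j w) t)\<^sup>2 \<partial>mu 0"
  interpret mu: sigma_finite_measure "mu 0" by (rule sigma_finite_mu)
  interpret pair_sigma_finite M "mu 0" ..
  have "(\<lambda>(w, t). tail_error n (\<lambda>j. X j w) t) \<in> borel_measurable (M \<Otimes>\<^sub>M borel)"
    unfolding tail_error_def by measurable
  note [measurable] = measurable_pair_mu[OF this, of 0]
  show "(\<lambda>w. \<integral>t. (tail_error n (\<lambda>j. X j w) t)\<^sup>2 \<partial>mu 0) \<in> borel_measurable M" by measurable
  have "(\<integral>\<^sup>+w. ennreal (?Q w) \<partial>M) = (\<integral>\<^sup>+w. (\<integral>\<^sup>+t. ennreal ((tail_error n (\<lambda>j. X j w) t)\<^sup>2) \<partial>mu 0) \<partial>M)"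
    by (intro nn_integral_cong nn_integral_eq_integral[symmetric] Ha_sq_integrable tail_error_Ha) auto
  also have "\<dots> = (\<integral>\<^sup>+t. (\<integral>\<^sup>+w. ennreal ((tail_error n (\<lambda>j. X j w) t)\<^sup>2) \<partial>M) \<partial>mu 0)"
    by (intro Fubini'[symmetric]) measurable
  also have "\<dots> \<le> (\<integral>\<^sup>+t. ennreal (1 / real n) * ennreal (exp (- 1 * t)) \<partial>mu 0)"
    by (intro nn_integral_mono tail_error_second_moment n) auto
  also have "\<dots> = ennreal (1 / real n) * (\<integral>\<^sup>+t. ennreal (exp (- 1 * t)) \<partial>mu 0)"
    by (intro nn_integral_cmult) (auto intro!: borel_measurable_muI)
  also have "\<dots> \<le> ennreal (1 / real n) * ennreal (1 / 1)"
    by (intro mult_left_mono nn_integral_mu_exp) auto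
  finally show "(\<integral>\<^sup>+w. ennreal (?Q w) \<partial>M) \<le> ennreal (1 / real n)" by simp
qed

lemma empirical_Ha: "0 \<le> a \<Longrightarrow> empirical n w \<in> Ha a"
proof -
  assume a: "0 \<le> a"
  have "(\<lambda>t. 1 / sqrt (real n) * (\<Sum>j<n. psi (X j w) t)) \<in> Ha a"
    by (intro Ha_scale Ha_sum psi_Ha a)
  then show ?thesis by (simp add: empirical_def[abs_def])
qed

lemma empirical_borel: "empirical n w \<in> borel_measurable borel"
  unfolding empirical_def[abs_def] by measurable

text \<open>On the event where the three quantities are small, \<open>perturbed_norm_diff\<close>
  applies, the mean being at least 1/2 there. Elsewhere the left side is at most 1, and the last
  three terms already add up to at least 1. This is Markov's inequality in pointwise form, ready for
  taking expectations term by term.\<close>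

lemma laplace_pointwise_bound:
  assumes a: "0 \<le> a" and k: "0 \<le> k" and n: "0 < n" and d: "0 < \<delta>" "\<delta> \<le> 1 / 2" and L: "0 < L" and w: "w \<in> space M"
  defines "m \<equiv> sample_mean n (\<lambda>j. X j w)"
    and "Q \<equiv> (\<integral>t. (tail_error n (\<lambda>j. X j w) t)\<^sup>2 \<partial>mu 0)"
    and "A \<equiv> (\<integral>t. (empirical n w t)\<^sup>2 \<partial>mu 0)"
  shows "\<bar>exp (- k * test_statistic n a (\<lambda>j. X j w)) - exp (- k * (\<integral>t. (empirical n w t)\<^sup>2 \<partial>mu a))\<bar> \<le>
    k * (100 * \<delta> * (L + 1)) + (m - 1)\<^sup>2 * (1 / \<delta>\<^sup>2 + sqrt (real n) / (2 * \<delta>)) + Q * (sqrt (real n) / (2 * \<delta>)) + A * (1 / L)"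
    (is "?lhs \<le> ?b1 + ?b2 + ?b3 + ?b4")
proof -
  let ?T = "test_statistic n a (\<lambda>j. X j w)"
    and ?s = "\<integral>t. (empirical n w t)\<^sup>2 \<partial>mu a"
  have T0: "0 \<le> ?T"
    unfolding test_statistic_def set_lebesgue_integral_def
    by (intro mult_nonneg_nonneg integral_nonneg_AE) auto
  have S0: "0 \<le> ?s" by simp
  have Q0: "0 \<le> Q" and A0: "0 \<le> A" by (simp_all add: Q_def A_def)
  have sn: "0 < sqrt (real n)" using n by simp
  have b: "0 \<le> ?b1" "0 \<le> ?b2" "0 \<le> ?b3" "0 \<le> ?b4"
    using k d L sn Q0 A0 by auto
  have le1: "?lhs \<le> 1"
  proof -
    have "exp (- k * x) \<le> 1" "0 \<le> exp (- k * x)" if "0 \<le> x" for x using k that by auto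
    from this[OF T0] this[OF S0] show ?thesis by (simp only: abs_le_iff) linarith
  qed
  show ?thesis
  proof (cases "\<bar>m - 1\<bar> \<le> \<delta> \<and> real n * (m - 1)\<^sup>2 * Q \<le> \<delta>\<^sup>2 \<and> A \<le> L")
    case True
    define R where "R t = (sqrt (real n) * (m - 1)) * tail_error n (\<lambda>j. X j w) t" for t
    have m0: "0 < m" using True d by linarith
    have "(\<integral>t. (R t)\<^sup>2 \<partial>mu 0) = real n * (m - 1)\<^sup>2 * Q"
      by (simp add: R_def power_mult_distrib Q_def)
    moreover have "R \<in> Ha 0" unfolding R_def by (intro Ha_scale tail_error_Ha) simp
    moreover have "R \<in> borel_measurable borel" unfolding R_def by measurable
    ultimately have "\<bar>(\<integral>t. (empirical n w t - R t)\<^sup>2 \<partial>mu (a / m)) / m ^ 3 - ?s\<bar> \<le> 100 * \<delta> * (L + 1)"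
      using True d by (intro perturbed_norm_diff a empirical_Ha empirical_borel) (auto simp: A_def)
    moreover have "(\<lambda>t. empirical n w t - R t) = centred_sum n (\<lambda>j. X j w)"
      using centred_sum_decomp[OF n, of "\<lambda>j. X j w"] by (simp add: fun_eq_iff empirical_def R_def m_def)
    ultimately have "\<bar>?T - ?s\<bar> \<le> 100 * \<delta> * (L + 1)"
      using test_statistic_rescaled[of n "\<lambda>j. X j w" a] m0 by (simp add: m_def fun_eq_iff)
    then have "?lhs \<le> ?b1"
      by (intro order_trans[OF exp_diff_le[OF T0 S0 k]] mult_left_mono k)
    then show ?thesis using b by linarith
  next
    case False
    then consider "\<delta> < \<bar>m - 1\<bar>" | "\<delta>\<^sup>2 < real n * (m - 1)\<^sup>2 * Q" | "L < A" by linarith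
    then have "1 \<le> ?b2 + ?b3 + ?b4"
    proof cases
      case 1
      then have "\<delta>\<^sup>2 \<le> (m - 1)\<^sup>2" using d power_mono[of \<delta> "\<bar>m - 1\<bar>" 2] by simp
      then have "1 \<le> (m - 1)\<^sup>2 * (1 / \<delta>\<^sup>2)" using d by (simp add: field_simps)
      also have "\<dots> \<le> ?b2" using d sn by (intro mult_left_mono) auto
      finally show ?thesis using b by linarith
    next
      case 2
      \<comment> \<open>A product above the square of \<delta> forces \<open>x + y\<close> above
        \<open>2 * \<delta>\<close>, so the dependent factors enter additively. Distributing
        \<open>sqrt (real n)\<close> evenly bounds the expectation of each by
        \<open>1 / sqrt (real n)\<close>.\<close>
      define x y where "x = sqrt (real n) * (m - 1)\<^sup>2" and "y = sqrt (real n) * Q"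
      have "x * y = real n * (m - 1)\<^sup>2 * Q" by (simp add: x_def y_def)
      with 2 have "\<delta>\<^sup>2 < x * y" by simp
      moreover have "4 * (x * y) \<le> (x + y)\<^sup>2"
        using zero_le_power2[of "x - y"] by (simp add: power2_eq_square algebra_simps)
      ultimately have "(2 * \<delta>)\<^sup>2 < (x + y)\<^sup>2" by (simp add: power_mult_distrib)
      moreover have xy: "0 \<le> x" "0 \<le> y" using Q0 by (simp_all add: x_def y_def)
      ultimately have "2 * \<delta> < x + y" using power2_less_imp_less[of "2 * \<delta>" "x + y"] by simp
      then have "1 \<le> (x + y) / (2 * \<delta>)" using d by simp
      also have "\<dots> = (m - 1)\<^sup>2 * (sqrt (real n) / (2 * \<delta>)) + ?b3"
        by (simp add: x_def y_def add_divide_distrib mult.commute)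
      also have "\<dots> \<le> ?b2 + ?b3"
        using d by (intro add_right_mono mult_left_mono) auto
      finally show ?thesis using b by linarith
    next
      case 3
      then have "1 \<le> ?b4" using L by (simp add: field_simps)
      then show ?thesis using b by linarith
    qed
    then show ?thesis using le1 b by linarith
  qed
qed

text \<open>The pointwise bound is integrated with the expectations \<open>1 / n\<close> for the
  squared mean error, at most \<open>1 / n\<close> for the squared tail error and at most 1 for the
  squared empirical norm.\<close>

lemma laplace_perturbation:
  assumes a: "0 \<le> a" and k: "0 \<le> k" and n: "0 < n" and d: "0 < \<delta>" "\<delta> \<le> 1 / 2" and L: "0 < L"
  shows "\<bar>(\<integral>w. exp (- k * test_statistic n a (\<lambda>j. X j w)) \<partial>M) - (\<integral>w. exp (- k * (\<integral>t. (empirical n w t)\<^sup>2 \<partial>mu a)) \<partial>M)\<bar> \<le>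
    k * (100 * \<delta> * (L + 1)) + 1 / L + (1 / (\<delta>\<^sup>2 * real n) + 1 / (\<delta> * sqrt (real n)))"
proof -
  let ?T = "\<lambda>w. exp (- k * test_statistic n a (\<lambda>j. X j w))" and ?S = "\<lambda>w. exp (- k * (\<integral>t. (empirical n w t)\<^sup>2 \<partial>mu a))"
  let ?m = "\<lambda>w. (sample_mean n (\<lambda>j. X j w) - 1)\<^sup>2"
  let ?Q = "\<lambda>w. \<integral>t. (tail_error n (\<lambda>j. X j w) t)\<^sup>2 \<partial>mu 0"
  let ?A = "\<lambda>w. \<integral>t. (empirical n w t)\<^sup>2 \<partial>mu 0"
  define c where "c = sqrt (real n) / (2 * \<delta>)"
  have sn: "0 < sqrt (real n)" "sqrt (real n) * sqrt (real n) = real n" using n by auto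
  have c0: "0 \<le> c" using d by (simp add: c_def)
  note [measurable] = measurable_test_statistic[of n a] measurable_integral_sq[OF bridge_bounds_empirical, of a n]
    measurable_integral_sq[OF bridge_bounds_empirical, of 0 n] mean_tail_error(2)[OF n]
  have T0: "0 \<le> test_statistic n a x" for x
    unfolding test_statistic_def set_lebesgue_integral_def
    by (intro mult_nonneg_nonneg integral_nonneg_AE) auto
  have i: "integrable M ?T" "integrable M ?S"
    by (rule integrable_const_bound[where B=1]; use k T0 in auto)+
  have EA: "(\<integral>\<^sup>+w. ennreal (?A w) \<partial>M) \<le> ennreal 1"
  proof -
    have "(\<integral>\<^sup>+w. ennreal (?A w) \<partial>M) = (\<integral>\<^sup>+w. (\<integral>\<^sup>+t. ennreal ((empirical n w t)\<^sup>2) \<partial>mu 0) \<partial>M)"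
      by (intro nn_integral_cong nn_integral_eq_integral[symmetric] Ha_sq_integrable empirical_Ha) auto
    also have "\<dots> \<le> 1"
      by (rule bridge_bounds_integrable(1)[OF prob_space_axioms bridge_bounds_empirical]) simp
    finally show ?thesis by simp
  qed
  have "ennreal \<bar>(\<integral>w. ?T w \<partial>M) - (\<integral>w. ?S w \<partial>M)\<bar> = ennreal (norm (\<integral>w. ?T w - ?S w \<partial>M))"
    using i by simp
  also have "\<dots> \<le> (\<integral>\<^sup>+w. ennreal (norm (?T w - ?S w)) \<partial>M)"
    by (intro integral_norm_bound_ennreal Bochner_Integration.integrable_diff i)
  also have "\<dots> \<le> (\<integral>\<^sup>+w. ennreal (k * (100 * \<delta> * (L + 1))) + ennreal (1 / \<delta>\<^sup>2 + c) * ennreal (?m w) + ennreal c * ennreal (?Q w) + ennreal (1 / L) * ennreal (?A w) \<partial>M)"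
  proof (rule nn_integral_mono)
    fix w assume w: "w \<in> space M"
    have "\<bar>?T w - ?S w\<bar> \<le> k * (100 * \<delta> * (L + 1)) + (1 / \<delta>\<^sup>2 + c) * ?m w + c * ?Q w + (1 / L) * ?A w"
      using laplace_pointwise_bound[OF a k n d L w] by (simp only: c_def mult.commute)
    then have "ennreal (norm (?T w - ?S w)) \<le> ennreal (k * (100 * \<delta> * (L + 1)) + (1 / \<delta>\<^sup>2 + c) * ?m w + c * ?Q w + (1 / L) * ?A w)"
      by (intro ennreal_leI) simp
    also have "\<dots> = ennreal (k * (100 * \<delta> * (L + 1))) + ennreal (1 / \<delta>\<^sup>2 + c) * ennreal (?m w) + ennreal c * ennreal (?Q w) + ennreal (1 / L) * ennreal (?A w)"
      using k d L c0 by (subst (1 2 3) ennreal_mult[symmetric]; simp add: ennreal_plus)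
    finally show "ennreal (norm (?T w - ?S w)) \<le> ennreal (k * (100 * \<delta> * (L + 1))) + ennreal (1 / \<delta>\<^sup>2 + c) * ennreal (?m w) + ennreal c * ennreal (?Q w) + ennreal (1 / L) * ennreal (?A w)" .
  qed
  also have "\<dots> = ennreal (k * (100 * \<delta> * (L + 1))) + ennreal (1 / \<delta>\<^sup>2 + c) * (\<integral>\<^sup>+w. ennreal (?m w) \<partial>M) + ennreal c * (\<integral>\<^sup>+w. ennreal (?Q w) \<partial>M) + ennreal (1 / L) * (\<integral>\<^sup>+w. ennreal (?A w) \<partial>M)"
    by (simp add: nn_integral_add nn_integral_cmult emeasure_space_1)
  also have "\<dots> \<le> ennreal (k * (100 * \<delta> * (L + 1))) + ennreal (1 / \<delta>\<^sup>2 + c) * ennreal (1 / real n) + ennreal c * ennreal (1 / real n) + ennreal (1 / L) * ennreal 1"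
    by (intro add_mono mult_left_mono EA mean_tail_error(1)[OF n] order_refl sample_mean_second_moment[OF n, THEN eq_refl]) auto
  also have "\<dots> = ennreal (k * (100 * \<delta> * (L + 1)) + (1 / \<delta>\<^sup>2 + c) * (1 / real n) + c * (1 / real n) + 1 / L * 1)"
    using k d L c0 by (subst (1 2 3) ennreal_mult[symmetric]; simp add: ennreal_plus)
  finally have "\<bar>(\<integral>w. ?T w \<partial>M) - (\<integral>w. ?S w \<partial>M)\<bar> \<le> k * (100 * \<delta> * (L + 1)) + (1 / \<delta>\<^sup>2 + c) * (1 / real n) + c * (1 / real n) + 1 / L * 1"
    using k d L c0 by (subst (asm) ennreal_le_iff) auto
  also have "\<dots> = k * (100 * \<delta> * (L + 1)) + 1 / L + (1 / (\<delta>\<^sup>2 * real n) + 2 * c / real n)"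
    using d n by (simp add: field_simps)
  also have "2 * c / real n = 1 / (\<delta> * sqrt (real n))"
  proof -
    define s where "s = sqrt (real n)"
    have "2 * (s / (2 * \<delta>)) / (s * s) = 1 / (\<delta> * s)"
      using d sn(1) by (simp add: s_def[symmetric] field_simps)
    then show ?thesis using sn(2) by (simp add: c_def s_def)
  qed
  finally show ?thesis .
qed

lemma laplace_perturbation_conv:
  assumes a: "0 \<le> a" and k: "0 \<le> k"
  shows "(\<lambda>n. (\<integral>w. exp (- k * test_statistic n a (\<lambda>j. X j w)) \<partial>M) - (\<integral>w. exp (- k * (\<integral>t. (empirical n w t)\<^sup>2 \<partial>mu a)) \<partial>M)) \<longlonglongrightarrow> 0"
proof (rule LIMSEQ_I)
  let ?T = "\<lambda>n. \<integral>w. exp (- k * test_statistic n a (\<lambda>j. X j w)) \<partial>M"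
    and ?S = "\<lambda>n. \<integral>w. exp (- k * (\<integral>t. (empirical n w t)\<^sup>2 \<partial>mu a)) \<partial>M"
  fix r :: real assume r: "0 < r"
  \<comment> \<open>The order of choice matters: \<open>L\<close> bounds the probability of a large
    norm, \<delta> is then small relative to \<open>L\<close>, and \<open>n\<close> comes last. The
    factor \<open>k + 1\<close> keeps the denominator positive for \<open>k = 0\<close>.\<close>
  define L where "L = 4 / r"
  define \<delta> where "\<delta> = min (1 / 2) (r / (4 * (k + 1) * 100 * (L + 1)))"
  have L: "0 < L" using r by (simp add: L_def)
  have d: "0 < \<delta>" "\<delta> \<le> 1 / 2"
    unfolding \<delta>_def using r k L by (simp_all only: min.cobounded1) (simp add: min_less_iff_conj)
  have kd: "k * (100 * \<delta> * (L + 1)) \<le> r / 4"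
  proof -
    define D where "D = r / (4 * (k + 1) * 100 * (L + 1))"
    have "100 * \<delta> * (L + 1) \<le> 100 * D * (L + 1)"
      using L by (intro mult_right_mono) (auto simp: \<delta>_def D_def)
    then have "k * (100 * \<delta> * (L + 1)) \<le> (k + 1) * (100 * D * (L + 1))"
      using k L d by (intro mult_mono) auto
    also have "(k + 1) * (100 * D * (L + 1)) = r / 4"
    proof -
      have "p * (100 * (r / (4 * p * 100 * q)) * q) = r / 4" if "p \<noteq> 0" "q \<noteq> 0" for p q :: real
        using that by (simp add: field_simps)
      from this[of "k + 1" "L + 1"] show ?thesis using k L by (simp add: D_def)
    qed
    finally show ?thesis .
  qed
  have "(\<lambda>n. 1 / (\<delta>\<^sup>2 * real n) + 1 / (\<delta> * sqrt (real n))) \<longlonglongrightarrow> 0"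
  proof -
    have "(\<lambda>n. 1 / \<delta>\<^sup>2 * inverse (real n) + 1 / \<delta> * sqrt (inverse (real n))) \<longlonglongrightarrow> 1 / \<delta>\<^sup>2 * 0 + 1 / \<delta> * sqrt 0"
      by (intro tendsto_intros LIMSEQ_inverse_real_of_nat_add lim_inverse_n)
    then show ?thesis by (simp add: real_sqrt_inverse divide_inverse mult.commute)
  qed
  then obtain n0 where n0: "\<And>n. n \<ge> n0 \<Longrightarrow> \<bar>1 / (\<delta>\<^sup>2 * real n) + 1 / (\<delta> * sqrt (real n))\<bar> < r / 4"
    using LIMSEQ_D[of _ 0 "r / 4"] r by fastforce
  show "\<exists>no. \<forall>n\<ge>no. norm ((?T n) - (?S n) - 0) < r"
  proof (intro exI allI impI)
    fix n assume n: "n \<ge> max 1 n0"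
    have "1 / L = r / 4" using r by (simp add: L_def)
    moreover have "0 < n" "n0 \<le> n" using n by auto
    note laplace_perturbation[OF a k this(1) d L] n0[OF this(2)]
    ultimately show "norm ((?T n) - (?S n) - 0) < r"
      using kd r unfolding real_norm_def diff_0_right by linarith
  qed
qed

end

theorem theorem2p1:
  fixes M :: "'w measure" and X :: "nat \<Rightarrow> 'w \<Rightarrow> real" and a :: real
  assumes "prob_space M"
    and "a \<ge> 0"
    and "prob_space.indep_vars M (\<lambda>_. borel) X UNIV"
    and "\<And>j. distributed M lborel (X j) (\<lambda>x. ennreal (exponential_density 1 x))"
  shows "\<exists>(P :: (nat \<Rightarrow> real) measure) (Z :: (nat \<Rightarrow> real) \<Rightarrow> real \<Rightarrow> real).
    prob_space P \<and> gaussian_element P a Z \<and> centred P a Z \<and> has_covariance_kernel P a Z K0 \<and>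
    weak_conv_m (\<lambda>n. distr M borel (\<lambda>w. test_statistic n a (\<lambda>j. X j w)))
      (distr P borel (\<lambda>w. (Ha_norm a (Z w))\<^sup>2))"
proof -
  interpret exp_sample M X
    using assms by (intro exp_sample.intro exp_sample_axioms.intro) auto
  have "weak_conv_m (\<lambda>n. distr M borel (\<lambda>w. test_statistic n a (\<lambda>j. X j w)))
      (distr gauss borel (\<lambda>z. (Ha_norm a (bridge_limit a z))\<^sup>2))"
  proof (rule laplace_imp_weak_conv[OF assms(1) prob_space_gauss])
    show "(\<lambda>w. test_statistic n a (\<lambda>j. X j w)) \<in> borel_measurable M" for n
      by (rule measurable_test_statistic)
    show "(\<lambda>z. (Ha_norm a (bridge_limit a z))\<^sup>2) \<in> borel_measurable gauss"
      using measurable_Ha_norm_bridge_limit[OF assms(2)] by measurable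
    show "0 \<le> test_statistic n a (\<lambda>j. X j w)" for n w
      unfolding test_statistic_def set_lebesgue_integral_def
      by (intro mult_nonneg_nonneg integral_nonneg_AE) auto
    fix k :: nat
    have k: "0 \<le> real k" by simp
    \<comment> \<open>Three limits telescope: statistic minus empirical norm, empirical norm minus
      norm of the partial series, and norm of the partial series to that of its limit.\<close>
    from tendsto_add[OF laplace_perturbation_conv[OF assms(2) k]
        tendsto_add[OF laplace_universal[OF assms(1) bridge_bounds_empirical prob_space_gauss bridge_bounds_levy_sum
            empirical_char_conv levy_sum_char_conv k assms(2)] levy_sum_laplace_conv[OF assms(2) k]]]
    show "(\<lambda>n. \<integral>w. exp (- real k * test_statistic n a (\<lambda>j. X j w)) \<partial>M) \<longlonglongrightarrow>
        (\<integral>z. exp (- real k * (Ha_norm a (bridge_limit a z))\<^sup>2) \<partial>gauss)"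
      by simp
  qed simp
  then show ?thesis
    using prob_space_gauss gaussian_element_bridge_limit[OF assms(2)] centred_bridge_limit[OF assms(2)]
      covariance_bridge_limit[OF assms(2)] by blast
qed

end
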